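(* Let $\mathcal{C}=\{\tau\in F_0:\ \gamma\cdot\tau \text{ is a critical point of } E_2 \text{ for some }\gamma\in\Gamma_0(2)\}$. Then $$\mathcal{C}=\left\{\tau\!\left(\tfrac{-d}{c}\right):\begin{pmatrix}a&b\\c&d\end{pmatrix}\in\Gamma_0(2),\ c\neq0\right\}\subset\mathcal{C}_-\cup\mathcal{C}_0\cup\mathcal{C}_+,$$ and the closure of $\mathcal{C}$ intersected with $F_0$ satisfies $\overline{\mathcal{C}}\cap F_0=\mathcal{C}_-\cup\mathcal{C}_0\cup\mathcal{C}_+$.
   Context: $\mathbb{H}$ is the upper half plane; for $\tau\in\mathbb{H}$, $\Lambda_\tau=\mathbb{Z}+\mathbb{Z}\tau$, $\wp(z|\tau)$ is the Weierstrass function, $\zeta(z|\tau)$ the Weierstrass zeta function ($\zeta'=-\wp$), $\eta_1(\tau)=2\zeta(\frac12|\tau)$, $\eta_2(\tau)=2\zeta(\frac\tau2|\tau)=\tau\eta_1(\tau)-2\pi i$, and $g_2(\tau)=60\sum_{(m,n)\neq(0,0)}(m\tau+n)^{-4}$. $E_2=\frac{3}{\pi^2}\eta_1$ is the normalized weight-2 Eisenstein series; a critical point of $E_2$ is a zero of $E_2'$. $\Gamma_0(2)=\{\begin{pmatrix}a&b\\c&d\end{pmatrix}\in SL(2,\mathbb{Z}):2\mid c\}$ acts by Möbius transformations. $F_0=\{\tau\in\mathbb{H}:0\le\operatorname{Re}\tau\le1,|\tau-\frac12|\ge\frac12\}$. For $C\in\mathbb{R}$ put $f_C(\tau)=12(C\eta_1(\tau)-\eta_2(\tau))^2-g_2(\tau)(C-\tau)^2$.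 For every $C\in\mathbb{R}\setminus\{0,1\}$, $f_C$ has exactly one zero in $F_0$ (it lies in the interior of $F_0$); denote it $\tau(C)$. Define $\mathcal{C}_0=\{\tau(C):C\in(0,1)\}$, $\mathcal{C}_-=\{\tau(C):C\in(-\infty,0)\}$, $\mathcal{C}_+=\{\tau(C):C\in(1,\infty)\}$. *)

theory Defs
  imports "HOL-Complex_Analysis.Complex_Analysis"
begin

definition upper_half_plane :: "complex set" where
  "upper_half_plane = {\<tau>. Im \<tau> > 0}"

definition period_lattice :: "complex \<Rightarrow> complex set" where
  "period_lattice \<tau> = {of_int m + of_int n * \<tau> | m n. True}"

text \<open>
  The Weierstrass zeta function: the odd antiderivative of minus the Weierstrass elliptic
  function, given by its Mittag-Leffler series. For \<open>\<tau>\<close> in the upper half plane the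
  unordered series converges absolutely. Its value at a lattice point, where the function has a
  pole, is meaningless.
\<close>

definition weierstrass_zeta :: "complex \<Rightarrow> complex \<Rightarrow> complex" where
  "weierstrass_zeta z \<tau> =
     1 / z + (\<Sum>\<^sub>\<infinity>\<omega>\<in>period_lattice \<tau> - {0}. (1 / (z - \<omega>) + 1 / \<omega> + z / \<omega>\<^sup>2))"

definition eta1 :: "complex \<Rightarrow> complex" where
  "eta1 \<tau> = 2 * weierstrass_zeta (1/2) \<tau>"

definition eta2 :: "complex \<Rightarrow> complex" where
  "eta2 \<tau> = 2 * weierstrass_zeta (\<tau>/2) \<tau>"

definition g2 :: "complex \<Rightarrow> complex" where
  "g2 \<tau> = 60 * (\<Sum>\<^sub>\<infinity>(m::int, n::int)\<in>UNIV - {(0, 0)}. 1 / (of_int m * \<tau> + of_int n) ^ 4)"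

definition E2 :: "complex \<Rightarrow> complex" where
  "E2 \<tau> = 3 / of_real pi ^ 2 * eta1 \<tau>"

definition critical_point_E2 :: "complex \<Rightarrow> bool" where
  "critical_point_E2 \<tau> \<longleftrightarrow> \<tau> \<in> upper_half_plane \<and> deriv E2 \<tau> = 0"

definition Gamma0_2 :: "(int^2^2) set" where
  "Gamma0_2 = {A. det A = 1 \<and> 2 dvd A $ 2 $ 1}"

definition moebius :: "int^2^2 \<Rightarrow> complex \<Rightarrow> complex" where
  "moebius A \<tau> = (of_int (A $ 1 $ 1) * \<tau> + of_int (A $ 1 $ 2)) /
                 (of_int (A $ 2 $ 1) * \<tau> + of_int (A $ 2 $ 2))"

definition F0 :: "complex set" where
  "F0 = {\<tau> \<in> upper_half_plane. 0 \<le> Re \<tau> \<and> Re \<tau> \<le> 1 \<and> cmod (\<tau> - 1/2) \<ge> 1/2}"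

definition f_fam :: "real \<Rightarrow> complex \<Rightarrow> complex" where
  "f_fam C \<tau> = 12 * (of_real C * eta1 \<tau> - eta2 \<tau>)\<^sup>2 - g2 \<tau> * (of_real C - \<tau>)\<^sup>2"

text \<open>
  The zero of \<open>f_fam C\<close> in \<open>F0\<close>; it is unique for real \<open>C\<close> other than \<open>0\<close> and \<open>1\<close>,
  and only such \<open>C\<close> are used below.
\<close>

definition tau_zero :: "real \<Rightarrow> complex" where
  "tau_zero C = (THE \<tau>. \<tau> \<in> F0 \<and> f_fam C \<tau> = 0)"

definition curve_0 :: "complex set" where
  "curve_0 = tau_zero ` {0<..<1}"

definition curve_minus :: "complex set" where
  "curve_minus = tau_zero ` {..<0}"

definition curve_plus :: "complex set" where
  "curve_plus = tau_zero ` {1<..}"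

definition crit_set :: "complex set" where
  "crit_set = {\<tau> \<in> F0. \<exists>\<gamma>\<in>Gamma0_2. critical_point_E2 (moebius \<gamma> \<tau>)}"

end

theory Submission
  imports Defs
begin

text \<open>
  Put \<open>v = x - y * \<tau>\<close> and let \<open>f_hom x y\<close> be the form homogeneous of degree 2 in the parameter
  \<open>C = x / y\<close> that specialises to \<open>f_fam C\<close> for \<open>(C, 1)\<close> and to a nonzero multiple of the derivative
  of \<open>E2\<close> for \<open>(1, 0)\<close>. It is equivariant under \<open>SL(2, Z)\<close>, so \<open>\<gamma> \<tau>\<close> is critical for \<open>E2\<close>
  exactly if \<open>f_hom d (-c) \<tau> = 0\<close>. Hence everything follows from the facts that, for \<open>\<tau>\<close> in \<open>F0\<close>,
  \<open>f_fam C\<close> has exactly one zero if \<open>C\<close> is real and different from 0 and 1, and none if \<open>C\<close>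
  is one of the cusps 0, 1, \<open>\<infinity>\<close>.

  Partial fractions of the cotangent give the \<open>q\<close>-expansions of \<open>eta1\<close> and \<open>g2\<close> and the Legendre
  relation. There are no cusp forms of weight at most 8, which yields Ramanujan's differential
  equations; these imply that all zeros of \<open>f_fam C\<close> are simple, because the discriminant does not
  vanish. The \<open>q\<close>-expansion shows that \<open>C = \<infinity>\<close> has no zeros in \<open>F0\<close>, and the element of order 3 that
  permutes the cusps of \<open>F0\<close> reduces the other cusps to this one and real \<open>C\<close> to \<open>C > 1\<close>. On the
  imaginary axis \<open>eta1\<close> and \<open>g2\<close> are real and \<open>g2 > 0\<close>, so no zeros lie on the boundary of \<open>F0\<close>.
  As zeros cannot escape into a cusp while \<open>C\<close> stays in a compact part of \<open>(1, \<infinity>)\<close>, their number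
  is constant there, and for large \<open>C\<close> it is one: the zero with \<open>q\<close> close to \<open>\<i> / (24 * pi * C)\<close>.
\<close>

section \<open>Partial fractions of the cotangent\<close>

text \<open>The zeros are counted without contour integrals: having exactly one zero in
  \<open>F0\<close> is shown to be a locally constant property of \<open>C > 1\<close>. Simple zeros
  persist under small changes of \<open>C\<close> and, lying in the interior, stay in
  \<open>F0\<close>; compactness keeps further ones from appearing. The obstacle is that
  \<open>F0\<close> has three cusps. Near \<open>\<infinity>\<close> the equation reads
  \<open>C = \<tau> + \<i> / (24 * pi * q) + ...\<close> with \<open>q = nome \<tau>\<close>, so a
  zero can approach this cusp only if \<open>\<bar>C\<bar>\<close> grows. The rotation
  \<open>\<tau> \<mapsto> 1 / (1 - \<tau>)\<close> carries this to the other two cusps, with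
  \<open>C\<close> replaced by \<open>1 / (1 - C)\<close> and \<open>(C - 1) / C\<close>. Hence
  zeros escape only when \<open>C\<close> tends to \<open>\<infinity>\<close>, 1 or 0, the ends of
  the three parameter intervals. A second obstacle is that the series of
  \<open>weierstrass_zeta\<close> converges absolutely, but its parts do not; they are summed row by
  row, and the boundary rows produce the term \<open>- 2 * pi * \<i>\<close> of the Legendre
  relation.\<close>

lemma has_sum_int_halves:
  fixes f :: "int \<Rightarrow> 'a :: {topological_comm_monoid_add, t2_space}"
  assumes "((\<lambda>n::nat. f (int n)) has_sum a) UNIV" "((\<lambda>n::nat. f (-1 - int n)) has_sum b) UNIV"
  shows "(f has_sum (a + b)) UNIV"
proof -
  have "(f has_sum a) (range int)"
    using assms(1) by (subst has_sum_reindex) (auto simp: o_def)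
  moreover have "(f has_sum b) (range (\<lambda>n. -1 - int n))"
    using assms(2) by (subst has_sum_reindex) (auto simp: o_def inj_def)
  moreover have "range int \<inter> range (\<lambda>n. -1 - int n) = {}" by auto
  moreover have "range int \<union> range (\<lambda>n. -1 - int n) = UNIV"
  proof -
    have "x \<in> range int \<union> range (\<lambda>n. -1 - int n)" for x
    proof (cases "x \<ge> 0")
      case True then have "x = int (nat x)" by simp
      then show ?thesis by blast
    next
      case False then have "x = -1 - int (nat (-1 - x))" by simp
      then show ?thesis by blast
    qed
    then show ?thesis by blast
  qed
  ultimately show ?thesis using has_sum_Un_disjoint by metis
qed

text \<open>Both ranges are needed: the half-open one pairs \<open>n\<close> with
  \<open>-1 - n\<close> and fits the reflection \<open>w \<mapsto> 1 - w\<close> of the polygamma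
  functions, the symmetric one lets odd terms cancel.\<close>

lemma has_sum_int_tendsto:
  fixes f :: "int \<Rightarrow> 'a :: {topological_comm_monoid_add, t2_space}"
  assumes "(f has_sum S) UNIV"
  shows "(\<lambda>N. \<Sum>m\<in>{-int N..int N}. f m) \<longlonglongrightarrow> S" "(\<lambda>N. \<Sum>m\<in>{-int N..<int N}. f m) \<longlonglongrightarrow> S"
proof -
  have ev: "\<forall>\<^sub>F N in sequentially. X \<subseteq> {-int N..<int N}" if "finite X" for X
  proof -
    have B: "\<bar>x\<bar> \<le> Max (abs ` X)" if "x \<in> X" for x
      using \<open>finite X\<close> that by simp
    have "X \<subseteq> {-int N..<int N}" if "N \<ge> nat (Max (abs ` X)) + 1" for N
    proof
      fix x assume "x \<in> X"
      from B[OF this] that show "x \<in> {-int N..<int N}" by auto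
    qed
    then show ?thesis by (rule eventually_sequentiallyI)
  qed
  have ev': "\<forall>\<^sub>F N in sequentially. X \<subseteq> {-int N..int N}" if "finite X" for X
    by (rule eventually_mono[OF ev[OF that]]) auto
  have "filterlim (\<lambda>N. {-int N..<int N}) (finite_subsets_at_top UNIV) sequentially"
    "filterlim (\<lambda>N. {-int N..int N}) (finite_subsets_at_top UNIV) sequentially"
    unfolding filterlim_finite_subsets_at_top using ev ev' by simp_all
  then show "(\<lambda>N. \<Sum>m\<in>{-int N..int N}. f m) \<longlonglongrightarrow> S" "(\<lambda>N. \<Sum>m\<in>{-int N..<int N}. f m) \<longlonglongrightarrow> S"
    using assms unfolding has_sum_def by (auto intro: filterlim_compose)
qed

lemma sin_pi_times_nonzero:
  fixes z :: complex
  assumes "z \<notin> \<int>" shows "sin (of_real pi * z) \<noteq> 0"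
proof
  assume "sin (of_real pi * z) = 0"
  then obtain n :: int where "of_real pi * z = of_real (of_int n * pi)" by (auto simp: sin_eq_0)
  then have "z = of_int n" by (simp add: mult.commute)
  then show False using assms by simp
qed

lemma not_nonpos_Ints_reflect:
  fixes z :: complex
  assumes "z \<notin> \<int>" shows "z \<notin> \<int>\<^sub>\<le>\<^sub>0" "1 - z \<notin> \<int>\<^sub>\<le>\<^sub>0"
  using assms nonpos_Ints_Int[of z] nonpos_Ints_Int[of "1 - z"] Ints_diff[OF Ints_1, of "1 - z"] by auto

text \<open>Logarithmic derivative of the reflection formula
  \<open>Gamma z * Gamma (1 - z) = pi / sin (pi * z)\<close>.\<close>

lemma Digamma_reflection_complex:
  fixes z :: complex
  assumes "z \<notin> \<int>"
  shows "Digamma (1 - z) - Digamma z = of_real pi * cot (of_real pi * z)"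
proof -
  note nz = not_nonpos_Ints_reflect[OF assms] and s = sin_pi_times_nonzero[OF assms]
  have "((\<lambda>z. Gamma z * Gamma (1 - z)) has_field_derivative
      Gamma z * Gamma (1 - z) * (Digamma z - Digamma (1 - z))) (at z)"
    using nz by (auto intro!: derivative_eq_intros simp: algebra_simps)
  moreover have "((\<lambda>z. Gamma z * Gamma (1 - z)) has_field_derivative
      - (of_real pi / sin (of_real pi * z)) * (of_real pi * cot (of_real pi * z))) (at z)"
    unfolding Gamma_reflection_complex using s
    by (auto intro!: derivative_eq_intros simp: cot_def field_simps power2_eq_square)
  ultimately have "Gamma z * Gamma (1 - z) * (Digamma z - Digamma (1 - z)) =
     - (of_real pi / sin (of_real pi * z)) * (of_real pi * cot (of_real pi * z))"
    by (rule DERIV_unique)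
  then have "of_real pi / sin (of_real pi * z) * (Digamma z - Digamma (1 - z)) =
     of_real pi / sin (of_real pi * z) * (- (of_real pi * cot (of_real pi * z)))"
    unfolding Gamma_reflection_complex by simp
  then have "Digamma z - Digamma (1 - z) = - (of_real pi * cot (of_real pi * z))"
    using s by (subst (asm) mult_cancel_left) auto
  then show ?thesis by (simp add: algebra_simps)
qed

lemma int_sum_split:
  fixes f :: "int \<Rightarrow> 'a :: comm_monoid_add"
  shows "(\<Sum>m\<in>{-int N..<int N}. f m) = (\<Sum>n<N. f (int n) + f (-1 - int n))"
proof (induction N)
  case (Suc N)
  have "{-int (Suc N)..<int (Suc N)} = insert (int N) (insert (-1 - int N) {-int N..<int N})" by auto
  then show ?case using Suc by (simp add: add_ac)
qed auto

text \<open>At \<open>w = 0\<close> the terms cancel in pairs, with \<open>1 / 0 = 0\<close>, except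
  for \<open>m = -N\<close>, which contributes \<open>-1 / N\<close>; the right side is 0 as well.
  Including this value covers the row \<open>n = 0\<close> of the lattice.\<close>

lemma cot_partial_fractions:
  fixes w :: complex
  assumes "w \<notin> \<int> \<or> w = 0"
  shows "(\<lambda>N. \<Sum>m\<in>{-int N..<int N}. 1 / (w + of_int m)) \<longlonglongrightarrow> of_real pi * cot (of_real pi * w)"
proof (cases "w = 0")
  case True
  have step: "1 / of_nat N + 1 / (- 1 - of_nat N) = - 1 / of_nat (Suc N) + 1 / (of_nat N :: complex)" for N
  proof -
    have "- 1 - of_nat N = - (of_nat (Suc N) :: complex)" by simp
    then show ?thesis by (simp only: divide_minus_right) simp
  qed
  have *: "(\<Sum>m\<in>{-int N..<int N}. 1 / (w + of_int m)) = - 1 / of_nat N" for N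
  proof (induction N)
    case (Suc N)
    have "(\<Sum>m\<in>{-int (Suc N)..<int (Suc N)}. 1 / (w + of_int m)) = - 1 / of_nat N + (1 / of_nat N + 1 / (- 1 - of_nat N))"
      using Suc True unfolding int_sum_split by simp
    then show ?case unfolding step by simp
  qed auto
  have "(\<lambda>N. - 1 / (of_nat N :: complex)) \<longlonglongrightarrow> 0"
    by (rule tendsto_divide_0[OF tendsto_const]) (rule tendsto_of_nat)
  then show ?thesis unfolding * using True by simp
next
  case False
  then have w: "w \<notin> \<int>" using assms by auto
  have nz: "w \<noteq> 0" "1 - w \<noteq> 0" using w by auto
  \<comment> \<open>The terms \<open>m = n\<close> and \<open>m = -1 - n\<close> form the partial
    sums for \<open>Digamma\<close> at \<open>w\<close> and at \<open>1 - w\<close>; the divergent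
    logarithms cancel.\<close>
  have eq: "(\<Sum>m\<in>{-int N..<int N}. 1 / (w + of_int m)) =
     (of_real (ln (real N)) - (\<Sum>n<N. inverse (1 - w + of_nat n)))
     - (of_real (ln (real N)) - (\<Sum>n<N. inverse (w + of_nat n)))" for N
  proof -
    have "w + of_int (-1 - int n) = - (1 - w + of_nat n)" for n by simp
    then have "1 / (w + of_int (-1 - int n)) = - inverse (1 - w + of_nat n)" for n
      by (simp only: divide_minus_right inverse_eq_divide)
    then show ?thesis unfolding int_sum_split by (simp only: of_int_of_nat_eq inverse_eq_divide[symmetric]) (simp add: sum_subtractf)
  qed
  show ?thesis unfolding eq Digamma_reflection_complex[OF w, symmetric]
    by (intro tendsto_diff Digamma_LIMSEQ nz)
qed

lemma summable_norm_inverse_power: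
  fixes w :: complex
  assumes "k \<ge> 2"
  shows "summable (\<lambda>n. norm (inverse ((w + of_nat n) ^ k)))"
proof (rule summable_comparison_test_ev)
  show "summable (\<lambda>n. 2 ^ k * (1 / (real n) ^ k))"
    using assms by (intro summable_mult) (simp add: inverse_power_summable inverse_eq_divide[symmetric] power_inverse)
  show "\<forall>\<^sub>F n in sequentially. norm (norm (inverse ((w + of_nat n) ^ k))) \<le> 2 ^ k * (1 / (real n) ^ k)"
  proof (rule eventually_sequentiallyI[of "nat \<lceil>2 * norm w\<rceil> + 1"])
    fix n assume n: "nat \<lceil>2 * norm w\<rceil> + 1 \<le> n"
    then have "2 * norm w \<le> n" "real n > 0" by linarith+
    moreover have "norm (w + of_nat n) \<ge> real n - norm w"
      by (metis add.commute norm_diff_ineq norm_of_nat)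
    ultimately have "norm (w + of_nat n) \<ge> real n / 2" "real n / 2 > 0" by auto
    then have "1 / norm (w + of_nat n) \<le> 1 / (real n / 2)" by (intro divide_left_mono mult_pos_pos) linarith+
    then have "(1 / norm (w + of_nat n)) ^ k \<le> (1 / (real n / 2)) ^ k" by (intro power_mono) auto
    then show "norm (norm (inverse ((w + of_nat n) ^ k))) \<le> 2 ^ k * (1 / (real n) ^ k)"
      by (simp add: norm_inverse norm_power power_divide inverse_eq_divide norm_divide)
  qed
qed

text \<open>For odd \<open>k\<close> the exponent is even, so the terms with negative
  \<open>m\<close> form the series at \<open>1 - w\<close> with the same sign.\<close>

lemma has_sum_inverse_power_Polygamma:
  fixes w :: complex
  assumes "odd k" "w \<notin> \<int>"
  shows "((\<lambda>m. 1 / (w + of_int m) ^ Suc k) has_sum ((Polygamma k w + Polygamma k (1 - w)) / fact k)) UNIV"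
proof -
  have nz: "w \<noteq> 0" "1 - w \<noteq> 0" and k: "k > 0" "Suc k \<ge> 2" using assms by (auto intro: Nat.gr0I elim!: oddE)
  have e: "even (Suc k)" using assms by simp
  have *: "((\<lambda>n::nat. inverse ((v + of_nat n) ^ Suc k)) has_sum (Polygamma k v / fact k)) UNIV" if "v \<noteq> 0" for v :: complex
    using norm_summable_imp_has_sum[OF summable_norm_inverse_power[OF k(2)] Polygamma_LIMSEQ[OF that k(1)]] e
    by (simp only: minus_one_power_iff if_True mult_1)
  have "((\<lambda>m. 1 / (w + of_int m) ^ Suc k) has_sum (Polygamma k w / fact k + Polygamma k (1 - w) / fact k)) UNIV"
  proof (rule has_sum_int_halves)
    show "((\<lambda>n::nat. 1 / (w + of_int (int n)) ^ Suc k) has_sum (Polygamma k w / fact k)) UNIV"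
      using *[OF nz(1)] by (simp add: inverse_eq_divide)
    have "(w + of_int (-1 - int n)) ^ Suc k = (1 - w + of_nat n) ^ Suc k" for n
      using power_minus_even[OF e, of "1 - w + of_nat n"] by (simp add: algebra_simps)
    then show "((\<lambda>n::nat. 1 / (w + of_int (-1 - int n)) ^ Suc k) has_sum (Polygamma k (1 - w) / fact k)) UNIV"
      using *[OF nz(2)] by (simp only: inverse_eq_divide)
  qed
  then show ?thesis by (simp add: add_divide_distrib)
qed

text \<open>Differentiating a reflection formula gives the next one with the opposite sign
  \<open>s\<close>. Starting from \<open>Digamma\<close>, three steps reach the orders 1 and 3,
  which evaluate the sums of inverse squares and inverse fourth powers.\<close>

lemma Polygamma_reflection_step:
  fixes z :: complex
  assumes "z \<notin> \<int>" "\<And>w. w \<notin> \<int> \<Longrightarrow> Polygamma k w + s * Polygamma k (1 - w) = f w"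
    "(f has_field_derivative f') (at z)"
  shows "Polygamma (Suc k) z - s * Polygamma (Suc k) (1 - z) = f'"
proof -
  have "((\<lambda>w. Polygamma k w + s * Polygamma k (1 - w)) has_field_derivative
      Polygamma (Suc k) z - s * Polygamma (Suc k) (1 - z)) (at z)"
    using not_nonpos_Ints_reflect[OF assms(1)] by (auto intro!: derivative_eq_intros)
  then have "(f has_field_derivative Polygamma (Suc k) z - s * Polygamma (Suc k) (1 - z)) (at z)"
    by (rule has_field_derivative_transform_within_open[of _ _ _ "- \<int>"])
      (use assms in \<open>auto intro: open_Compl closed_Ints\<close>)
  then show ?thesis using assms(3) DERIV_unique by blast
qed

lemma Polygamma_1_reflection:
  fixes z :: complex
  assumes "z \<notin> \<int>"
  shows "Polygamma 1 z + Polygamma 1 (1 - z) = of_real pi ^ 2 / sin (of_real pi * z) ^ 2"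
proof -
  have "((\<lambda>w. - (of_real pi * cot (of_real pi * w))) has_field_derivative
      of_real pi ^ 2 / sin (of_real pi * z) ^ 2) (at z)"
    using sin_pi_times_nonzero[OF assms]
    by (auto intro!: derivative_eq_intros DERIV_chain2[OF DERIV_cot] simp: power2_eq_square inverse_eq_divide)
  from Polygamma_reflection_step[OF assms _ this, of 0 "-1"] show ?thesis
    by (simp add: Digamma_reflection_complex[symmetric])
qed

lemma Polygamma_2_reflection:
  fixes z :: complex
  assumes "z \<notin> \<int>"
  shows "Polygamma 2 z - Polygamma 2 (1 - z) =
    - 2 * of_real pi ^ 3 * cos (of_real pi * z) / sin (of_real pi * z) ^ 3"
proof -
  have "((\<lambda>z. of_real pi ^ 2 / sin (of_real pi * z) ^ 2) has_field_derivative
      - 2 * of_real pi ^ 3 * cos (of_real pi * z) / sin (of_real pi * z) ^ 3) (at z)"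
    using sin_pi_times_nonzero[OF assms]
    by (auto intro!: derivative_eq_intros simp: field_simps eval_nat_numeral)
  moreover have "Polygamma 1 w + 1 * Polygamma 1 (1 - w) = of_real pi ^ 2 / sin (of_real pi * w) ^ 2"
    if "w \<notin> \<int>" for w :: complex using Polygamma_1_reflection[OF that] by simp
  ultimately show ?thesis using Polygamma_reflection_step[of z 1 1, OF assms]
    by (simp add: numeral_2_eq_2)
qed

lemma Polygamma_3_reflection:
  fixes z :: complex
  assumes "z \<notin> \<int>"
  shows "Polygamma 3 z + Polygamma 3 (1 - z) =
    2 * of_real pi ^ 4 * (3 / sin (of_real pi * z) ^ 4 - 2 / sin (of_real pi * z) ^ 2)"
proof -
  define s c where "s = sin (of_real pi * z)" and "c = cos (of_real pi * z)"
  have sc: "c * c = 1 - s * s" unfolding s_def c_def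
    using sin_cos_squared_add[of "of_real pi * z"] by (simp add: power2_eq_square eq_diff_eq add.commute)
  have s0: "s \<noteq> 0" using sin_pi_times_nonzero[OF assms] by (simp add: s_def)
  have "((\<lambda>z. - 2 * of_real pi ^ 3 * cos (of_real pi * z) / sin (of_real pi * z) ^ 3) has_field_derivative
      - 2 * of_real pi ^ 3 * (- (of_real pi * s) * s ^ 3 - c * (3 * s ^ 2 * (of_real pi * c))) / (s ^ 3 * s ^ 3)) (at z)"
    using sin_pi_times_nonzero[OF assms] unfolding s_def c_def
    by (auto intro!: derivative_eq_intros) (simp add: field_simps)
  also have "- 2 * of_real pi ^ 3 * (- (of_real pi * s) * s ^ 3 - c * (3 * s ^ 2 * (of_real pi * c))) / (s ^ 3 * s ^ 3)
     = 2 * of_real pi ^ 4 * (s ^ 4 + 3 * s ^ 2 * (c * c)) / s ^ 6"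
    using s0 by (simp add: eval_nat_numeral algebra_simps)
  also have "\<dots> = 2 * of_real pi ^ 4 * (3 / s ^ 4 - 2 / s ^ 2)"
    unfolding sc using s0 by (simp add: divide_simps) (simp add: eval_nat_numeral algebra_simps)
  finally show ?thesis using Polygamma_reflection_step[of z 2 "-1"] Polygamma_2_reflection assms
    by (simp add: s_def eval_nat_numeral)
qed

lemma has_sum_inverse_square_shift:
  fixes w :: complex
  assumes "w \<notin> \<int>"
  shows "((\<lambda>m. 1 / (w + of_int m) ^ 2) has_sum (of_real pi ^ 2 / sin (of_real pi * w) ^ 2)) UNIV"
  using has_sum_inverse_power_Polygamma[of 1 w] assms Polygamma_1_reflection[OF assms]
  by (simp add: numeral_2_eq_2)

lemma has_sum_inverse_power4_shift:
  fixes w :: complex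
  assumes "w \<notin> \<int>"
  shows "((\<lambda>m. 1 / (w + of_int m) ^ 4) has_sum
    (of_real pi ^ 4 * (1 / sin (of_real pi * w) ^ 4 - 2 / (3 * sin (of_real pi * w) ^ 2)))) UNIV"
proof -
  have "(2 * of_real pi ^ 4 * (3 / sin (of_real pi * w) ^ 4 - 2 / sin (of_real pi * w) ^ 2)) / fact 3
     = of_real pi ^ 4 * (1 / sin (of_real pi * w) ^ 4 - 2 / (3 * sin (of_real pi * w) ^ 2))"
    using sin_pi_times_nonzero[OF assms] by (simp add: fact_numeral field_simps)
  moreover have "Suc 3 = (4::nat)" by simp
  ultimately show ?thesis using has_sum_inverse_power_Polygamma[of 3 w] assms
    unfolding Polygamma_3_reflection[OF assms] by simp
qed

text \<open>The term \<open>m = 0\<close> is \<open>1 / 0 = 0\<close>.\<close>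
lemma has_sum_inverse_power_int:
  assumes k: "even k" "k \<ge> 2" and S: "((\<lambda>m. 1 / (1/2 + of_int m) ^ k) has_sum S) UNIV"
  shows "((\<lambda>m. 1 / (of_int m :: complex) ^ k) has_sum (S / (2 ^ k - 1))) UNIV"
proof -
  let ?f = "\<lambda>m. 1 / (of_int m :: complex) ^ k"
  have "summable (\<lambda>n. norm (?f (int n)))"
    using summable_norm_inverse_power[OF k(2), of 0] by (simp add: inverse_eq_divide)
  then obtain a where a: "((\<lambda>n::nat. ?f (int n)) has_sum a) UNIV"
    using norm_summable_imp_summable_on[of "\<lambda>n. ?f (int n)"] by (auto simp: summable_on_def)
  have "(of_int (-1 - int n)) ^ k = (1 + of_nat n :: complex) ^ k" for n
    using power_minus_even[OF k(1), of "1 + of_nat n :: complex"] by (simp add: algebra_simps)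
  then have "summable (\<lambda>n. norm (?f (-1 - int n)))"
    using summable_norm_inverse_power[OF k(2), of 1] by (simp only: inverse_eq_divide)
  then obtain b where b: "((\<lambda>n::nat. ?f (-1 - int n)) has_sum b) UNIV"
    using norm_summable_imp_summable_on[of "\<lambda>n. ?f (-1 - int n)"] by (auto simp: summable_on_def)
  define T where "T = a + b"
  have T: "(?f has_sum T) UNIV" unfolding T_def by (rule has_sum_int_halves[OF a b])
  \<comment> \<open>Even \<open>m\<close> reproduce the whole sum and odd \<open>m\<close> the sum
    at shift 1/2, so that \<open>T = T / 2 ^ k + S / 2 ^ k\<close> determines
    \<open>T\<close>.\<close>
  have "((\<lambda>m. ?f (2 * m)) has_sum (T / 2 ^ k)) UNIV"
    using has_sum_cmult_right[OF T, of "1 / 2 ^ k"] by (simp add: power_mult_distrib)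
  then have ev: "(?f has_sum (T / 2 ^ k)) (range (\<lambda>m. 2 * m))"
    by (subst has_sum_reindex) (auto simp: o_def inj_def)
  have "?f (2 * m + 1) = 1 / 2 ^ k * (1 / (1/2 + of_int m) ^ k)" for m
  proof -
    have "of_int (2 * m + 1) = 2 * (1/2 + of_int m :: complex)" by (simp add: algebra_simps)
    then show ?thesis by (simp only: power_mult_distrib) simp
  qed
  then have "((\<lambda>m. ?f (2 * m + 1)) has_sum (S / 2 ^ k)) UNIV"
    using has_sum_cmult_right[OF S, of "1 / 2 ^ k"] by (simp only: ) simp
  then have od: "(?f has_sum (S / 2 ^ k)) (range (\<lambda>m. 2 * m + 1))"
    by (subst has_sum_reindex) (auto simp: o_def inj_def)
  have "range (\<lambda>m::int. 2 * m) \<inter> range (\<lambda>m. 2 * m + 1) = {}" by (auto; presburger)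
  moreover have "range (\<lambda>m::int. 2 * m) \<union> range (\<lambda>m. 2 * m + 1) = UNIV"
    by (auto simp: image_iff) presburger
  ultimately have "(?f has_sum (T / 2 ^ k + S / 2 ^ k)) UNIV"
    using has_sum_Un_disjoint[OF ev od] by simp
  then have "T = T / 2 ^ k + S / 2 ^ k" using T has_sum_unique by blast
  moreover have "(2::complex) ^ k \<noteq> 1"
  proof -
    have "(2::real) ^ k > 1" using k by (intro one_less_power) auto
    then show ?thesis by (metis norm_one norm_power norm_numeral less_irrefl)
  qed
  ultimately have "T = S / (2 ^ k - 1)" by (simp add: divide_simps) (simp add: algebra_simps)
  then show ?thesis using T by simp
qed

lemma half_notin_Ints: "(1/2 :: complex) \<notin> \<int>"
proof
  assume "(1/2 :: complex) \<in> \<int>"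
  then obtain n :: int where "1/2 = (of_int n :: complex)" by (auto simp: Ints_def)
  then have "of_int (2 * n) = (of_int 1 :: complex)" by (simp add: mult.commute)
  then have "2 * n = 1" by (simp only: of_int_eq_iff)
  then show False by presburger
qed

lemma has_sum_inverse_square_int: "((\<lambda>m. 1 / (of_int m :: complex) ^ 2) has_sum (of_real pi ^ 2 / 3)) UNIV"
  using has_sum_inverse_power_int[OF _ _ has_sum_inverse_square_shift[OF half_notin_Ints]]
  by (simp add: sin_of_real[symmetric] flip: of_real_divide of_real_mult)

lemma has_sum_inverse_power4_int: "((\<lambda>m. 1 / (of_int m :: complex) ^ 4) has_sum (of_real pi ^ 4 / 45)) UNIV"
proof -
  have "sin (of_real pi * (1/2) :: complex) = 1" using sin_of_real[of "pi/2", where 'a=complex] by simp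
  then show ?thesis
    using has_sum_inverse_power_int[OF _ _ has_sum_inverse_power4_shift[OF half_notin_Ints]] by simp
qed

context
  fixes w q :: complex
  assumes w: "Im w > 0" and q: "q = exp (2 * of_real pi * \<i> * w)"
begin

lemma nome_ne: "q \<noteq> 0" "q \<noteq> 1" "w \<notin> \<int>"
proof -
  show "q \<noteq> 0" by (simp add: q)
  have "norm q < 1" using w by (simp add: q)
  then show "q \<noteq> 1" by auto
  show "w \<notin> \<int>" using w by (auto simp: Ints_def)
qed

lemma cot_sin_nome:
  "cot (of_real pi * w) = \<i> * (q + 1) / (q - 1)" "sin (of_real pi * w) ^ 2 = - ((1 - q) ^ 2) / (4 * q)"
proof -
  define e where "e = exp (\<i> * (of_real pi * w))"
  have e: "e \<noteq> 0" "q = e * e" "exp (- (\<i> * (of_real pi * w))) = 1 / e"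
    by (auto simp: e_def q exp_add[symmetric] exp_minus inverse_eq_divide algebra_simps)
  have s: "sin (of_real pi * w) = (q - 1) / (2 * \<i> * e)"
    unfolding sin_exp_eq using e by (simp add: e_def[symmetric]) (simp add: field_simps)
  have c: "cos (of_real pi * w) = (q + 1) / (2 * e)"
    unfolding cos_exp_eq using e by (simp add: e_def[symmetric]) (simp add: field_simps)
  have "q \<noteq> 1" by (rule nome_ne)
  show "cot (of_real pi * w) = \<i> * (q + 1) / (q - 1)"
    unfolding cot_def s c using e(1) \<open>q \<noteq> 1\<close> by (simp add: divide_simps)
  show "sin (of_real pi * w) ^ 2 = - ((1 - q) ^ 2) / (4 * q)"
    unfolding s e(2) using e(1) by (simp add: power2_eq_square field_simps)
qed

lemma has_sum_inverse_square_nome: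
  "((\<lambda>m. 1 / (w + of_int m) ^ 2) has_sum (- 4 * of_real pi ^ 2 * (q / (1 - q) ^ 2))) UNIV"
  using has_sum_inverse_square_shift[OF nome_ne(3)] nome_ne(1,2) unfolding cot_sin_nome by (simp add: mult_ac)

lemma has_sum_inverse_power4_nome:
  "((\<lambda>m. 1 / (w + of_int m) ^ 4) has_sum (8 * of_real pi ^ 4 / 3 * (q * (1 + 4 * q + q ^ 2) / (1 - q) ^ 4))) UNIV"
proof -
  have "sin (of_real pi * w) ^ 4 = (sin (of_real pi * w) ^ 2) ^ 2" by simp
  also have "\<dots> = (1 - q) ^ 4 / (16 * q ^ 2)" unfolding cot_sin_nome by (simp add: power_divide power_mult_distrib)
  finally have s4: "sin (of_real pi * w) ^ 4 = (1 - q) ^ 4 / (16 * q ^ 2)" .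
  have "of_real pi ^ 4 * (1 / sin (of_real pi * w) ^ 4 - 2 / (3 * sin (of_real pi * w) ^ 2)) =
    8 * of_real pi ^ 4 / 3 * (q * (1 + 4 * q + q ^ 2) / (1 - q) ^ 4)"
    unfolding s4 cot_sin_nome using nome_ne(1,2) by (simp add: divide_simps) (simp add: eval_nat_numeral algebra_simps)
  then show ?thesis using has_sum_inverse_power4_shift[OF nome_ne(3)] by simp
qed

end

section \<open>Lattice sums\<close>

no_notation Infinite_Set_Sum.abs_summable_on (infix "abs'_summable'_on" 50)

text \<open>The imaginary part of \<open>m + n * \<tau>\<close> controls \<open>n\<close>; the
  triangle inequality then controls \<open>m\<close>.\<close>

lemma lattice_coordinates_bound:
  assumes "Im \<tau> > 0"
  obtains A where "A > 0" "\<And>m n. \<bar>real_of_int m\<bar> \<le> A * cmod (of_int m + of_int n * \<tau>)"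
    "\<And>m n. \<bar>real_of_int n\<bar> \<le> A * cmod (of_int m + of_int n * \<tau>)"
proof -
  define B where "B = 1 / Im \<tau>"
  define A where "A = B + (1 + B * cmod \<tau>)"
  have B: "B > 0" using assms by (simp add: B_def)
  have n: "\<bar>real_of_int n\<bar> \<le> B * cmod (of_int m + of_int n * \<tau>)" for m n
  proof -
    have "\<bar>real_of_int n\<bar> * Im \<tau> = \<bar>Im (of_int m + of_int n * \<tau>)\<bar>" using assms by (simp add: abs_mult)
    also have "\<dots> \<le> cmod (of_int m + of_int n * \<tau>)" by (rule abs_Im_le_cmod)
    finally show ?thesis using assms by (simp add: B_def field_simps)
  qed
  have m: "\<bar>real_of_int m\<bar> \<le> (1 + B * cmod \<tau>) * cmod (of_int m + of_int n * \<tau>)" for m n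
  proof -
    have "\<bar>real_of_int m\<bar> = cmod ((of_int m + of_int n * \<tau>) - of_int n * \<tau>)" by simp
    also have "\<dots> \<le> cmod (of_int m + of_int n * \<tau>) + cmod (of_int n * \<tau>)" by (rule norm_triangle_ineq4)
    also have "cmod (of_int n * \<tau>) = \<bar>real_of_int n\<bar> * cmod \<tau>" by (simp add: norm_mult)
    also have "\<dots> \<le> B * cmod (of_int m + of_int n * \<tau>) * cmod \<tau>" by (intro mult_right_mono n) auto
    finally show ?thesis by (simp add: algebra_simps)
  qed
  show ?thesis
  proof
    show "A > 0" using B by (simp add: A_def add_pos_nonneg)
    fix m n
    have "0 \<le> B * cmod (of_int m + of_int n * \<tau>)" "0 \<le> (1 + B * cmod \<tau>) * cmod (of_int m + of_int n * \<tau>)"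
      using B by auto
    then show "\<bar>real_of_int m\<bar> \<le> A * cmod (of_int m + of_int n * \<tau>)"
      "\<bar>real_of_int n\<bar> \<le> A * cmod (of_int m + of_int n * \<tau>)"
      using m[of m n] n[of n m] by (auto simp: A_def distrib_right)
  qed
qed

lemma lattice_ball_finite:
  assumes "Im \<tau> > 0"
  shows "finite {(n, m). cmod (of_int m + of_int n * \<tau>) < R}"
proof -
  obtain A where A: "A > 0" "\<And>m n. \<bar>real_of_int m\<bar> \<le> A * cmod (of_int m + of_int n * \<tau>)"
    "\<And>m n. \<bar>real_of_int n\<bar> \<le> A * cmod (of_int m + of_int n * \<tau>)"
    using lattice_coordinates_bound[OF assms] by blast
  have "{(n, m). cmod (of_int m + of_int n * \<tau>) < R} \<subseteq> {-\<lceil>A * R\<rceil>..\<lceil>A * R\<rceil>} \<times> {-\<lceil>A * R\<rceil>..\<lceil>A * R\<rceil>}"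
  proof clarify
    fix n m :: int assume "cmod (of_int m + of_int n * \<tau>) < R"
    then have "A * cmod (of_int m + of_int n * \<tau>) \<le> A * R" using A(1) by simp
    with A(2)[of m n] A(3)[of n m] have "\<bar>real_of_int m\<bar> \<le> A * R" "\<bar>real_of_int n\<bar> \<le> A * R" by linarith+
    then show "n \<in> {-\<lceil>A * R\<rceil>..\<lceil>A * R\<rceil>} \<and> m \<in> {-\<lceil>A * R\<rceil>..\<lceil>A * R\<rceil>}" by (auto; linarith)
  qed
  then show ?thesis by (rule finite_subset) auto
qed

lemma summable_on_int_powr:
  "(\<lambda>m::int. (1 + \<bar>real_of_int m\<bar>) powr (-3/2)) summable_on UNIV"
proof -
  have "summable (\<lambda>n. real n powr (-3/2))" by (subst summable_real_powr_iff) simp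
  then have s: "summable (\<lambda>n. norm (real (Suc n) powr (-3/2)))" "summable (\<lambda>n. norm (real (Suc (Suc n)) powr (-3/2)))"
    by (simp_all only: summable_Suc_iff[of "\<lambda>n. real n powr (-3/2)"] summable_Suc_iff[of "\<lambda>n. real (Suc n) powr (-3/2)"] real_norm_def abs_of_nonneg[OF powr_ge_zero])
  obtain a b where ab: "((\<lambda>n. real (Suc n) powr (-3/2)) has_sum a) UNIV" "((\<lambda>n. real (Suc (Suc n)) powr (-3/2)) has_sum b) UNIV"
    using s[THEN norm_summable_imp_summable_on] unfolding summable_on_def by blast
  have "((\<lambda>m::int. (1 + \<bar>real_of_int m\<bar>) powr (-3/2)) has_sum (a + b)) UNIV"
  proof (rule has_sum_int_halves)
    show "((\<lambda>n. (1 + \<bar>real_of_int (int n)\<bar>) powr (-3/2)) has_sum a) UNIV" using ab(1) by simp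
    have "1 + \<bar>real_of_int (-1 - int n)\<bar> = real (Suc (Suc n))" for n by simp
    then show "((\<lambda>n. (1 + \<bar>real_of_int (-1 - int n)\<bar>) powr (-3/2)) has_sum b) UNIV" using ab(2) by simp
  qed
  then show ?thesis by (auto simp: summable_on_def)
qed

text \<open>Both \<open>1 + \<bar>m\<bar>\<close> and \<open>1 + \<bar>n\<bar>\<close> are at most a
  constant times the modulus of a nonzero lattice point, hence so is the square root of their
  product. An exponent of at least 3 therefore gives a majorant that is a product of two convergent
  sums with exponent 3/2.\<close>

lemma abs_summable_on_lattice:
  assumes "Im \<tau> > 0" "k \<ge> 3"
  shows "(\<lambda>(n, m). 1 / (of_int m + of_int n * \<tau>) ^ k) abs_summable_on UNIV"
proof -
  obtain A where A: "A > 0" "\<And>m n. \<bar>real_of_int m\<bar> \<le> A * cmod (of_int m + of_int n * \<tau>)"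
    "\<And>m n. \<bar>real_of_int n\<bar> \<le> A * cmod (of_int m + of_int n * \<tau>)"
    using lattice_coordinates_bound[OF assms(1)] by blast
  define h where "h = (\<lambda>m::int. (1 + \<bar>real_of_int m\<bar>) powr (-3/2))"
  have h: "h summable_on UNIV" "\<And>m. h m \<ge> 0" using summable_on_int_powr by (simp_all add: h_def)
  have nh: "norm (h x * h y) = h x * h y" for x y using h(2) by (simp add: abs_mult)
  have *: "(\<lambda>(n, m). h n * h m) abs_summable_on (UNIV \<times> UNIV)"
    unfolding Infinite_Sum.abs_summable_on_Sigma_iff
  proof (intro conjI ballI)
    fix x show "(\<lambda>y. case (x, y) of (n, m) \<Rightarrow> h n * h m) abs_summable_on UNIV"
      using summable_on_cmult_right[OF h(1), of "h x"] by (simp add: nh del: real_norm_def)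
  next
    have "(\<Sum>\<^sub>\<infinity>y. norm (case (x, y) of (n, m) \<Rightarrow> h n * h m)) = h x * infsum h UNIV" for x
      using infsum_cmult_right[of "h x" h UNIV] h(1) by (simp add: nh del: real_norm_def)
    moreover have "norm (h x * infsum h UNIV) = h x * infsum h UNIV" for x
      using h(2) infsum_nonneg[of UNIV h] by (simp add: abs_mult)
    ultimately show "(\<lambda>x. \<Sum>\<^sub>\<infinity>y. norm (case (x, y) of (n, m) \<Rightarrow> h n * h m)) abs_summable_on UNIV"
      using summable_on_cmult_left[OF h(1), of "infsum h UNIV"] by (simp del: real_norm_def)
  qed
  define K where "K = (2 * A) ^ k"
  have **: "(\<lambda>(n, m). K * (h n * h m)) abs_summable_on UNIV"
    using summable_on_cmult_right[OF *, of "norm K"] by (simp add: case_prod_unfold abs_mult)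
  show ?thesis
  proof (rule Infinite_Sum.abs_summable_on_comparison_test[OF **], clarify)
    fix n m :: int
    let ?L = "cmod (of_int m + of_int n * \<tau>)"
    show "norm (1 / (of_int m + of_int n * \<tau>) ^ k) \<le> norm (K * (h n * h m))"
    proof (cases "?L = 0")
      case True
      then show ?thesis using assms(2) by (simp add: power_0_left)
    next
      case False
      then have L: "?L > 0" by simp
      have "(m, n) \<noteq> (0, 0)" using False by auto
      then have "1 \<le> \<bar>real_of_int m\<bar> \<or> 1 \<le> \<bar>real_of_int n\<bar>" by auto
      with A(2)[of m n] A(3)[of n m] have AL: "1 \<le> A * ?L" "1 + \<bar>real_of_int m\<bar> \<le> 2 * A * ?L" "1 + \<bar>real_of_int n\<bar> \<le> 2 * A * ?L" by linarith+
      define P where "P = (1 + \<bar>real_of_int n\<bar>) * (1 + \<bar>real_of_int m\<bar>)"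
      have P1: "P \<ge> 1" unfolding P_def using mult_mono[of 1 "1 + \<bar>real_of_int n\<bar>" 1 "1 + \<bar>real_of_int m\<bar>"] by simp
      have "P \<le> (2 * A * ?L) * (2 * A * ?L)" unfolding P_def using AL by (intro mult_mono) auto
      then have "sqrt P \<le> 2 * A * ?L" using A(1) L by (intro real_le_lsqrt) (auto simp: power2_eq_square)
      then have "sqrt P ^ k \<le> (2 * A * ?L) ^ k" using P1 by (intro power_mono) auto
      moreover have "P powr (3/2) \<le> sqrt P ^ k"
      proof -
        have "P powr (3/2) = (P powr (1/2)) powr 3" by (simp add: powr_powr)
        also have "\<dots> = sqrt P ^ 3" using P1 by (simp add: powr_half_sqrt)
        also have "\<dots> \<le> sqrt P ^ k" using P1 assms(2) by (intro power_increasing) auto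
        finally show ?thesis .
      qed
      ultimately have PK: "P powr (3/2) \<le> K * ?L ^ k" by (simp add: K_def power_mult_distrib)
      have "h n * h m = P powr (-3/2)" unfolding h_def P_def by (simp add: powr_mult)
      also have "\<dots> = 1 / P powr (3/2)" by (simp add: powr_minus_divide)
      finally have hh: "h n * h m = 1 / P powr (3/2)" .
      have "1 / ?L ^ k \<le> K * (1 / P powr (3/2))"
        using PK P1 L by (simp add: field_simps)
      then have "norm (1 / (of_int m + of_int n * \<tau>) ^ k) \<le> K * (h n * h m)"
        unfolding hh by (simp add: norm_divide norm_power)
      then show ?thesis by simp
    qed
  qed
qed

text \<open>The summand equals \<open>z\<^sup>2 / (\<omega>\<^sup>2 * (z - \<omega>))\<close>, which
  is of order \<open>\<omega> ^ -3\<close> once \<open>\<omega>\<close> has modulus at least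
  \<open>2 * cmod z + 1\<close>; the finitely many smaller lattice points, including 0 and possibly
  \<open>z\<close>, do not affect summability.\<close>

lemma summable_on_zeta_terms:
  assumes "Im \<tau> > 0"
  shows "(\<lambda>(n, m). 1 / (z - (of_int m + of_int n * \<tau>)) + 1 / (of_int m + of_int n * \<tau>)
           + z / (of_int m + of_int n * \<tau>)\<^sup>2) summable_on UNIV"
proof -
  let ?F = "{(n, m). cmod (of_int m + of_int n * \<tau>) < 2 * cmod z + 1}"
  let ?t = "\<lambda>(n, m). 1 / (z - (of_int m + of_int n * \<tau>)) + 1 / (of_int m + of_int n * \<tau>)
           + z / (of_int m + of_int n * \<tau>)\<^sup>2"
  have "(\<lambda>(n, m). 1 / (of_int m + of_int n * \<tau>) ^ 3) abs_summable_on (-?F)"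
    using abs_summable_on_lattice[OF assms, of 3] summable_on_subset_banach by blast
  from summable_on_cmult_right[OF this, of "2 * cmod z ^ 2"]
  have *: "(\<lambda>(n, m). (2 * cmod z ^ 2) *\<^sub>R (1 / (of_int m + of_int n * \<tau>) ^ 3)) abs_summable_on (-?F)"
    by (simp add: case_prod_unfold abs_mult)
  have "?t abs_summable_on (-?F)"
  proof (rule Infinite_Sum.abs_summable_on_comparison_test[OF *])
    fix x assume "x \<in> -?F"
    obtain n m where x: "x = (n, m)" by (cases x)
    have nm: "\<not> cmod (of_int m + of_int n * \<tau>) < 2 * cmod z + 1" using \<open>x \<in> -?F\<close> by (simp add: x)
    define \<omega> where "\<omega> = of_int m + of_int n * \<tau>"
    have \<omega>: "cmod \<omega> \<ge> 2 * cmod z + 1" using nm by (simp add: \<omega>_def)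
    have d: "cmod (z - \<omega>) \<ge> cmod \<omega> / 2" using \<omega> norm_triangle_ineq2[of \<omega> z] by (simp add: norm_minus_commute)
    have \<omega>0: "cmod \<omega> > 0" using \<omega> norm_ge_zero[of z] by linarith
    then have nz: "\<omega> \<noteq> 0" "z - \<omega> \<noteq> 0" using d by auto
    have "1 / (z - \<omega>) + 1 / \<omega> + z / \<omega>\<^sup>2 = z\<^sup>2 / (\<omega>\<^sup>2 * (z - \<omega>))"
      using nz by (simp add: divide_simps) (simp add: power2_eq_square algebra_simps)
    then have "norm (1 / (z - \<omega>) + 1 / \<omega> + z / \<omega>\<^sup>2) = cmod z ^ 2 / (cmod \<omega> ^ 2 * cmod (z - \<omega>))"
      by (simp add: norm_divide norm_mult norm_power)
    also have "\<dots> \<le> cmod z ^ 2 / (cmod \<omega> ^ 2 * (cmod \<omega> / 2))"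
      using d \<omega>0 nz by (intro divide_left_mono mult_left_mono mult_pos_pos) auto
    also have "\<dots> = norm ((2 * cmod z ^ 2) *\<^sub>R (1 / \<omega> ^ 3))"
      using \<omega>0 by (simp add: norm_divide norm_power norm_mult power3_eq_cube power2_eq_square abs_mult field_simps)
    finally show "norm (?t x) \<le> norm ((\<lambda>(n, m). (2 * cmod z ^ 2) *\<^sub>R (1 / (of_int m + of_int n * \<tau>) ^ 3)) x)"
      by (simp only: \<omega>_def x prod.case)
  qed
  then have "?t summable_on (-?F)" by (rule abs_summable_summable)
  moreover have "?t summable_on ?F" using lattice_ball_finite[OF assms] by (rule summable_on_finite)
  ultimately have "?t summable_on (-?F \<union> ?F)" by (rule summable_on_Un_disjoint) auto
  then show ?thesis by (simp add: Compl_partition2)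
qed

lemma bij_betw_period_lattice:
  assumes "Im \<tau> > 0"
  shows "bij_betw (\<lambda>(n, m). of_int m + of_int n * \<tau>) UNIV (period_lattice \<tau>)"
proof -
  have "m = m' \<and> n = n'" if "of_int m + of_int n * \<tau> = of_int m' + of_int n' * \<tau>" for m n m' n' :: int
  proof -
    have "real_of_int n * Im \<tau> = real_of_int n' * Im \<tau>" using arg_cong[OF that, of Im] by simp
    then have "n = n'" using assms by simp
    then show ?thesis using that by simp
  qed
  then show ?thesis by (auto simp: bij_betw_def inj_on_def period_lattice_def image_iff)
qed

text \<open>By \<open>1 / 0 = 0\<close> the summand at \<open>\<omega> = 0\<close> is the term \<open>1 / z\<close> of the zeta function.\<close>
lemma weierstrass_zeta_eq_infsum:
  assumes "Im \<tau> > 0"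
  shows "weierstrass_zeta z \<tau> = (\<Sum>\<^sub>\<infinity>\<omega>\<in>period_lattice \<tau>. 1 / (z - \<omega>) + 1 / \<omega> + z / \<omega>\<^sup>2)"
    and "(\<lambda>\<omega>. 1 / (z - \<omega>) + 1 / \<omega> + z / \<omega>\<^sup>2) summable_on period_lattice \<tau>"
proof -
  let ?t = "\<lambda>\<omega>. 1 / (z - \<omega>) + 1 / \<omega> + z / \<omega>\<^sup>2"
  show s: "?t summable_on period_lattice \<tau>"
    using summable_on_zeta_terms[OF assms, of z] bij_betw_period_lattice[OF assms]
    by (subst summable_on_reindex_bij_betw[symmetric, of _ UNIV]) (auto simp: case_prod_unfold)
  have 0: "0 \<in> period_lattice \<tau>" unfolding period_lattice_def by (force intro!: exI[of _ 0])
  have "infsum ?t ({0} \<union> (period_lattice \<tau> - {0})) = infsum ?t {0} + infsum ?t (period_lattice \<tau> - {0})"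
    by (rule infsum_Un_disjoint) (auto intro: summable_on_subset_banach[OF s])
  also have "{0} \<union> (period_lattice \<tau> - {0}) = period_lattice \<tau>" using 0 by auto
  finally show "weierstrass_zeta z \<tau> = infsum ?t (period_lattice \<tau>)"
    unfolding weierstrass_zeta_def by simp
qed

text \<open>Summability of the whole allows each row to be evaluated along
  \<open>{-int N..<int N}\<close>, where a summand may be split into parts that converge only
  conditionally.\<close>

lemma infsum_int_pairs:
  fixes f :: "int \<times> int \<Rightarrow> complex"
  assumes "f summable_on UNIV" "\<And>n. (\<lambda>N. \<Sum>m\<in>{-int N..<int N}. f (n, m)) \<longlonglongrightarrow> r n"
  shows "(\<lambda>N. \<Sum>n\<in>{-int N..int N}. r n) \<longlonglongrightarrow> infsum f UNIV"
proof -
  have s: "f summable_on (UNIV \<times> UNIV)" using assms(1) by simp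
  have row: "((\<lambda>m. f (n, m)) has_sum r n) UNIV" for n
  proof -
    have "(\<lambda>m. f (n, m)) summable_on UNIV"
      using summable_on_subset_banach[OF assms(1), of "range (Pair n)"]
      by (simp add: summable_on_reindex inj_on_def o_def)
    then have h: "((\<lambda>m. f (n, m)) has_sum (\<Sum>\<^sub>\<infinity>m. f (n, m))) UNIV" by simp
    have "(\<Sum>\<^sub>\<infinity>m. f (n, m)) = r n"
      using has_sum_int_tendsto(2)[OF h] assms(2)[of n] LIMSEQ_unique by blast
    then show ?thesis using h by simp
  qed
  have "(r has_sum infsum f (UNIV \<times> UNIV)) UNIV"
    by (rule has_sum_Sigma[OF isUCont_plus has_sum_infsum[OF s] row])
  then show ?thesis using has_sum_int_tendsto(1) by fastforce
qed

definition row_square :: "complex \<Rightarrow> int \<Rightarrow> complex" where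
  "row_square \<tau> n = (\<Sum>\<^sub>\<infinity>m. 1 / (of_int n * \<tau> + of_int m) ^ 2)"

definition row_power4 :: "complex \<Rightarrow> int \<Rightarrow> complex" where
  "row_power4 \<tau> n = (\<Sum>\<^sub>\<infinity>m. 1 / (of_int n * \<tau> + of_int m) ^ 4)"

lemma row_not_Ints:
  assumes "Im \<tau> > 0" shows "of_int n * \<tau> \<notin> \<int> \<or> n = 0"
proof -
  have "Im (of_int n * \<tau>) = 0" if "of_int n * \<tau> \<in> \<int>" using that by (metis Ints_cases complex_Im_of_int)
  then show ?thesis using assms by (cases "of_int n * \<tau> \<in> \<int>") simp_all
qed

lemma has_sum_row:
  assumes "Im \<tau> > 0"
  shows "((\<lambda>m. 1 / (of_int n * \<tau> + of_int m) ^ 2) has_sum row_square \<tau> n) UNIV"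
    "((\<lambda>m. 1 / (of_int n * \<tau> + of_int m) ^ 4) has_sum row_power4 \<tau> n) UNIV"
  using has_sum_inverse_square_shift has_sum_inverse_power4_shift
    has_sum_inverse_square_int has_sum_inverse_power4_int row_not_Ints[OF assms, of n]
  unfolding row_square_def row_power4_def has_sum_infsum summable_on_def
  by (auto intro!: has_sum_infsum simp: summable_on_def; blast)+

text \<open>In row \<open>n\<close> the three parts of the summand give a cotangent at
  \<open>z - n * \<tau>\<close>, a cotangent at \<open>n * \<tau>\<close> and
  \<open>z * row_square \<tau> n\<close>. The second one is odd in \<open>n\<close> and cancels over
  the symmetric range.\<close>

lemma zeta_tendsto:
  assumes "Im \<tau> > 0" "z \<notin> period_lattice \<tau>"
  shows "(\<lambda>N. \<Sum>n\<in>{-int N..int N}. of_real pi * cot (of_real pi * (z - of_int n * \<tau>)) + z * row_square \<tau> n)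
      \<longlonglongrightarrow> weierstrass_zeta z \<tau>"
proof -
  let ?t = "\<lambda>(n, m). 1 / (z - (of_int m + of_int n * \<tau>)) + 1 / (of_int m + of_int n * \<tau>)
           + z / (of_int m + of_int n * \<tau>)\<^sup>2"
  define r where "r n = of_real pi * cot (of_real pi * (z - of_int n * \<tau>)) + of_real pi * cot (of_real pi * (of_int n * \<tau>))
     + z * row_square \<tau> n" for n
  have row: "(\<lambda>N. \<Sum>m\<in>{-int N..<int N}. ?t (n, m)) \<longlonglongrightarrow> r n" for n
  proof -
    have nz: "- (z - of_int n * \<tau>) \<notin> \<int> \<or> - (z - of_int n * \<tau>) = 0"
    proof -
      have "False" if "- (z - of_int n * \<tau>) = of_int m" for m
      proof -
        have "z = of_int (-m) + of_int n * \<tau>" using that by (simp add: algebra_simps)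
        then show False using assms(2) unfolding period_lattice_def by blast
      qed
      then show ?thesis unfolding Ints_def by auto
    qed
    have "(\<lambda>N. - (\<Sum>m\<in>{-int N..<int N}. 1 / (- (z - of_int n * \<tau>) + of_int m)))
      \<longlonglongrightarrow> - (of_real pi * cot (of_real pi * (- (z - of_int n * \<tau>))))"
      by (intro tendsto_minus cot_partial_fractions nz)
    moreover have "- (1 / (- (z - of_int n * \<tau>) + of_int m)) = 1 / (z - (of_int m + of_int n * \<tau>))" for m
    proof -
      have "- (z - of_int n * \<tau>) + of_int m = - (z - (of_int m + of_int n * \<tau>))" by simp
      then show ?thesis by (simp only: divide_minus_right minus_minus)
    qed
    ultimately have 1: "(\<lambda>N. \<Sum>m\<in>{-int N..<int N}. 1 / (z - (of_int m + of_int n * \<tau>)))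
      \<longlonglongrightarrow> of_real pi * cot (of_real pi * (z - of_int n * \<tau>))"
      by (simp only: sum_negf[symmetric] mult_minus_right cot_minus minus_minus)
    have "of_int n * \<tau> \<notin> \<int> \<or> of_int n * \<tau> = 0" using row_not_Ints[OF assms(1), of n] by auto
    from cot_partial_fractions[OF this]
    have 2: "(\<lambda>N. \<Sum>m\<in>{-int N..<int N}. 1 / (of_int m + of_int n * \<tau>)) \<longlonglongrightarrow> of_real pi * cot (of_real pi * (of_int n * \<tau>))"
      by (simp add: add.commute)
    have 3: "(\<lambda>N. \<Sum>m\<in>{-int N..<int N}. z / (of_int m + of_int n * \<tau>)\<^sup>2) \<longlonglongrightarrow> z * row_square \<tau> n"
      using tendsto_mult_left[OF has_sum_int_tendsto(2)[OF has_sum_row(1)[OF assms(1), of n]], of z]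
      by (simp add: sum_distrib_left add.commute)
    show ?thesis using tendsto_add[OF tendsto_add[OF 1 2] 3] by (simp add: r_def sum.distrib)
  qed
  have z: "weierstrass_zeta z \<tau> = infsum ?t UNIV"
    unfolding weierstrass_zeta_eq_infsum(1)[OF assms(1)]
    using infsum_reindex_bij_betw[OF bij_betw_period_lattice[OF assms(1)], of "\<lambda>\<omega>. 1 / (z - \<omega>) + 1 / \<omega> + z / \<omega>\<^sup>2"]
    by (simp add: case_prod_unfold)
  have c: "(\<Sum>n\<in>{-int N..int N}. of_real pi * cot (of_real pi * (of_int n * \<tau>))) = 0" for N
  proof -
    let ?g = "\<lambda>n. of_real pi * cot (of_real pi * (of_int n * \<tau>))"
    have "sum ?g {-int N..int N} = (\<Sum>n\<in>{-int N..int N}. ?g (- n))"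
      by (rule sum.reindex_bij_witness[of _ uminus uminus]) auto
    also have "\<dots> = - sum ?g {-int N..int N}" by (simp add: sum_negf)
    finally show ?thesis by (simp add: eq_neg_iff_add_eq_0 del: add_eq_0_iff)
  qed
  show ?thesis
    using infsum_int_pairs[OF summable_on_zeta_terms[OF assms(1)] row] c
    by (simp add: z r_def sum.distrib)
qed

lemma g2_tendsto:
  assumes "Im \<tau> > 0"
  shows "(\<lambda>N. \<Sum>n\<in>{-int N..int N}. 60 * row_power4 \<tau> n) \<longlonglongrightarrow> g2 \<tau>"
proof -
  let ?t = "\<lambda>(n::int, m::int). 1 / (of_int n * \<tau> + of_int m) ^ 4"
  have s: "?t summable_on UNIV"
    using abs_summable_summable[OF abs_summable_on_lattice[OF assms, of 4]] by (simp add: add.commute)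
  have "g2 \<tau> = 60 * infsum ?t UNIV"
    \<comment> \<open>The omitted pair \<open>(0, 0)\<close> would contribute
      \<open>1 / 0 = 0\<close>.\<close>
    unfolding g2_def by (intro arg_cong[of _ _ "(*) 60"] infsum_cong_neutral) auto
  moreover have "(\<lambda>N. \<Sum>n\<in>{-int N..int N}. row_power4 \<tau> n) \<longlonglongrightarrow> infsum ?t UNIV"
    using has_sum_int_tendsto(2)[OF has_sum_row(2)[OF assms]] by (intro infsum_int_pairs[OF s]) simp
  ultimately show ?thesis by (simp add: sum_distrib_left[symmetric] tendsto_mult_left)
qed

section \<open>Expansions in the nome and modularity\<close>

definition lambert :: "(complex \<Rightarrow> complex) \<Rightarrow> complex \<Rightarrow> complex" where
  "lambert \<phi> q = (\<Sum>n. \<phi> (q ^ Suc n))"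

text \<open>As \<open>\<phi>\<close> vanishes at 0, it is \<open>z * \<psi> z\<close> with
  \<open>\<psi>\<close> bounded on every smaller disc. So the terms are locally dominated by a
  geometric series, which permits termwise differentiation.\<close>

lemma lambert_series:
  assumes "\<phi> holomorphic_on ball 0 1" "\<phi> 0 = 0" "q \<in> ball 0 1"
  shows "(\<lambda>n. \<phi> (q ^ Suc n)) sums lambert \<phi> q"
    and "(\<lambda>n. of_nat (Suc n) * q ^ n * deriv \<phi> (q ^ Suc n)) sums deriv (lambert \<phi>) q"
    and "(lambert \<phi> has_field_derivative deriv (lambert \<phi>) q) (at q)"
proof -
  let ?f = "\<lambda>n q. \<phi> (q ^ Suc n)" and ?f' = "\<lambda>n q. of_nat (Suc n) * q ^ n * deriv \<phi> (q ^ Suc n)"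
  have pw: "x ^ Suc n \<in> ball 0 1" if "x \<in> ball 0 1" for x :: complex and n
  proof -
    have "norm x ^ Suc n \<le> norm x" using that power_Suc_le_self[of "norm x" n] by simp
    also have "norm x < 1" using that by simp
    finally show ?thesis by (simp add: norm_mult norm_power)
  qed
  define \<psi> where "\<psi> z = (if z = 0 then deriv \<phi> 0 else (\<phi> z - \<phi> 0) / (z - 0))" for z
  have \<psi>: "\<psi> holomorphic_on ball 0 1" "\<And>z. \<phi> z = z * \<psi> z"
    using pole_lemma_open[OF assms(1) open_ball, of 0] assms(2) by (simp_all add: \<psi>_def[abs_def])
  have "\<exists>g g'. \<forall>x\<in>ball 0 1. ((\<lambda>n. ?f n x) sums g x) \<and> ((\<lambda>n. ?f' n x) sums g' x) \<and> (g has_field_derivative g' x) (at x)"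
  proof (rule series_and_derivative_comparison_local[OF open_ball])
    fix n and x :: complex assume x: "x \<in> ball 0 1"
    have "(\<phi> has_field_derivative deriv \<phi> (x ^ Suc n)) (at (x ^ Suc n))"
      using assms(1) pw[OF x] holomorphic_derivI open_ball by blast
    moreover have "((\<lambda>x. x ^ Suc n) has_field_derivative of_nat (Suc n) * x ^ n) (at x)"
      by (auto intro!: derivative_eq_intros simp del: power_Suc)
    ultimately show "(?f n has_field_derivative ?f' n x) (at x)"
      using DERIV_chain2[of \<phi> _ "\<lambda>x. x ^ Suc n"] by (simp add: mult.commute)
  next
    fix x :: complex assume x: "x \<in> ball 0 1"
    define d r where "d = (1 - norm x) / 2" and "r = norm x + d"
    have dr: "d > 0" "r < 1" "r \<ge> 0" using x by (auto simp: d_def r_def field_simps)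
    have "continuous_on (cball 0 r) \<psi>"
      using \<psi>(1) dr by (auto intro!: holomorphic_on_imp_continuous_on elim: holomorphic_on_subset)
    then have "bounded (\<psi> ` cball 0 r)" by (intro compact_imp_bounded compact_continuous_image) auto
    then obtain B where B: "norm (\<psi> z) \<le> B" if "z \<in> cball 0 r" for z unfolding bounded_iff by blast
    have "norm (?f n y) \<le> r ^ Suc n * B" if "y \<in> ball x d \<inter> ball 0 1" for n y
    proof -
      have yr: "norm y \<le> r" using that norm_triangle_ineq2[of y x] by (simp add: r_def dist_norm norm_minus_commute)
      have n: "norm (y ^ Suc n) \<le> r ^ Suc n" using power_mono[OF yr norm_ge_zero, of "Suc n"] by (simp only: norm_power)
      also have "r ^ Suc n \<le> r" using dr power_Suc_le_self[of r n] by simp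
      finally have "norm (\<psi> (y ^ Suc n)) \<le> B" by (intro B) simp
      with n show ?thesis unfolding \<psi>(2)[of "y ^ Suc n"] norm_mult[of "y ^ Suc n"] using dr by (intro mult_mono) auto
    qed
    moreover have "summable (\<lambda>n. r ^ Suc n * B)"
      using dr by (intro summable_mult2) (subst summable_Suc_iff, simp add: summable_geometric)
    ultimately show "\<exists>d h. 0 < d \<and> summable h \<and> (\<forall>\<^sub>F n in sequentially. \<forall>y\<in>ball x d \<inter> ball 0 1. norm (?f n y) \<le> h n)"
      using dr by (intro exI[of _ d] exI[of _ "\<lambda>n. r ^ Suc n * B"]) (auto simp del: power_Suc)
  qed
  then obtain g g' where g: "\<And>x. x \<in> ball 0 1 \<Longrightarrow> (\<lambda>n. ?f n x) sums g x"
      "\<And>x. x \<in> ball 0 1 \<Longrightarrow> (\<lambda>n. ?f' n x) sums g' x"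
      "\<And>x. x \<in> ball 0 1 \<Longrightarrow> (g has_field_derivative g' x) (at x)" by blast
  have eq: "g x = lambert \<phi> x" if "x \<in> ball 0 1" for x
    using g(1)[OF that] by (simp add: lambert_def sums_iff)
  then have d: "(lambert \<phi> has_field_derivative g' q) (at q)"
    using has_field_derivative_transform_within_open[OF g(3)[OF assms(3)] open_ball assms(3)] by blast
  have d': "deriv (lambert \<phi>) q = g' q" by (rule DERIV_imp_deriv[OF d])
  show "(\<lambda>n. ?f n q) sums lambert \<phi> q" using g(1) eq assms(3) by metis
  show "(\<lambda>n. ?f' n q) sums deriv (lambert \<phi>) q" using g(2)[OF assms(3)] d' by simp
  show "(lambert \<phi> has_field_derivative deriv (lambert \<phi>) q) (at q)" using d d' by simp
qed

lemma lambert_0: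
  assumes "\<phi> holomorphic_on ball 0 1" "\<phi> 0 = 0"
  shows "lambert \<phi> 0 = 0" "deriv (lambert \<phi>) 0 = deriv \<phi> 0"
proof -
  show "lambert \<phi> 0 = 0" using assms(2) by (simp add: lambert_def)
  have "(\<lambda>n. of_nat (Suc n) * 0 ^ n * deriv \<phi> (0 ^ Suc n)) sums (deriv \<phi> 0)"
    using sums_single[of 0 "\<lambda>n. deriv \<phi> 0"] by (rule sums_cong[THEN iffD1, rotated]) (auto simp: power_0_left)
  then show "deriv (lambert \<phi>) 0 = deriv \<phi> 0"
    using lambert_series(2)[OF assms, of 0] sums_unique2 by (metis centre_in_ball zero_less_one)
qed

lemma lambert_holomorphic:
  assumes "\<phi> holomorphic_on ball 0 1" "\<phi> 0 = 0"
  shows "lambert \<phi> holomorphic_on ball 0 1"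
  using lambert_series(3)[OF assms] by (subst holomorphic_on_open) blast+

text \<open>These are the generating functions of \<open>k\<close> and \<open>k ^ 3\<close>; their
  Lambert series have as coefficients the divisor sums of exponent 1 and 3.\<close>

definition \<phi>2 :: "complex \<Rightarrow> complex" where "\<phi>2 q = q / (1 - q) ^ 2"
definition \<phi>4 :: "complex \<Rightarrow> complex" where "\<phi>4 q = q * (1 + 4 * q + q ^ 2) / (1 - q) ^ 4"

lemma \<phi>_basic: "\<phi>2 holomorphic_on ball 0 1" "\<phi>4 holomorphic_on ball 0 1" "\<phi>2 0 = 0" "\<phi>4 0 = 0"
  unfolding \<phi>2_def \<phi>4_def by (auto intro!: holomorphic_intros)

lemma deriv_\<phi>2: assumes "q \<noteq> 1" shows "deriv \<phi>2 q = (1 + q) / (1 - q) ^ 3"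
proof -
  have "(\<phi>2 has_field_derivative (1 * (1 - q) ^ 2 - q * (2 * (1 - q) * (- 1))) / ((1 - q) ^ 2 * (1 - q) ^ 2)) (at q)"
    unfolding \<phi>2_def using assms by (auto intro!: derivative_eq_intros)
  also have "(1 * (1 - q) ^ 2 - q * (2 * (1 - q) * (- 1))) / ((1 - q) ^ 2 * (1 - q) ^ 2) = (1 + q) / (1 - q) ^ 3"
  proof -
    have "1 * (1 - q) ^ 2 - q * (2 * (1 - q) * (- 1)) = (1 - q) * (1 + q)" by (simp add: power2_eq_square algebra_simps)
    moreover have "(1 - q) ^ 2 * (1 - q) ^ 2 = (1 - q) * (1 - q) ^ 3" by (simp add: eval_nat_numeral)
    ultimately show ?thesis using assms by simp
  qed
  finally show ?thesis by (rule DERIV_imp_deriv)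
qed

lemma deriv_\<phi>4_0: "deriv \<phi>4 0 = 1"
proof -
  have "(\<phi>4 has_field_derivative 1) (at 0)"
    unfolding \<phi>4_def by (auto intro!: derivative_eq_intros)
  then show ?thesis by (rule DERIV_imp_deriv)
qed

definition nome :: "complex \<Rightarrow> complex" where "nome \<tau> = exp (2 * of_real pi * \<i> * \<tau>)"

lemma norm_nome: "norm (nome \<tau>) = exp (- 2 * pi * Im \<tau>)" by (simp add: nome_def)
lemma nome_in_ball: "Im \<tau> > 0 \<Longrightarrow> nome \<tau> \<in> ball 0 1" by (simp add: norm_nome)
lemma nome_nonzero [simp]: "nome \<tau> \<noteq> 0" by (simp add: nome_def)
lemma nome_add: "nome (a + b) = nome a * nome b" by (simp add: nome_def exp_add distrib_left)
lemma nome_of_nat_mult: "nome (of_nat n * \<tau>) = nome \<tau> ^ n"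
  by (simp add: nome_def exp_of_nat_mult[symmetric] mult_ac)
lemma nome_of_int [simp]: "nome (of_int n) = 1"
  unfolding nome_def by (simp add: exp_eq_1)

lemma even_sum_int:
  fixes r :: "int \<Rightarrow> complex"
  assumes "\<And>n. r (- n) = r n"
  shows "(\<Sum>n\<in>{-int N..int N}. r n) = r 0 + 2 * (\<Sum>k<N. r (int (Suc k)))"
proof (induction N)
  case (Suc N)
  have "{-int (Suc N)..int (Suc N)} = insert (int (Suc N)) (insert (- int (Suc N)) {-int N..int N})" by auto
  then have "(\<Sum>n\<in>{-int (Suc N)..int (Suc N)}. r n) = r (int (Suc N)) + (r (- int (Suc N)) + (\<Sum>n\<in>{-int N..int N}. r n))"
    by (simp del: of_nat_Suc)
  then show ?case using Suc by (simp only: assms sum.lessThan_Suc) (simp add: algebra_simps)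
qed auto

lemma row_nome:
  assumes "Im \<tau> > 0"
  shows "row_square \<tau> (int (Suc k)) = - 4 * of_real pi ^ 2 * \<phi>2 (nome \<tau> ^ Suc k)"
    "row_power4 \<tau> (int (Suc k)) = 8 * of_real pi ^ 4 / 3 * \<phi>4 (nome \<tau> ^ Suc k)"
proof -
  have im: "Im (of_int (int (Suc k)) * \<tau>) > 0" using assms by simp
  have q: "nome \<tau> ^ Suc k = exp (2 * of_real pi * \<i> * (of_int (int (Suc k)) * \<tau>))"
    using nome_of_nat_mult[of "Suc k" \<tau>] by (simp add: nome_def del: power_Suc)
  show "row_square \<tau> (int (Suc k)) = - 4 * of_real pi ^ 2 * \<phi>2 (nome \<tau> ^ Suc k)"
    using has_sum_inverse_square_nome[OF im q] has_sum_row(1)[OF assms] has_sum_unique unfolding \<phi>2_def by blast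
  show "row_power4 \<tau> (int (Suc k)) = 8 * of_real pi ^ 4 / 3 * \<phi>4 (nome \<tau> ^ Suc k)"
    using has_sum_inverse_power4_nome[OF im q] has_sum_row(2)[OF assms] has_sum_unique unfolding \<phi>4_def by blast
qed

lemma row_0: "row_square \<tau> 0 = of_real pi ^ 2 / 3" "row_power4 \<tau> 0 = of_real pi ^ 4 / 45"
  using has_sum_inverse_square_int has_sum_inverse_power4_int
  by (simp_all add: row_square_def row_power4_def infsumI)

lemma row_uminus: "row_square \<tau> (- n) = row_square \<tau> n" "row_power4 \<tau> (- n) = row_power4 \<tau> n"
proof -
  have "(of_int (- n) * \<tau> + of_int m) ^ k = (of_int n * \<tau> + of_int (- m)) ^ k" if "even k" for m k
    using power_minus_even[OF that, of "of_int n * \<tau> + of_int (- m)"] by simp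
  moreover have "bij (uminus :: int \<Rightarrow> int)" by (rule bij_uminus)
  ultimately show "row_square \<tau> (- n) = row_square \<tau> n" "row_power4 \<tau> (- n) = row_power4 \<tau> n"
    unfolding row_square_def row_power4_def
    using infsum_reindex_bij_betw[of uminus UNIV UNIV "\<lambda>m. 1 / (of_int n * \<tau> + of_int m) ^ 2"]
      infsum_reindex_bij_betw[of uminus UNIV UNIV "\<lambda>m. 1 / (of_int n * \<tau> + of_int m) ^ 4"]
    by simp_all
qed

text \<open>With Eisenstein series normalized to constant term 1, these are
  \<open>pi ^ 2 / 3\<close> times the one of weight 2 and \<open>4 * pi ^ 4 / 3\<close> times the
  one of weight 4, as functions of \<open>q\<close>.\<close>

definition \<eta>q :: "complex \<Rightarrow> complex" where "\<eta>q q = of_real pi ^ 2 / 3 - 8 * of_real pi ^ 2 * lambert \<phi>2 q"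
definition gq :: "complex \<Rightarrow> complex" where "gq q = 4 * of_real pi ^ 4 / 3 + 320 * of_real pi ^ 4 * lambert \<phi>4 q"

lemma row_square_tendsto:
  assumes "Im \<tau> > 0"
  shows "(\<lambda>N. \<Sum>n\<in>{-int N..int N}. row_square \<tau> n) \<longlonglongrightarrow> \<eta>q (nome \<tau>)"
proof -
  have "(\<lambda>N. \<Sum>k<N. \<phi>2 (nome \<tau> ^ Suc k)) \<longlonglongrightarrow> lambert \<phi>2 (nome \<tau>)"
    using lambert_series(1)[OF \<phi>_basic(1,3) nome_in_ball[OF assms]] unfolding sums_def .
  then have "(\<lambda>N. of_real pi ^ 2 / 3 + 2 * (- 4 * of_real pi ^ 2 * (\<Sum>k<N. \<phi>2 (nome \<tau> ^ Suc k))))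
      \<longlonglongrightarrow> of_real pi ^ 2 / 3 + 2 * (- 4 * of_real pi ^ 2 * lambert \<phi>2 (nome \<tau>))"
    by (intro tendsto_intros)
  then show ?thesis
    by (simp only: even_sum_int[of "row_square \<tau>", OF row_uminus(1)] row_0 row_nome[OF assms] sum_distrib_left[symmetric]) (simp add: \<eta>q_def mult.assoc)
qed

lemma g2_nome:
  assumes "Im \<tau> > 0"
  shows "g2 \<tau> = gq (nome \<tau>)"
proof -
  have "(\<lambda>N. \<Sum>k<N. \<phi>4 (nome \<tau> ^ Suc k)) \<longlonglongrightarrow> lambert \<phi>4 (nome \<tau>)"
    using lambert_series(1)[OF \<phi>_basic(2,4) nome_in_ball[OF assms]] unfolding sums_def .
  then have "(\<lambda>N. 60 * (of_real pi ^ 4 / 45 + 2 * (8 * of_real pi ^ 4 / 3 * (\<Sum>k<N. \<phi>4 (nome \<tau> ^ Suc k)))))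
      \<longlonglongrightarrow> 60 * (of_real pi ^ 4 / 45 + 2 * (8 * of_real pi ^ 4 / 3 * lambert \<phi>4 (nome \<tau>)))"
    by (intro tendsto_intros)
  moreover have "(\<Sum>n\<in>{-int N..int N}. 60 * row_power4 \<tau> n) = 60 * (of_real pi ^ 4 / 45 + 2 * (8 * of_real pi ^ 4 / 3 * (\<Sum>k<N. \<phi>4 (nome \<tau> ^ Suc k))))" for N
    by (simp only: sum_distrib_left[symmetric] even_sum_int[of "row_power4 \<tau>", OF row_uminus(2)] row_0 row_nome[OF assms])
  ultimately have "g2 \<tau> = 60 * (of_real pi ^ 4 / 45 + 2 * (8 * of_real pi ^ 4 / 3 * lambert \<phi>4 (nome \<tau>)))"
    using g2_tendsto[OF assms] LIMSEQ_unique by fastforce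
  then show ?thesis by (simp add: gq_def algebra_simps)
qed

section \<open>Quasi-periods of the zeta function and the Legendre relation\<close>

lemma cot_row_tendsto:
  assumes "Im \<tau> > 0" "z \<notin> period_lattice \<tau>"
  shows "(\<lambda>N. \<Sum>n\<in>{-int N..int N}. of_real pi * cot (of_real pi * (z - of_int n * \<tau>)))
      \<longlonglongrightarrow> weierstrass_zeta z \<tau> - z * \<eta>q (nome \<tau>)"
  using tendsto_diff[OF zeta_tendsto[OF assms] tendsto_mult_left[OF row_square_tendsto[OF assms(1)], of z]]
  by (simp add: sum.distrib sum_distrib_left)

lemma period_lattice_iff_add:
  "z + (of_int m + of_int n * \<tau>) \<in> period_lattice \<tau> \<longleftrightarrow> z \<in> period_lattice \<tau>"
proof -
  have *: "z + (of_int m + of_int n * \<tau>) \<in> period_lattice \<tau>" if "z \<in> period_lattice \<tau>" for z m n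
  proof -
    obtain m' n' where "z = of_int m' + of_int n' * \<tau>" using \<open>z \<in> _\<close> unfolding period_lattice_def by blast
    then have "z + (of_int m + of_int n * \<tau>) = of_int (m + m') + of_int (n + n') * \<tau>" by (simp add: algebra_simps)
    then show ?thesis unfolding period_lattice_def by blast
  qed
  show ?thesis using *[of z m n] *[of "z + (of_int m + of_int n * \<tau>)" "-m" "-n"] by (auto simp: algebra_simps)
qed

text \<open>The series of cotangents is periodic term by term, so the increment comes only from the
  linear term \<open>z * \<eta>q (nome \<tau>)\<close>.\<close>

lemma zeta_add_1:
  assumes "Im \<tau> > 0" "z \<notin> period_lattice \<tau>"
  shows "weierstrass_zeta (z + 1) \<tau> = weierstrass_zeta z \<tau> + \<eta>q (nome \<tau>)"
proof -
  have z1: "z + 1 \<notin> period_lattice \<tau>" using period_lattice_iff_add[of z 1 0 \<tau>] assms(2) by simp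
  have "cot (of_real pi * (z + 1 - w)) = cot (of_real pi * (z - w))" for w
  proof -
    have "of_real pi * (z + 1 - w) = of_real pi * (z - w) + of_real pi" by (simp add: algebra_simps)
    then show ?thesis unfolding cot_def by (simp add: sin_add cos_add)
  qed
  then have "weierstrass_zeta (z + 1) \<tau> - (z + 1) * \<eta>q (nome \<tau>) = weierstrass_zeta z \<tau> - z * \<eta>q (nome \<tau>)"
    using cot_row_tendsto[OF assms] cot_row_tendsto[OF assms(1) z1] LIMSEQ_unique by fastforce
  then show ?thesis by (simp add: algebra_simps)
qed

lemma cot_tendsto:
  assumes "Im \<tau> > 0"
  shows "(\<lambda>N. cot (of_real pi * (z + of_nat N * \<tau>))) \<longlonglongrightarrow> - \<i>"
proof -
  have "(\<lambda>N. nome z * nome \<tau> ^ N) \<longlonglongrightarrow> nome z * 0"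
    using nome_in_ball[OF assms] by (intro tendsto_mult_left LIMSEQ_power_zero) auto
  then have l: "(\<lambda>N. nome (z + of_nat N * \<tau>)) \<longlonglongrightarrow> 0" by (simp add: nome_add nome_of_nat_mult)
  have "(\<lambda>N. \<i> * (nome (z + of_nat N * \<tau>) + 1) / (nome (z + of_nat N * \<tau>) - 1)) \<longlonglongrightarrow> \<i> * (0 + 1) / (0 - 1)"
    by (intro tendsto_intros l) auto
  moreover have "\<forall>\<^sub>F N in sequentially. \<i> * (nome (z + of_nat N * \<tau>) + 1) / (nome (z + of_nat N * \<tau>) - 1)
     = cot (of_real pi * (z + of_nat N * \<tau>))"
  proof (rule eventually_sequentiallyI[of "nat \<lceil>- Im z / Im \<tau>\<rceil> + 1"])
    fix N assume "nat \<lceil>- Im z / Im \<tau>\<rceil> + 1 \<le> N"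
    then have "- Im z / Im \<tau> < real N" by linarith
    then have "Im (z + of_nat N * \<tau>) > 0" using assms by (simp add: field_simps)
    from cot_sin_nome(1)[OF this refl] show "\<i> * (nome (z + of_nat N * \<tau>) + 1) / (nome (z + of_nat N * \<tau>) - 1)
     = cot (of_real pi * (z + of_nat N * \<tau>))" by (simp add: nome_def)
  qed
  ultimately show ?thesis by (simp add: filterlim_cong[OF refl refl])
qed

text \<open>Translation by \<open>\<tau>\<close> moves the symmetric range of rows by one. Only the
  two end rows differ, and their cotangents tend to \<open>- \<i>\<close> and \<open>\<i>\<close>;
  their difference is the source of \<open>- 2 * pi * \<i>\<close>.\<close>

lemma zeta_add_\<tau>:
  assumes "Im \<tau> > 0" "z \<notin> period_lattice \<tau>"
  shows "weierstrass_zeta (z + \<tau>) \<tau> = weierstrass_zeta z \<tau> + (\<tau> * \<eta>q (nome \<tau>) - 2 * of_real pi * \<i>)"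
proof -
  define g where "g n = of_real pi * cot (of_real pi * (z - of_int n * \<tau>))" for n
  have z1: "z + \<tau> \<notin> period_lattice \<tau>" using period_lattice_iff_add[of z 0 1 \<tau>] assms(2) by simp
  have s: "(\<Sum>n\<in>{-int N..int N}. g (n - 1)) = (\<Sum>n\<in>{-int N..int N}. g n) + (g (- int N - 1) - g (int N))" for N
  proof -
    have "(\<Sum>n\<in>{-int N..int N}. g (n - 1)) = sum g {-int N - 1..int N - 1}"
      by (rule sum.reindex_bij_witness[of _ "\<lambda>n. n + 1" "\<lambda>n. n - 1"]) auto
    moreover have "{-int N - 1..int N} = insert (-int N - 1) {-int N..int N}"
      "{-int N - 1..int N} = insert (int N) {-int N - 1..int N - 1}" by auto
    ultimately have "g (-int N - 1) + sum g {-int N..int N} = g (int N) + (\<Sum>n\<in>{-int N..int N}. g (n - 1))"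
      by (smt (verit) sum.insert finite_atLeastAtMost_int atLeastAtMost_iff)
    then show ?thesis by (simp add: algebra_simps)
  qed
  have "(\<lambda>N. of_real pi * cot (of_real pi * ((z + \<tau>) + of_nat N * \<tau>))) \<longlonglongrightarrow> of_real pi * (- \<i>)"
    by (intro tendsto_mult_left cot_tendsto assms)
  then have 1: "(\<lambda>N. g (- int N - 1)) \<longlonglongrightarrow> of_real pi * (- \<i>)"
    by (simp add: g_def algebra_simps)
  have "(\<lambda>N. - (of_real pi * cot (of_real pi * (- z + of_nat N * \<tau>)))) \<longlonglongrightarrow> - (of_real pi * (- \<i>))"
    by (intro tendsto_minus tendsto_mult_left cot_tendsto assms)
  moreover have "- (of_real pi * cot (of_real pi * (- z + of_nat N * \<tau>))) = g (int N)" for N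
  proof -
    have "of_real pi * (- z + of_nat N * \<tau>) = - (of_real pi * (z - of_int (int N) * \<tau>))" by (simp add: algebra_simps)
    then show ?thesis unfolding g_def by (simp only: cot_minus) simp
  qed
  ultimately have 2: "(\<lambda>N. g (int N)) \<longlonglongrightarrow> of_real pi * \<i>" by simp
  have sh: "of_real pi * cot (of_real pi * (z + \<tau> - of_int n * \<tau>)) = g (n - 1)" for n
    by (simp add: g_def algebra_simps)
  have "(\<lambda>N. \<Sum>n\<in>{-int N..int N}. g (n - 1)) \<longlonglongrightarrow> weierstrass_zeta (z + \<tau>) \<tau> - (z + \<tau>) * \<eta>q (nome \<tau>)"
    using cot_row_tendsto[OF assms(1) z1] unfolding sh .
  moreover have "(\<lambda>N. \<Sum>n\<in>{-int N..int N}. g (n - 1)) \<longlonglongrightarrow>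
      (weierstrass_zeta z \<tau> - z * \<eta>q (nome \<tau>)) + (of_real pi * (- \<i>) - of_real pi * \<i>)"
    unfolding s using cot_row_tendsto[OF assms] by (intro tendsto_add tendsto_diff 1 2) (simp add: g_def)
  ultimately have "weierstrass_zeta (z + \<tau>) \<tau> - (z + \<tau>) * \<eta>q (nome \<tau>) =
     (weierstrass_zeta z \<tau> - z * \<eta>q (nome \<tau>)) + (of_real pi * (- \<i>) - of_real pi * \<i>)"
    using LIMSEQ_unique by blast
  then show ?thesis by (simp add: algebra_simps)
qed

lemma quasi_periodic_int_mult:
  assumes "\<And>z. z \<notin> L \<Longrightarrow> f (z + p) = f z + (e :: complex)" "\<And>z. z + p \<in> L \<longleftrightarrow> z \<in> L" "z \<notin> L"
  shows "f (z + of_int n * p) = f z + of_int n * e"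
proof -
  have nat: "z + of_nat k * p \<notin> L \<and> f (z + of_nat k * p) = f z + of_nat k * e" if "z \<notin> L" for z k
  proof (induction k)
    case (Suc k)
    have "z + of_nat (Suc k) * p = (z + of_nat k * p) + p" by (simp add: algebra_simps)
    then show ?case using Suc assms(1,2)[of "z + of_nat k * p"] by (simp add: algebra_simps)
  qed (use that in auto)
  show ?thesis
  proof (cases "n \<ge> 0")
    case True then show ?thesis using nat[OF assms(3), of "nat n"] by simp
  next
    case False
    define w where "w = z + of_int n * p"
    have zw: "z = w + of_nat (nat (- n)) * p" using False by (simp add: w_def)
    have "w + of_nat k * p \<in> L \<longleftrightarrow> w \<in> L" for k
    proof (induction k)
      case (Suc k)
      have "w + of_nat (Suc k) * p = (w + of_nat k * p) + p" by (simp add: algebra_simps)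
      then show ?case using Suc assms(2)[of "w + of_nat k * p"] by metis
    qed auto
    then have "w \<notin> L" using assms(3) zw by metis
    from nat[OF this, of "nat (- n)"] have "f z = f w + of_nat (nat (- n)) * e" unfolding zw[symmetric] by simp
    then have "f z = f w - of_int n * e" using False by simp
    then show ?thesis by (simp add: w_def)
  qed
qed

lemma zeta_quasi_periodic:
  assumes "Im \<tau> > 0" "z \<notin> period_lattice \<tau>"
  shows "weierstrass_zeta (z + (of_int m + of_int n * \<tau>)) \<tau> =
    weierstrass_zeta z \<tau> + of_int m * \<eta>q (nome \<tau>) + of_int n * (\<tau> * \<eta>q (nome \<tau>) - 2 * of_real pi * \<i>)"
proof -
  have p: "z + 1 \<in> period_lattice \<tau> \<longleftrightarrow> z \<in> period_lattice \<tau>" "z + \<tau> \<in> period_lattice \<tau> \<longleftrightarrow> z \<in> period_lattice \<tau>" for z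
    using period_lattice_iff_add[of z 1 0 \<tau>] period_lattice_iff_add[of z 0 1 \<tau>] by simp_all
  have z': "z + of_int m \<notin> period_lattice \<tau>" using period_lattice_iff_add[of z m 0 \<tau>] assms(2) by simp
  have "weierstrass_zeta (z + of_int m * 1) \<tau> = weierstrass_zeta z \<tau> + of_int m * \<eta>q (nome \<tau>)"
    using quasi_periodic_int_mult[of "period_lattice \<tau>" "\<lambda>z. weierstrass_zeta z \<tau>" 1] zeta_add_1[OF assms(1)] p(1) assms(2) by blast
  moreover have "weierstrass_zeta ((z + of_int m) + of_int n * \<tau>) \<tau> = weierstrass_zeta (z + of_int m) \<tau>
      + of_int n * (\<tau> * \<eta>q (nome \<tau>) - 2 * of_real pi * \<i>)"
    using quasi_periodic_int_mult[of "period_lattice \<tau>" "\<lambda>z. weierstrass_zeta z \<tau>" \<tau>] zeta_add_\<tau>[OF assms(1)] p(2) z' by blast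
  ultimately show ?thesis by (simp add: add.assoc)
qed

lemma period_lattice_uminus: "z \<in> period_lattice \<tau> \<Longrightarrow> - z \<in> period_lattice \<tau>"
  unfolding period_lattice_def
proof clarify
  fix m n :: int
  have "- (of_int m + of_int n * \<tau>) = of_int (- m) + of_int (- n) * \<tau>" by simp
  then show "\<exists>m' n'. - (of_int m + of_int n * \<tau>) = of_int m' + of_int n' * \<tau> \<and> True" by blast
qed

lemma zeta_odd:
  assumes "Im \<tau> > 0"
  shows "weierstrass_zeta (- z) \<tau> = - weierstrass_zeta z \<tau>"
proof -
  have "bij_betw uminus (period_lattice \<tau>) (period_lattice \<tau>)"
    by (rule bij_betwI[of _ _ _ uminus]) (auto dest: period_lattice_uminus)
  from infsum_reindex_bij_betw[OF this, of "\<lambda>\<omega>. 1 / (- z - \<omega>) + 1 / \<omega> + - z / \<omega>\<^sup>2"]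
  have "weierstrass_zeta (- z) \<tau> = (\<Sum>\<^sub>\<infinity>\<omega>\<in>period_lattice \<tau>. 1 / (- z - - \<omega>) + 1 / (- \<omega>) + - z / (- \<omega>)\<^sup>2)"
    unfolding weierstrass_zeta_eq_infsum(1)[OF assms] by simp
  also have "\<dots> = (\<Sum>\<^sub>\<infinity>\<omega>\<in>period_lattice \<tau>. - (1 / (z - \<omega>) + 1 / \<omega> + z / \<omega>\<^sup>2))"
  proof (rule infsum_cong)
    fix \<omega>
    have "- z - - \<omega> = - (z - \<omega>)" by simp
    then show "1 / (- z - - \<omega>) + 1 / (- \<omega>) + - z / (- \<omega>)\<^sup>2 = - (1 / (z - \<omega>) + 1 / \<omega> + z / \<omega>\<^sup>2)"
      by (simp only: divide_minus_right power2_minus divide_minus_left) simp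
  qed
  also have "\<dots> = - weierstrass_zeta z \<tau>"
    unfolding weierstrass_zeta_eq_infsum(1)[OF assms] by (rule infsum_uminus)
  finally show ?thesis .
qed

text \<open>For a period \<open>\<omega>\<close>, translation by \<open>\<omega>\<close> takes
  \<open>- \<omega> / 2\<close> to \<open>\<omega> / 2\<close>; as zeta is odd, its value at
  \<open>\<omega> / 2\<close> is half the quasi-period. This one fact gives \<open>eta1\<close>,
  \<open>eta2\<close> and the transformation law of \<open>eta1\<close>.\<close>

lemma zeta_half_period:
  assumes "Im \<tau> > 0" "(of_int m + of_int n * \<tau>) / 2 \<notin> period_lattice \<tau>"
  shows "2 * weierstrass_zeta ((of_int m + of_int n * \<tau>) / 2) \<tau> =
    of_int m * \<eta>q (nome \<tau>) + of_int n * (\<tau> * \<eta>q (nome \<tau>) - 2 * of_real pi * \<i>)"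
proof -
  define \<omega> where "\<omega> = of_int m + of_int n * \<tau>"
  have "- (\<omega> / 2) \<notin> period_lattice \<tau>" using period_lattice_uminus[of "- (\<omega> / 2)" \<tau>] assms(2) by (auto simp: \<omega>_def)
  from zeta_quasi_periodic[OF assms(1) this, of m n]
  have "weierstrass_zeta (- (\<omega> / 2) + \<omega>) \<tau> = - weierstrass_zeta (\<omega> / 2) \<tau> + of_int m * \<eta>q (nome \<tau>) + of_int n * (\<tau> * \<eta>q (nome \<tau>) - 2 * of_real pi * \<i>)"
    unfolding zeta_odd[OF assms(1)] \<omega>_def .
  moreover have "- (\<omega> / 2) + \<omega> = \<omega> / 2" by (simp add: field_simps)
  ultimately have "2 * weierstrass_zeta (\<omega> / 2) \<tau> = of_int m * \<eta>q (nome \<tau>) + of_int n * (\<tau> * \<eta>q (nome \<tau>) - 2 * of_real pi * \<i>)"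
    by (simp add: algebra_simps)
  then show ?thesis unfolding \<omega>_def .
qed

lemma half_period_notin:
  assumes "Im \<tau> > 0" "odd m \<or> odd n"
  shows "(of_int m + of_int n * \<tau>) / 2 \<notin> period_lattice \<tau>"
proof
  assume "(of_int m + of_int n * \<tau>) / 2 \<in> period_lattice \<tau>"
  then obtain a b where "(of_int m + of_int n * \<tau>) / 2 = of_int a + of_int b * \<tau>" unfolding period_lattice_def by auto
  then have "of_int m + of_int n * \<tau> = of_int (2 * a) + of_int (2 * b) * \<tau>" by (simp add: field_simps)
  then have "(n, m) = (2 * b, 2 * a)"
    using bij_betw_period_lattice[OF assms(1)] by (intro inj_onD[of "\<lambda>(n, m). of_int m + of_int n * \<tau>" UNIV])
      (auto simp: bij_betw_def)
  then show False using assms(2) by auto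
qed

lemma eta1_nome: assumes "Im \<tau> > 0" shows "eta1 \<tau> = \<eta>q (nome \<tau>)"
  using zeta_half_period[OF assms half_period_notin[OF assms, of 1 0]] by (simp add: eta1_def)

lemma Legendre_relation: assumes "Im \<tau> > 0" shows "eta2 \<tau> = \<tau> * eta1 \<tau> - 2 * of_real pi * \<i>"
  using zeta_half_period[OF assms half_period_notin[OF assms, of 0 1]] eta1_nome[OF assms] by (simp add: eta2_def)

section \<open>Transformation of \<open>eta1\<close> and \<open>g2\<close> under
  \<open>SL(2, Z)\<close>\<close>

lemma Im_moebius:
  fixes a b c d :: int
  assumes "a * d - b * c = 1"
  shows "Im ((of_int a * \<tau> + of_int b) / (of_int c * \<tau> + of_int d)) = Im \<tau> / (cmod (of_int c * \<tau> + of_int d))\<^sup>2"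
proof -
  have "real_of_int (a * d - b * c) = 1" using assms by simp
  then have "real_of_int a * real_of_int d - real_of_int b * real_of_int c = 1" by simp
  then have "real_of_int a * Im \<tau> * (real_of_int c * Re \<tau> + real_of_int d) - (real_of_int a * Re \<tau> + real_of_int b) * (real_of_int c * Im \<tau>) = Im \<tau>"
    by algebra
  then show ?thesis by (simp add: Im_divide cmod_power2)
qed

lemma moebius_denominator_nonzero:
  fixes a b c d :: int
  assumes "Im \<tau> > 0" "a * d - b * c = 1"
  shows "of_int c * \<tau> + of_int d \<noteq> 0"
proof
  assume "of_int c * \<tau> + of_int d = 0"
  then have "Im (of_int c * \<tau> + of_int d) = 0" "Re (of_int c * \<tau> + of_int d) = 0" by simp_all
  then have "c = 0" "d = 0" using assms(1) by auto
  then show False using assms(2) by simp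
qed

lemma period_lattice_moebius:
  fixes a b c d :: int
  assumes "Im \<tau> > 0" "a * d - b * c = 1"
  shows "bij_betw (\<lambda>\<omega>. (of_int c * \<tau> + of_int d) * \<omega>)
     (period_lattice ((of_int a * \<tau> + of_int b) / (of_int c * \<tau> + of_int d))) (period_lattice \<tau>)"
proof -
  define J where "J = of_int c * \<tau> + of_int d"
  have J: "J \<noteq> 0" using moebius_denominator_nonzero[OF assms] by (simp add: J_def)
  have e: "J * (of_int m + of_int n * ((of_int a * \<tau> + of_int b) / J)) = of_int (m * d + n * b) + of_int (m * c + n * a) * \<tau>" for m n
    using J by (simp add: field_simps) (simp add: J_def algebra_simps)
  have "of_int m + of_int n * \<tau> \<in> (*) J ` period_lattice ((of_int a * \<tau> + of_int b) / J)" for m n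
  proof -
    have "(a * m - b * n) * d + (d * n - c * m) * b = (a * d - b * c) * m" "(a * m - b * n) * c + (d * n - c * m) * a = (a * d - b * c) * n"
      by (simp_all add: algebra_simps)
    then have "of_int m + of_int n * \<tau> = J * (of_int (a * m - b * n) + of_int (d * n - c * m) * ((of_int a * \<tau> + of_int b) / J))"
      unfolding e assms(2) by simp
    then show ?thesis unfolding period_lattice_def by blast
  qed
  then have "(*) J ` period_lattice ((of_int a * \<tau> + of_int b) / J) = period_lattice \<tau>"
    using e unfolding period_lattice_def by fastforce
  then show ?thesis using J by (auto simp: bij_betw_def inj_on_def J_def)
qed

text \<open>Multiplication by \<open>J = c * \<tau> + d\<close> takes the lattice of the transformed
  point to that of \<open>\<tau>\<close>, and zeta is homogeneous of degree -1. So 1/2 becomes the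
  half period \<open>(d + c * \<tau>) / 2\<close>, which is no lattice point since determinant 1
  keeps \<open>c\<close> and \<open>d\<close> from being both even.\<close>

lemma eta1_moebius:
  fixes a b c d :: int
  assumes "Im \<tau> > 0" "a * d - b * c = 1"
  shows "eta1 ((of_int a * \<tau> + of_int b) / (of_int c * \<tau> + of_int d)) =
    (of_int c * \<tau> + of_int d) * (of_int d * eta1 \<tau> + of_int c * eta2 \<tau>)"
proof -
  define J \<tau>' where "J = of_int c * \<tau> + of_int d" and "\<tau>' = (of_int a * \<tau> + of_int b) / J"
  have J: "J \<noteq> 0" using moebius_denominator_nonzero[OF assms] by (simp add: J_def)
  have \<tau>': "Im \<tau>' > 0" using Im_moebius[OF assms(2), of \<tau>] J assms(1) by (simp add: \<tau>'_def J_def)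
  have bij: "bij_betw (\<lambda>\<omega>. J * \<omega>) (period_lattice \<tau>') (period_lattice \<tau>)"
    using period_lattice_moebius[OF assms] by (simp add: J_def \<tau>'_def)
  have "weierstrass_zeta (J * (1/2)) \<tau> = (\<Sum>\<^sub>\<infinity>\<omega>\<in>period_lattice \<tau>'. 1 / (J * (1/2) - J * \<omega>) + 1 / (J * \<omega>) + (J * (1/2)) / (J * \<omega>)\<^sup>2)"
    unfolding weierstrass_zeta_eq_infsum(1)[OF assms(1)] by (rule infsum_reindex_bij_betw[OF bij, symmetric])
  also have "\<dots> = (\<Sum>\<^sub>\<infinity>\<omega>\<in>period_lattice \<tau>'. (1 / J) * (1 / (1/2 - \<omega>) + 1 / \<omega> + (1/2) / \<omega>\<^sup>2))"
  proof (rule infsum_cong)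
    fix \<omega>
    have "J * (1/2) - J * \<omega> = J * (1/2 - \<omega>)" by (simp add: algebra_simps)
    moreover have "(J * (1/2)) / (J * \<omega>)\<^sup>2 = (1 / J) * ((1/2) / \<omega>\<^sup>2)" using J by (simp add: power2_eq_square)
    ultimately show "1 / (J * (1/2) - J * \<omega>) + 1 / (J * \<omega>) + (J * (1/2)) / (J * \<omega>)\<^sup>2 = (1 / J) * (1 / (1/2 - \<omega>) + 1 / \<omega> + (1/2) / \<omega>\<^sup>2)"
      by (simp only: distrib_left) simp
  qed
  also have "\<dots> = (1 / J) * weierstrass_zeta (1/2) \<tau>'"
    unfolding weierstrass_zeta_eq_infsum(1)[OF \<tau>'] by (rule infsum_cmult_right')
  finally have "eta1 \<tau>' = J * (2 * weierstrass_zeta (J * (1/2)) \<tau>)" using J by (simp add: eta1_def)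
  moreover have "odd d \<or> odd c"
  proof (rule ccontr)
    assume "\<not> ?thesis" then have "even (a * d - b * c)" by simp
    then show False using assms(2) by simp
  qed
  then have "2 * weierstrass_zeta ((of_int d + of_int c * \<tau>) / 2) \<tau> = of_int d * eta1 \<tau> + of_int c * eta2 \<tau>"
    using zeta_half_period[OF assms(1) half_period_notin[OF assms(1), of d c]] Legendre_relation[OF assms(1)] eta1_nome[OF assms(1)] by simp
  moreover have "(of_int d + of_int c * \<tau>) / 2 = J * (1/2)" by (simp add: J_def)
  ultimately show ?thesis by (simp add: \<tau>'_def J_def)
qed

lemma g2_moebius:
  fixes a b c d :: int
  assumes "Im \<tau> > 0" "a * d - b * c = 1"
  shows "g2 ((of_int a * \<tau> + of_int b) / (of_int c * \<tau> + of_int d)) = (of_int c * \<tau> + of_int d) ^ 4 * g2 \<tau>"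
proof -
  define J \<tau>' where "J = of_int c * \<tau> + of_int d" and "\<tau>' = (of_int a * \<tau> + of_int b) / J"
  have J: "J \<noteq> 0" using moebius_denominator_nonzero[OF assms] by (simp add: J_def)
  have \<tau>': "Im \<tau>' > 0" using Im_moebius[OF assms(2), of \<tau>] J assms(1) by (simp add: \<tau>'_def J_def)
  have bij: "bij_betw (\<lambda>\<omega>. J * \<omega>) (period_lattice \<tau>') (period_lattice \<tau>)"
    using period_lattice_moebius[OF assms] by (simp add: J_def \<tau>'_def)
  have g: "g2 t = 60 * (\<Sum>\<^sub>\<infinity>\<omega>\<in>period_lattice t. 1 / \<omega> ^ 4)" if "Im t > 0" for t
  proof -
    have "(\<Sum>\<^sub>\<infinity>\<omega>\<in>period_lattice t. 1 / \<omega> ^ 4) = (\<Sum>\<^sub>\<infinity>(m, n)\<in>UNIV. 1 / (of_int m * t + of_int n) ^ 4)"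
      using infsum_reindex_bij_betw[OF bij_betw_period_lattice[OF that], of "\<lambda>\<omega>. 1 / \<omega> ^ 4"] by (simp add: case_prod_unfold add.commute)
    moreover have "\<dots> = (\<Sum>\<^sub>\<infinity>(m, n)\<in>UNIV - {(0, 0)}. 1 / (of_int m * t + of_int n) ^ 4)"
      by (rule infsum_cong_neutral) auto
    ultimately show ?thesis by (simp add: g2_def)
  qed
  have "(\<Sum>\<^sub>\<infinity>\<omega>\<in>period_lattice \<tau>. 1 / \<omega> ^ 4) = (\<Sum>\<^sub>\<infinity>\<omega>\<in>period_lattice \<tau>'. (1 / J ^ 4) * (1 / \<omega> ^ 4))"
    by (subst infsum_reindex_bij_betw[OF bij, symmetric]) (simp add: power_mult_distrib)
  also have "\<dots> = (1 / J ^ 4) * (\<Sum>\<^sub>\<infinity>\<omega>\<in>period_lattice \<tau>'. 1 / \<omega> ^ 4)" by (rule infsum_cmult_right')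
  finally show ?thesis using J g[OF assms(1)] g[OF \<tau>'] by (simp add: \<tau>'_def J_def)
qed

section \<open>Cusp forms of low weight and Ramanujan's equations\<close>

lemma nome_surj:
  assumes "q \<in> ball 0 1" "q \<noteq> 0"
  obtains \<tau> where "Im \<tau> > 0" "nome \<tau> = q" "Im \<tau> = - ln (norm q) / (2 * pi)"
proof
  let ?t = "Ln q / (2 * of_real pi * \<i>)"
  show "nome ?t = q" using assms by (simp add: nome_def)
  have "Im ?t = - Re (Ln q) / (2 * pi)"
    by (simp add: Im_divide power2_eq_square)
  then show "Im ?t = - ln (norm q) / (2 * pi)" using assms by (simp add: Re_Ln)
  then show "Im ?t > 0" using assms by (simp add: divide_neg_pos)
qed

text \<open>Below height 3/4, a translation to \<open>\<bar>Re \<sigma>\<bar> \<le> 1/2\<close>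
  leaves squared modulus at most \<open>1/4 + 9/16 = 13/16\<close>, so that the inversion raises the
  height by a factor of at least 16/13. Finitely many rounds suffice. The value 3/4 is below
  \<open>sqrt 3 / 2\<close>, which is what makes this factor exceed 1.\<close>

lemma modular_orbit_high:
  fixes \<phi> :: "complex \<Rightarrow> 'a"
  assumes inv: "\<And>\<tau>. Im \<tau> > 0 \<Longrightarrow> \<phi> (- 1 / \<tau>) = \<phi> \<tau>" "\<And>\<tau> n. Im \<tau> > 0 \<Longrightarrow> \<phi> (\<tau> + of_int n) = \<phi> \<tau>"
    and "Im \<tau> > 0"
  shows "\<exists>\<tau>'. Im \<tau>' \<ge> 3/4 \<and> \<phi> \<tau>' = \<phi> \<tau>"
proof -
  have *: "\<exists>\<tau>'. Im \<tau>' \<ge> 3/4 \<and> \<phi> \<tau>' = \<phi> \<tau>" if "Im \<tau> > 0" "Im \<tau> \<ge> 3/4 * (13/16) ^ k" for k \<tau>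
    using that
  proof (induction k arbitrary: \<tau>)
    case 0 then show ?case by auto
  next
    case (Suc k)
    show ?case
    proof (cases "Im \<tau> \<ge> 3/4")
      case True then show ?thesis by auto
    next
      case False
      define \<sigma> where "\<sigma> = \<tau> + of_int (- round (Re \<tau>))"
      have \<sigma>: "\<bar>Re \<sigma>\<bar> \<le> 1/2" "Im \<sigma> = Im \<tau>" "\<phi> \<sigma> = \<phi> \<tau>"
        using of_int_round_abs_le[of "Re \<tau>"] inv(2)[OF Suc.prems(1), of "- round (Re \<tau>)"] by (auto simp: \<sigma>_def abs_minus_commute)
      have "\<bar>Re \<sigma>\<bar>\<^sup>2 \<le> (1/2)\<^sup>2" "(Im \<sigma>)\<^sup>2 \<le> (3/4)\<^sup>2"
        using \<sigma> False Suc.prems(1) by (intro power_mono; simp)+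
      then have n: "(cmod \<sigma>)\<^sup>2 \<le> 13/16" unfolding cmod_power2 by (simp add: power2_eq_square)
      have n0: "(cmod \<sigma>)\<^sup>2 > 0" using \<sigma>(2) Suc.prems(1) by auto
      have im: "Im (- 1 / \<sigma>) = Im \<sigma> / (cmod \<sigma>)\<^sup>2" by (simp add: Im_divide cmod_power2)
      have "3/4 * (13/16) ^ k \<le> Im \<sigma> / (13/16)" using Suc.prems(2) \<sigma>(2) by simp
      also have "\<dots> \<le> Im \<sigma> / (cmod \<sigma>)\<^sup>2" using n n0 \<sigma>(2) Suc.prems(1) by (intro divide_left_mono) auto
      finally have 1: "3/4 * (13/16) ^ k \<le> Im (- 1 / \<sigma>)" unfolding im .
      have 2: "0 < Im (- 1 / \<sigma>)" unfolding im using n0 \<sigma>(2) Suc.prems(1) by simp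
      show ?thesis using Suc.IH[OF 2 1] inv(1)[of \<sigma>] \<sigma>(2,3) Suc.prems(1) by auto
    qed
  qed
  obtain k where "(13/16 :: real) ^ k < Im \<tau>" using real_arch_pow_inv[of "Im \<tau>" "13/16"] assms(3) by auto
  then have "3/4 * (13/16 :: real) ^ k \<le> Im \<tau>" using assms(3) zero_le_power[of "13/16::real" k] by linarith
  then show ?thesis using *[OF assms(3)] by blast
qed

text \<open>The function \<open>y ^ j * exp (- 2 * pi * y)\<close> is largest at
  \<open>j / (2 * pi)\<close>, which for \<open>j \<le> 4\<close> lies below 7/10; this is the
  origin of the weight bound 8. From 7/10 to 3/4 it loses a definite factor, because
  \<open>2 * pi > 6 > 4 / (7/10)\<close>.\<close>

lemma power_exp_decay:
  fixes y :: real
  assumes "y \<ge> 3/4" "j \<le> 4"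
  shows "y ^ j * exp (- 2 * pi * y) \<le> exp (- (1/100)) * ((7/10) ^ j * exp (- 2 * pi * (7/10)))"
proof -
  have "y / (7/10) \<le> exp (y / (7/10) - 1)" using exp_ge_add_one_self[of "y / (7/10) - 1"] by simp
  then have "(y / (7/10)) ^ j \<le> exp (y / (7/10) - 1) ^ j" using assms by (intro power_mono) auto
  also have "\<dots> \<le> exp (y / (7/10) - 1) ^ 4" using assms by (intro power_increasing) auto
  also have "\<dots> = exp (4 * (y / (7/10) - 1))" by (simp add: exp_of_nat_mult[symmetric])
  finally have "(y / (7/10)) ^ j * exp (- 2 * pi * y) \<le> exp (4 * (y / (7/10) - 1)) * exp (- 2 * pi * y)"
    by (intro mult_right_mono) auto
  also have "\<dots> = exp (4 * (y / (7/10) - 1) - 2 * pi * y)" by (simp add: exp_add[symmetric])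
  also have "\<dots> \<le> exp (- (1/100) - 2 * pi * (7/10))"
  proof -
    have "6 * (y - 7/10) \<le> 2 * pi * (y - 7/10)" using pi_gt3 assms by (intro mult_right_mono) auto
    then show ?thesis using assms by (simp add: algebra_simps)
  qed
  also have "\<dots> = exp (- (1/100)) * exp (- 2 * pi * (7/10))" by (simp add: exp_add[symmetric])
  finally show ?thesis by (simp add: power_divide field_simps)
qed

text \<open>
  Siegel's argument: \<open>(Im \<tau>) ^ j * \<bar>f \<tau>\<bar>\<close> is invariant, so its supremum is already approached
  on \<open>Im \<tau> \<ge> 3/4\<close>, while the maximum modulus principle for \<open>f / q\<close> bounds it there by a
  smaller multiple of its supremum on \<open>Im \<tau> = 7/10\<close>.
\<close>
lemma no_cusp_forms_low_weight:
  assumes P: "P holomorphic_on ball 0 1" "P 0 = 0" and j: "j \<le> 4"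
    and S: "\<And>\<tau>. Im \<tau> > 0 \<Longrightarrow> P (nome (- 1 / \<tau>)) = \<tau> ^ (2 * j) * P (nome \<tau>)"
    and \<tau>: "Im \<tau> > 0"
  shows "P (nome \<tau>) = 0"
proof -
  define \<phi> where "\<phi> \<tau> = Im \<tau> ^ j * cmod (P (nome \<tau>))" for \<tau>
  have inv1: "\<phi> (- 1 / \<tau>) = \<phi> \<tau>" if "Im \<tau> > 0" for \<tau>
  proof -
    have "\<tau> \<noteq> 0" using that by auto
    moreover have "Im (- 1 / \<tau>) = Im \<tau> / (cmod \<tau>)\<^sup>2" by (simp add: Im_divide cmod_power2)
    ultimately show ?thesis by (simp only: \<phi>_def S[OF that] norm_mult norm_power power_divide power_mult) simp
  qed
  have inv2: "\<phi> (\<tau> + of_int n) = \<phi> \<tau>" for \<tau> n by (simp add: \<phi>_def nome_add)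
  define R where "R z = (if z = 0 then deriv P 0 else (P z - P 0) / (z - 0))" for z
  have R: "R holomorphic_on ball 0 1" "\<And>z. P z = z * R z"
    using pole_lemma_open[OF P(1) open_ball, of 0] P(2) by (simp_all add: R_def[abs_def])
  define r where "r = exp (- 2 * pi * (7/10))"
  have r: "0 < r" "r < 1" by (auto simp: r_def)
  have cR: "continuous_on (cball 0 r) R"
    using R(1) r by (auto intro!: holomorphic_on_imp_continuous_on elim: holomorphic_on_subset)
  then have "bounded (R ` cball 0 r)" by (intro compact_imp_bounded compact_continuous_image) auto
  then obtain B where B: "norm (R z) \<le> B" if "z \<in> cball 0 r" for z unfolding bounded_iff by blast
  define c where "c = exp (- (1/100) :: real)"
  have c: "0 < c" "c < 1" by (auto simp: c_def)
  have bound: "\<phi> \<tau> \<le> c * ((7/10) ^ j * r * K)" if "Im \<tau> \<ge> 3/4" "\<And>z. z \<in> cball 0 r \<Longrightarrow> norm (R z) \<le> K" for \<tau> K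
  proof -
    have "norm (nome \<tau>) \<le> r" unfolding norm_nome r_def using that(1) by simp
    then have "norm (R (nome \<tau>)) \<le> K" using that(2) by simp
    have "\<phi> \<tau> = (Im \<tau> ^ j * exp (- 2 * pi * Im \<tau>)) * norm (R (nome \<tau>))"
      unfolding \<phi>_def R(2)[of "nome \<tau>"] norm_mult norm_nome by simp
    also have "\<dots> \<le> (c * ((7/10) ^ j * r)) * K"
      unfolding c_def r_def using c \<open>norm (R (nome \<tau>)) \<le> K\<close> that(1)
      by (intro mult_mono power_exp_decay j) auto
    finally show ?thesis by (simp add: mult_ac)
  qed
  have high: "\<exists>\<tau>'. Im \<tau>' \<ge> 3/4 \<and> \<phi> \<tau>' = \<phi> \<tau>" if "Im \<tau> > 0" for \<tau>
    using modular_orbit_high[of \<phi>, OF inv1 inv2 that] by blast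
  define M where "M = Sup (\<phi> ` {\<tau>. Im \<tau> > 0})"
  have "bdd_above (\<phi> ` {\<tau>. Im \<tau> > 0})"
    using high bound[OF _ B] by (intro bdd_aboveI2[of _ _ "c * ((7/10) ^ j * r * B)"]) (metis mem_Collect_eq)
  then have M: "\<phi> \<tau> \<le> M" if "Im \<tau> > 0" for \<tau>
    unfolding M_def using that by (intro cSup_upper) auto
  have RM: "norm (R z) \<le> M / ((7/10) ^ j * r)" if "z \<in> cball 0 r" for z
  proof (rule maximum_modulus_frontier[of R "cball 0 r"])
    show "R holomorphic_on interior (cball 0 r)" using R(1) r by (auto elim!: holomorphic_on_subset)
    show "continuous_on (closure (cball 0 r)) R" using cR by simp
    fix w :: complex assume "w \<in> frontier (cball 0 r)"
    then have w: "norm w = r" by simp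
    then have "w \<in> ball 0 1" "w \<noteq> 0" using r by auto
    then obtain \<sigma> where \<sigma>: "Im \<sigma> > 0" "nome \<sigma> = w" "Im \<sigma> = - ln (norm w) / (2 * pi)"
      using nome_surj by blast
    then have im: "Im \<sigma> = 7/10" using w by (simp add: r_def)
    then have "\<phi> \<sigma> = (7/10) ^ j * (r * norm (R w))"
      unfolding \<phi>_def \<sigma>(2) R(2)[of w] norm_mult w im by simp
    then have "(7/10) ^ j * (r * norm (R w)) \<le> M" using M[OF \<sigma>(1)] by simp
    then show "norm (R w) \<le> M / ((7/10) ^ j * r)" using r by (simp add: field_simps)
  qed (use that in auto)
  have "\<phi> \<tau> \<le> c * M" if t0: "Im \<tau> > 0" for \<tau>
  proof -
    obtain \<tau>' where t: "Im \<tau>' \<ge> 3/4" "\<phi> \<tau>' = \<phi> \<tau>" using high[OF t0] by blast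
    have "\<phi> \<tau>' \<le> c * M" using bound[OF t(1) RM] r by simp
    then show ?thesis using t(2) by simp
  qed
  then have "M \<le> c * M" unfolding M_def
    by (intro cSup_least) (auto intro!: exI[of _ \<i>])
  then have "(1 - c) * M \<le> 0" by (simp add: algebra_simps)
  then have "M \<le> 0" using c by (simp add: mult_le_0_iff)
  then have "\<phi> \<tau> \<le> 0" using M[OF \<tau>] by simp
  then show ?thesis using zero_less_power[OF \<tau>, of j] unfolding \<phi>_def by (simp add: mult_le_0_iff)
qed

section \<open>Derivatives with respect to \<open>\<tau>\<close> of functions of the nome\<close>

definition Dq :: "(complex \<Rightarrow> complex) \<Rightarrow> complex \<Rightarrow> complex" where
  "Dq F q = 2 * of_real pi * \<i> * q * deriv F q"

lemma Dq_holomorphic: "F holomorphic_on ball 0 1 \<Longrightarrow> Dq F holomorphic_on ball 0 1"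
  unfolding Dq_def[abs_def] by (intro holomorphic_intros) auto

lemma Dq_0 [simp]: "Dq F 0 = 0" by (simp add: Dq_def)

lemma has_field_derivative_nome_comp:
  assumes "F holomorphic_on S" "open S" "nome \<tau> \<in> S"
  shows "((\<lambda>\<tau>. F (nome \<tau>)) has_field_derivative Dq F (nome \<tau>)) (at \<tau>)"
proof -
  have "(nome has_field_derivative 2 * of_real pi * \<i> * nome \<tau>) (at \<tau>)"
    unfolding nome_def[abs_def] by (auto intro!: derivative_eq_intros)
  moreover have "(F has_field_derivative deriv F (nome \<tau>)) (at (nome \<tau>))"
    using assms holomorphic_derivI by blast
  ultimately have "((\<lambda>\<tau>. F (nome \<tau>)) has_field_derivative deriv F (nome \<tau>) * (2 * of_real pi * \<i> * nome \<tau>)) (at \<tau>)"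
    by (rule DERIV_chain2[rotated])
  then show ?thesis by (simp add: Dq_def mult_ac)
qed

lemma has_field_derivative_nome:
  assumes "F holomorphic_on ball 0 1" "Im \<tau> > 0"
  shows "((\<lambda>\<tau>. F (nome \<tau>)) has_field_derivative Dq F (nome \<tau>)) (at \<tau>)"
  by (rule has_field_derivative_nome_comp[OF assms(1) open_ball nome_in_ball[OF assms(2)]])

lemma open_upper: "open {\<tau>. Im \<tau> > 0}" by (rule open_halfspace_Im_gt)

lemma Dq_inversion:
  assumes "F holomorphic_on ball 0 1" "\<And>\<tau>. Im \<tau> > 0 \<Longrightarrow> F (nome (- 1 / \<tau>)) = G \<tau>"
    and "Im \<tau> > 0" "(G has_field_derivative G') (at \<tau>)"
  shows "Dq F (nome (- 1 / \<tau>)) = \<tau> ^ 2 * G'"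
proof -
  have t0: "\<tau> \<noteq> 0" using assms(3) by auto
  have im: "Im (- 1 / \<tau>) > 0" using assms(3) t0 by (simp add: Im_divide) (simp add: sum_power2_gt_zero_iff complex_eq_iff)
  have "((\<lambda>\<tau>. - 1 / \<tau>) has_field_derivative 1 / \<tau> ^ 2) (at \<tau>)"
    using t0 by (auto intro!: derivative_eq_intros simp: power2_eq_square)
  from DERIV_chain2[OF has_field_derivative_nome[OF assms(1) im] this]
  have "((\<lambda>\<tau>. F (nome (- 1 / \<tau>))) has_field_derivative Dq F (nome (- 1 / \<tau>)) * (1 / \<tau> ^ 2)) (at \<tau>)" .
  then have "(G has_field_derivative Dq F (nome (- 1 / \<tau>)) * (1 / \<tau> ^ 2)) (at \<tau>)"
    by (rule has_field_derivative_transform_within_open[OF _ open_upper]) (use assms in auto)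
  then have "G' = Dq F (nome (- 1 / \<tau>)) * (1 / \<tau> ^ 2)" using assms(4) DERIV_unique by blast
  then show ?thesis using t0 by simp
qed

lemma \<eta>q_holomorphic: "\<eta>q holomorphic_on ball 0 1"
  unfolding \<eta>q_def[abs_def] by (intro holomorphic_intros lambert_holomorphic \<phi>_basic)

lemma gq_holomorphic: "gq holomorphic_on ball 0 1"
  unfolding gq_def[abs_def] by (intro holomorphic_intros lambert_holomorphic \<phi>_basic)

lemma \<eta>q_gq_0: "\<eta>q 0 = of_real pi ^ 2 / 3" "gq 0 = 4 * of_real pi ^ 4 / 3"
  using lambert_0(1)[OF \<phi>_basic(1,3)] lambert_0(1)[OF \<phi>_basic(2,4)] by (simp_all add: \<eta>q_def gq_def)

lemma Im_inversion_pos: "Im \<tau> > 0 \<Longrightarrow> Im (- 1 / \<tau>) > 0"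
  using Im_moebius[of 0 0 "-1" 1 \<tau>] by (cases "\<tau> = 0") simp_all

lemma \<eta>q_inversion:
  assumes "Im \<tau> > 0"
  shows "\<eta>q (nome (- 1 / \<tau>)) = \<tau> ^ 2 * \<eta>q (nome \<tau>) - 2 * of_real pi * \<i> * \<tau>"
  using eta1_moebius[OF assms, of 0 0 "-1" 1] Legendre_relation[OF assms]
    eta1_nome[OF assms] eta1_nome[OF Im_inversion_pos[OF assms]]
  by (simp add: power2_eq_square algebra_simps)

lemma gq_inversion:
  assumes "Im \<tau> > 0"
  shows "gq (nome (- 1 / \<tau>)) = \<tau> ^ 4 * gq (nome \<tau>)"
  using g2_moebius[OF assms, of 0 0 "-1" 1] g2_nome[OF assms] g2_nome[OF Im_inversion_pos[OF assms]] by simp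

text \<open>Under inversion the inhomogeneous terms of the derivative and of the square of
  \<open>\<eta>q\<close> cancel, so the difference of both sides has weight 4. Its constant term
  vanishes because \<open>12 * (pi ^ 2 / 3) ^ 2 = 4 * pi ^ 4 / 3\<close>.\<close>

lemma Dq_\<eta>q:
  assumes "Im \<tau> > 0"
  shows "Dq \<eta>q (nome \<tau>) = \<i> / (24 * of_real pi) * (12 * \<eta>q (nome \<tau>) ^ 2 - gq (nome \<tau>))"
proof -
  define P where "P q = Dq \<eta>q q - \<i> / (24 * of_real pi) * (12 * \<eta>q q ^ 2 - gq q)" for q
  have "P (nome \<tau>) = 0"
  proof (rule no_cusp_forms_low_weight[of P 2])
    show "P holomorphic_on ball 0 1" unfolding P_def[abs_def]
      by (intro holomorphic_intros Dq_holomorphic \<eta>q_holomorphic gq_holomorphic) auto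
    show "P 0 = 0" by (simp add: P_def \<eta>q_gq_0 power2_eq_square eval_nat_numeral)
    fix \<tau> assume t: "Im \<tau> > 0"
    have d: "((\<lambda>\<tau>. \<tau> ^ 2 * \<eta>q (nome \<tau>) - 2 * of_real pi * \<i> * \<tau>) has_field_derivative
       (2 * \<tau> * \<eta>q (nome \<tau>) + \<tau> ^ 2 * Dq \<eta>q (nome \<tau>) - 2 * of_real pi * \<i>)) (at \<tau>)"
      by (auto intro!: derivative_eq_intros has_field_derivative_nome \<eta>q_holomorphic t simp: mult_ac)
    have D: "Dq \<eta>q (nome (- 1 / \<tau>)) = \<tau> ^ 2 * (2 * \<tau> * \<eta>q (nome \<tau>) + \<tau> ^ 2 * Dq \<eta>q (nome \<tau>) - 2 * of_real pi * \<i>)"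
      by (rule Dq_inversion[OF \<eta>q_holomorphic \<eta>q_inversion t d])
    show "P (nome (- 1 / \<tau>)) = \<tau> ^ (2 * 2) * P (nome \<tau>)"
      unfolding P_def D \<eta>q_inversion[OF t] gq_inversion[OF t]
      by (simp add: field_simps) (simp add: eval_nat_numeral algebra_simps)
  qed (use assms in auto)
  then show ?thesis by (simp add: P_def)
qed

text \<open>The Serre derivative of \<open>gq\<close>, a constant multiple of the Eisenstein series
  of weight 6. Defined in this way it needs no lattice sum of its own, and Ramanujan's equation for
  \<open>gq\<close> holds by definition.\<close>

definition Gq :: "complex \<Rightarrow> complex" where
  "Gq q = Dq gq q - 2 * \<i> / of_real pi * \<eta>q q * gq q"

lemma Gq_holomorphic: "Gq holomorphic_on ball 0 1"
  unfolding Gq_def[abs_def]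
  by (intro holomorphic_intros Dq_holomorphic \<eta>q_holomorphic gq_holomorphic) auto

lemma Gq_inversion:
  assumes t: "Im \<tau> > 0"
  shows "Gq (nome (- 1 / \<tau>)) = \<tau> ^ 6 * Gq (nome \<tau>)"
proof -
  have d: "((\<lambda>\<tau>. \<tau> ^ 4 * gq (nome \<tau>)) has_field_derivative
     (4 * \<tau> ^ 3 * gq (nome \<tau>) + \<tau> ^ 4 * Dq gq (nome \<tau>))) (at \<tau>)"
    by (auto intro!: derivative_eq_intros has_field_derivative_nome gq_holomorphic t simp: mult_ac)
  have D: "Dq gq (nome (- 1 / \<tau>)) = \<tau> ^ 2 * (4 * \<tau> ^ 3 * gq (nome \<tau>) + \<tau> ^ 4 * Dq gq (nome \<tau>))"
    by (rule Dq_inversion[OF gq_holomorphic gq_inversion t d])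
  show ?thesis unfolding Gq_def D \<eta>q_inversion[OF t] gq_inversion[OF t]
    by (simp add: field_simps) (simp add: eval_nat_numeral algebra_simps)
qed

text \<open>The difference of both sides is a cusp form of weight 8, the largest weight that the
  vanishing result admits.\<close>

lemma Dq_Gq:
  assumes "Im \<tau> > 0"
  shows "Dq Gq (nome \<tau>) = 3 * \<i> / of_real pi * \<eta>q (nome \<tau>) * Gq (nome \<tau>) - gq (nome \<tau>) ^ 2 / (2 * of_real pi ^ 2)"
proof -
  define P where "P q = Dq Gq q - 3 * \<i> / of_real pi * \<eta>q q * Gq q + gq q ^ 2 / (2 * of_real pi ^ 2)" for q
  have "P (nome \<tau>) = 0"
  proof (rule no_cusp_forms_low_weight[of P 4])
    show "P holomorphic_on ball 0 1" unfolding P_def[abs_def]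
      by (intro holomorphic_intros Dq_holomorphic \<eta>q_holomorphic gq_holomorphic Gq_holomorphic) auto
    show "P 0 = 0" by (simp add: P_def Gq_def \<eta>q_gq_0 field_simps eval_nat_numeral)
    fix \<tau> assume t: "Im \<tau> > 0"
    have d: "((\<lambda>\<tau>. \<tau> ^ 6 * Gq (nome \<tau>)) has_field_derivative
       (6 * \<tau> ^ 5 * Gq (nome \<tau>) + \<tau> ^ 6 * Dq Gq (nome \<tau>))) (at \<tau>)"
      by (auto intro!: derivative_eq_intros has_field_derivative_nome Gq_holomorphic t simp: mult_ac)
    have D: "Dq Gq (nome (- 1 / \<tau>)) = \<tau> ^ 2 * (6 * \<tau> ^ 5 * Gq (nome \<tau>) + \<tau> ^ 6 * Dq Gq (nome \<tau>))"
      by (rule Dq_inversion[OF Gq_holomorphic Gq_inversion t d])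
    show "P (nome (- 1 / \<tau>)) = \<tau> ^ (2 * 4) * P (nome \<tau>)"
      unfolding P_def D \<eta>q_inversion[OF t] gq_inversion[OF t] Gq_inversion[OF t]
      by (simp add: field_simps) (simp add: eval_nat_numeral algebra_simps)
  qed (use assms in auto)
  then show ?thesis by (simp add: P_def algebra_simps)
qed

section \<open>Simplicity of the zeros\<close>

text \<open>A constant multiple of the modular discriminant: \<open>gq\<close> and \<open>Gq\<close>
  are multiples of the Eisenstein series of weights 4 and 6, and the factor
  \<open>3 * pi ^ 2\<close> makes the constant terms cancel.\<close>

definition Disc :: "complex \<Rightarrow> complex" where
  "Disc q = gq q ^ 3 + 3 * of_real pi ^ 2 * Gq q ^ 2"

lemma has_field_derivative_Dq_0:
  assumes "F holomorphic_on ball 0 1"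
  shows "(Dq F has_field_derivative 2 * of_real pi * \<i> * deriv F 0) (at 0)"
proof -
  have "deriv F holomorphic_on ball 0 1" by (rule holomorphic_deriv[OF assms open_ball])
  then have "(deriv F has_field_derivative deriv (deriv F) 0) (at 0)"
    by (rule holomorphic_derivI[OF _ open_ball]) auto
  from DERIV_mult[OF DERIV_cmult[OF DERIV_ident, of "2 * of_real pi * \<i>"] this]
  show ?thesis by (simp add: Dq_def[abs_def] mult_ac)
qed

lemma \<eta>q_gq_deriv_0:
  "(\<eta>q has_field_derivative - 8 * of_real pi ^ 2) (at 0)" "(gq has_field_derivative 320 * of_real pi ^ 4) (at 0)"
proof -
  have l: "(lambert \<phi>2 has_field_derivative 1) (at 0)" "(lambert \<phi>4 has_field_derivative 1) (at 0)"
    using lambert_series(3)[OF \<phi>_basic(1,3), of 0] lambert_series(3)[OF \<phi>_basic(2,4), of 0]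
      lambert_0(2)[OF \<phi>_basic(1,3)] lambert_0(2)[OF \<phi>_basic(2,4)] deriv_\<phi>2[of 0] deriv_\<phi>4_0 by simp_all
  show "(\<eta>q has_field_derivative - 8 * of_real pi ^ 2) (at 0)"
    unfolding \<eta>q_def[abs_def] using l(1) by (auto intro!: derivative_eq_intros)
  show "(gq has_field_derivative 320 * of_real pi ^ 4) (at 0)"
    unfolding gq_def[abs_def] using l(2) by (auto intro!: derivative_eq_intros)
qed

lemma deriv_Disc_0: "(Disc has_field_derivative 4096 * of_real pi ^ 12) (at 0)"
proof -
  note e = \<eta>q_gq_deriv_0(1) and g = \<eta>q_gq_deriv_0(2)
  have "(Gq has_field_derivative 2 * of_real pi * \<i> * (320 * of_real pi ^ 4)
      - 2 * \<i> / of_real pi * (- 8 * of_real pi ^ 2 * gq 0 + \<eta>q 0 * (320 * of_real pi ^ 4))) (at 0)"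
  proof -
    have "Gq = (\<lambda>q. Dq gq q - 2 * \<i> / of_real pi * (\<eta>q q * gq q))" by (simp add: Gq_def fun_eq_iff mult.assoc)
    moreover have "((\<lambda>q. Dq gq q - 2 * \<i> / of_real pi * (\<eta>q q * gq q)) has_field_derivative
      2 * of_real pi * \<i> * deriv gq 0 - 2 * \<i> / of_real pi * ((- 8 * of_real pi ^ 2) * gq 0 + (320 * of_real pi ^ 4) * \<eta>q 0)) (at 0)"
      by (intro DERIV_diff has_field_derivative_Dq_0 gq_holomorphic DERIV_cmult DERIV_mult e g)
    ultimately show ?thesis unfolding DERIV_imp_deriv[OF g] by (simp only: mult.commute[of "\<eta>q 0"])
  qed
  also have "2 * of_real pi * \<i> * (320 * of_real pi ^ 4)
      - 2 * \<i> / of_real pi * (- 8 * of_real pi ^ 2 * gq 0 + \<eta>q 0 * (320 * of_real pi ^ 4)) = 448 * \<i> * of_real pi ^ 5"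
    unfolding \<eta>q_gq_0 by (simp add: field_simps eval_nat_numeral)
  finally have G: "(Gq has_field_derivative 448 * \<i> * of_real pi ^ 5) (at 0)" .
  have G0: "Gq 0 = - 8 * \<i> / 9 * of_real pi ^ 5"
    unfolding Gq_def \<eta>q_gq_0 by (simp add: field_simps eval_nat_numeral)
  have "(Disc has_field_derivative 3 * gq 0 ^ 2 * (320 * of_real pi ^ 4)
      + 3 * of_real pi ^ 2 * (2 * Gq 0 * (448 * \<i> * of_real pi ^ 5))) (at 0)"
  proof -
    have "((\<lambda>q. gq q * (gq q * gq q) + 3 * of_real pi ^ 2 * (Gq q * Gq q)) has_field_derivative
      (320 * of_real pi ^ 4 * (gq 0 * gq 0) + (320 * of_real pi ^ 4 * gq 0 + 320 * of_real pi ^ 4 * gq 0) * gq 0)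
      + 3 * of_real pi ^ 2 * (448 * \<i> * of_real pi ^ 5 * Gq 0 + 448 * \<i> * of_real pi ^ 5 * Gq 0)) (at 0)"
      by (intro DERIV_add DERIV_cmult DERIV_mult g G)
    moreover have "Disc = (\<lambda>q. gq q * (gq q * gq q) + 3 * of_real pi ^ 2 * (Gq q * Gq q))"
      by (simp add: Disc_def fun_eq_iff power2_eq_square power3_eq_cube)
    ultimately show ?thesis by (simp add: power2_eq_square distrib_left mult_ac)
  qed
  also have "3 * gq 0 ^ 2 * (320 * of_real pi ^ 4)
      + 3 * of_real pi ^ 2 * (2 * Gq 0 * (448 * \<i> * of_real pi ^ 5)) = 4096 * of_real pi ^ 12"
    unfolding G0 \<eta>q_gq_0 by (simp add: power_mult_distrib power_divide)
  finally show ?thesis .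
qed

text \<open>\<open>\<lambda>\<tau>. Disc (nome \<tau>)\<close> solves a linear differential equation on the half plane.\<close>
lemma Disc_nonzero:
  assumes "Im \<tau> > 0"
  shows "Disc (nome \<tau>) \<noteq> 0"
proof
  assume 0: "Disc (nome \<tau>) = 0"
  let ?H = "{\<tau>. Im \<tau> > 0}"
  have H: "convex ?H" by (rule convex_halfspace_Im_gt)
  have "(\<lambda>\<tau>. 6 * \<i> / of_real pi * \<eta>q (nome \<tau>)) holomorphic_on ?H"
    using has_field_derivative_nome[OF \<eta>q_holomorphic]
    by (intro holomorphic_intros) (subst holomorphic_on_open[OF open_upper], blast)
  \<comment> \<open>With a primitive \<open>p\<close> of the logarithmic derivative,
    \<open>Disc (nome \<tau>) * exp (- p \<tau>)\<close> is constant. One zero would make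
    \<open>Disc\<close> vanish identically, contrary to its nonzero derivative at
    \<open>q = 0\<close>.\<close>
  then obtain p where p0: "\<And>x. x \<in> ?H \<Longrightarrow> (p has_field_derivative 6 * \<i> / of_real pi * \<eta>q (nome x)) (at x within ?H)"
    using holomorphic_convex_primitive'[OF H open_upper] by blast
  have p: "(p has_field_derivative 6 * \<i> / of_real pi * \<eta>q (nome x)) (at x)" if "Im x > 0" for x
    using p0[of x] at_within_open[OF _ open_upper, of x] that by simp
  have alg: "3 * g ^ 2 * (G + 2 * \<i> / P * e * g) + 3 * P ^ 2 * (2 * G * (3 * \<i> / P * e * G - g ^ 2 / (2 * P ^ 2)))
      = 6 * \<i> / P * e * (g ^ 3 + 3 * P ^ 2 * G ^ 2)" if "P \<noteq> 0" for e g G P :: complex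
    using that by (simp add: divide_simps) (simp add: eval_nat_numeral algebra_simps)
  have D: "((\<lambda>\<tau>. Disc (nome \<tau>)) has_field_derivative 6 * \<i> / of_real pi * \<eta>q (nome x) * Disc (nome x)) (at x)"
    if "Im x > 0" for x
  proof -
    let ?g' = "Dq gq (nome x)" and ?G' = "Dq Gq (nome x)"
    have "((\<lambda>\<tau>. gq (nome \<tau>) * (gq (nome \<tau>) * gq (nome \<tau>)) + 3 * of_real pi ^ 2 * (Gq (nome \<tau>) * Gq (nome \<tau>)))
      has_field_derivative ?g' * (gq (nome x) * gq (nome x)) + (?g' * gq (nome x) + ?g' * gq (nome x)) * gq (nome x)
        + 3 * of_real pi ^ 2 * (?G' * Gq (nome x) + ?G' * Gq (nome x))) (at x)"
      by (intro DERIV_add DERIV_cmult DERIV_mult has_field_derivative_nome gq_holomorphic Gq_holomorphic that)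
    moreover have "?g' * (gq (nome x) * gq (nome x)) + (?g' * gq (nome x) + ?g' * gq (nome x)) * gq (nome x)
        + 3 * of_real pi ^ 2 * (?G' * Gq (nome x) + ?G' * Gq (nome x))
      = 3 * gq (nome x) ^ 2 * ?g' + 3 * of_real pi ^ 2 * (2 * Gq (nome x) * ?G')"
      by (simp add: power2_eq_square algebra_simps)
    moreover have "?g' = Gq (nome x) + 2 * \<i> / of_real pi * \<eta>q (nome x) * gq (nome x)" by (simp add: Gq_def)
    moreover have "3 * gq (nome x) ^ 2 * (Gq (nome x) + 2 * \<i> / of_real pi * \<eta>q (nome x) * gq (nome x))
        + 3 * of_real pi ^ 2 * (2 * Gq (nome x) * ?G') = 6 * \<i> / of_real pi * \<eta>q (nome x) * Disc (nome x)"
      unfolding Dq_Gq[OF that] Disc_def by (rule alg) simp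
    moreover have "(\<lambda>\<tau>. Disc (nome \<tau>)) = (\<lambda>\<tau>. gq (nome \<tau>) * (gq (nome \<tau>) * gq (nome \<tau>)) + 3 * of_real pi ^ 2 * (Gq (nome \<tau>) * Gq (nome \<tau>)))"
      by (simp add: Disc_def power2_eq_square power3_eq_cube mult.assoc)
    ultimately show ?thesis by metis
  qed
  have "((\<lambda>\<tau>. Disc (nome \<tau>) * exp (- p \<tau>)) has_field_derivative 0) (at x within ?H)" if "x \<in> ?H" for x
  proof -
    have x: "Im x > 0" using that by simp
    have "((\<lambda>\<tau>. Disc (nome \<tau>) * exp (- p \<tau>)) has_field_derivative
       6 * \<i> / of_real pi * \<eta>q (nome x) * Disc (nome x) * exp (- p x) +
       exp (- p x) * - (6 * \<i> / of_real pi * \<eta>q (nome x)) * Disc (nome x)) (at x)"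
      by (intro DERIV_mult D[OF x] DERIV_chain2[OF DERIV_exp] DERIV_minus p[OF x])
    also have "6 * \<i> / of_real pi * \<eta>q (nome x) * Disc (nome x) * exp (- p x) +
       exp (- p x) * - (6 * \<i> / of_real pi * \<eta>q (nome x)) * Disc (nome x) = 0" by simp
    finally show ?thesis by (rule has_field_derivative_at_within)
  qed
  then have "\<exists>c. \<forall>x\<in>?H. Disc (nome x) * exp (- p x) = c"
    using has_field_derivative_zero_constant[OF H, of "\<lambda>\<tau>. Disc (nome \<tau>) * exp (- p \<tau>)"] by blast
  then obtain c where c: "Disc (nome x) * exp (- p x) = c" if "Im x > 0" for x by blast
  then have dz: "Disc (nome x) = 0" if "Im x > 0" for x
    using c[OF assms] c[OF that] 0 by simp
  have z: "Disc q = 0" if q: "q \<in> ball 0 1" "q \<noteq> 0" for q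
  proof -
    obtain x where "Im x > 0" "nome x = q" using nome_surj[OF q] by blast
    then show ?thesis using dz by blast
  qed
  have "Disc 0 = 0" unfolding Disc_def Gq_def \<eta>q_gq_0 by (simp add: field_simps eval_nat_numeral)
  then have "Disc q = 0" if "q \<in> ball 0 1" for q using z[OF that] by (cases "q = 0") auto
  then have "(Disc has_field_derivative 0) (at 0)"
    using has_field_derivative_transform_within_open[of "\<lambda>_. 0" 0 0 "ball 0 1" Disc] by simp
  from DERIV_unique[OF this deriv_Disc_0] show False by simp
qed

text \<open>
  The homogeneous form of \<open>f_fam\<close>, with \<open>C = x / y\<close>; the value \<open>C = \<infinity>\<close>, that is \<open>y = 0\<close>,
  corresponds to the derivative of \<open>E2\<close>.
\<close>
definition f_hom :: "real \<Rightarrow> real \<Rightarrow> complex \<Rightarrow> complex" where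
  "f_hom x y \<tau> = 12 * (of_real x * eta1 \<tau> - of_real y * eta2 \<tau>)\<^sup>2 - g2 \<tau> * (of_real x - of_real y * \<tau>)\<^sup>2"

lemma f_fam_eq_f_hom: "f_fam C \<tau> = f_hom C 1 \<tau>" by (simp add: f_fam_def f_hom_def)

lemma f_hom_scale: "f_hom (k * x) (k * y) \<tau> = of_real k ^ 2 * f_hom x y \<tau>"
  by (simp add: f_hom_def power2_eq_square algebra_simps)

lemma f_hom_zero_scale:
  assumes "k \<noteq> 0" shows "f_hom (k * x) (k * y) \<tau> = 0 \<longleftrightarrow> f_hom x y \<tau> = 0"
  using assms by (simp add: f_hom_scale)

lemma f_hom_eq:
  assumes "Im \<tau> > 0"
  shows "f_hom x y \<tau> = 12 * ((of_real x - of_real y * \<tau>) * \<eta>q (nome \<tau>) + 2 * of_real pi * \<i> * of_real y)\<^sup>2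
    - gq (nome \<tau>) * (of_real x - of_real y * \<tau>)\<^sup>2"
  unfolding f_hom_def Legendre_relation[OF assms] eta1_nome[OF assms] g2_nome[OF assms] by (simp add: algebra_simps)

text \<open>The quasi-periods \<open>(eta2, eta1)\<close> and the periods \<open>(\<tau>, 1)\<close>
  undergo the same linear substitution, with factors \<open>J\<close> and \<open>1 / J\<close>. Both
  linear forms in \<open>f_hom\<close> thus see the same change of \<open>(x, y)\<close>, and the
  factor \<open>J ^ 4\<close> of \<open>g2\<close> balances the weights.\<close>

lemma f_hom_moebius:
  fixes a b c d :: int
  assumes "Im \<tau> > 0" "a * d - b * c = 1"
  shows "f_hom x y ((of_int a * \<tau> + of_int b) / (of_int c * \<tau> + of_int d)) =
    (of_int c * \<tau> + of_int d) ^ 2 * f_hom (x * of_int d - y * of_int b) (y * of_int a - x * of_int c) \<tau>"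
proof -
  define J \<tau>' where "J = of_int c * \<tau> + of_int d" and "\<tau>' = (of_int a * \<tau> + of_int b) / J"
  have J: "J \<noteq> 0" using moebius_denominator_nonzero[OF assms] by (simp add: J_def)
  have \<tau>': "Im \<tau>' > 0" using Im_moebius[OF assms(2), of \<tau>] J assms(1) by (simp add: \<tau>'_def J_def)
  have e1: "eta1 \<tau>' = J * (of_int d * eta1 \<tau> + of_int c * eta2 \<tau>)"
    using eta1_moebius[OF assms] by (simp add: J_def \<tau>'_def)
  have g: "g2 \<tau>' = J ^ 4 * g2 \<tau>" using g2_moebius[OF assms] by (simp add: J_def \<tau>'_def)
  have det: "of_int a * of_int d - of_int b * of_int c = (1::complex)"
    using arg_cong[OF assms(2), of "of_int :: int \<Rightarrow> complex"] by simp
  have "eta2 \<tau>' = (of_int a * \<tau> + of_int b) * (of_int d * eta1 \<tau> + of_int c * eta2 \<tau>) - 2 * of_real pi * \<i>"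
    unfolding Legendre_relation[OF \<tau>'] e1 using J by (simp add: \<tau>'_def)
  \<comment> \<open>Determinant 1 and the Legendre relation at \<open>\<tau>\<close> turn the
    constant into a linear form in \<open>eta1\<close> and \<open>eta2\<close>, so that
    \<open>eta2\<close> also transforms linearly.\<close>
  also have "2 * of_real pi * \<i> = (of_int a * of_int d - of_int b * of_int c) * (\<tau> * eta1 \<tau> - eta2 \<tau>)"
    unfolding det Legendre_relation[OF assms(1)] by simp
  finally have e2: "eta2 \<tau>' = J * (of_int a * eta2 \<tau> + of_int b * eta1 \<tau>)"
    by (simp add: J_def algebra_simps)
  have "of_real x - of_real y * \<tau>' = ((of_real x * of_int d - of_real y * of_int b) - (of_real y * of_int a - of_real x * of_int c) * \<tau>) / J"
    using J by (simp add: \<tau>'_def field_simps) (simp add: J_def algebra_simps)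
  moreover have "of_real x * eta1 \<tau>' - of_real y * eta2 \<tau>' =
     J * ((of_real x * of_int d - of_real y * of_int b) * eta1 \<tau> - (of_real y * of_int a - of_real x * of_int c) * eta2 \<tau>)"
    unfolding e1 e2 by (simp add: algebra_simps)
  ultimately have "f_hom x y \<tau>' = J ^ 2 * f_hom (x * of_int d - y * of_int b) (y * of_int a - x * of_int c) \<tau>"
    unfolding f_hom_def g using J by (simp add: power_mult_distrib power_divide) (simp add: eval_nat_numeral field_simps)
  then show ?thesis by (simp add: J_def \<tau>'_def)
qed

lemma critical_point_E2_iff:
  assumes "Im \<tau> > 0"
  shows "critical_point_E2 \<tau> \<longleftrightarrow> f_hom 1 0 \<tau> = 0"
proof -
  have "((\<lambda>\<tau>. 3 / of_real pi ^ 2 * \<eta>q (nome \<tau>)) has_field_derivative 3 / of_real pi ^ 2 * Dq \<eta>q (nome \<tau>)) (at \<tau>)"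
    by (intro DERIV_cmult has_field_derivative_nome \<eta>q_holomorphic assms)
  then have "(E2 has_field_derivative 3 / of_real pi ^ 2 * Dq \<eta>q (nome \<tau>)) (at \<tau>)"
    by (rule has_field_derivative_transform_within_open[OF _ open_upper]) (use assms in \<open>auto simp: E2_def eta1_nome\<close>)
  then have "deriv E2 \<tau> = 3 / of_real pi ^ 2 * Dq \<eta>q (nome \<tau>)" by (rule DERIV_imp_deriv)
  then show ?thesis
    using assms by (simp add: critical_point_E2_def upper_half_plane_def f_hom_eq Dq_\<eta>q)
qed

definition f_hom_deriv :: "real \<Rightarrow> real \<Rightarrow> complex \<Rightarrow> complex" where
  "f_hom_deriv x y \<tau> = (let v = of_real x - of_real y * \<tau> in
     24 * (v * \<eta>q (nome \<tau>) + 2 * of_real pi * \<i> * of_real y) * (v * Dq \<eta>q (nome \<tau>) - of_real y * \<eta>q (nome \<tau>))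
      - Dq gq (nome \<tau>) * v\<^sup>2 + 2 * of_real y * gq (nome \<tau>) * v)"

lemma has_field_derivative_f_hom:
  assumes "Im \<tau> > 0"
  shows "(f_hom x y has_field_derivative f_hom_deriv x y \<tau>) (at \<tau>)"
proof -
  have "((\<lambda>\<tau>. 12 * ((of_real x - of_real y * \<tau>) * \<eta>q (nome \<tau>) + 2 * of_real pi * \<i> * of_real y)\<^sup>2
    - gq (nome \<tau>) * (of_real x - of_real y * \<tau>)\<^sup>2) has_field_derivative f_hom_deriv x y \<tau>) (at \<tau>)"
    using has_field_derivative_nome[OF gq_holomorphic assms] has_field_derivative_nome[OF \<eta>q_holomorphic assms]
    unfolding f_hom_deriv_def Let_def
    by (auto intro!: derivative_eq_intros simp: algebra_simps power2_eq_square)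
  then show ?thesis
    by (rule has_field_derivative_transform_within_open[OF _ open_upper]) (use assms f_hom_eq in auto)
qed

lemma f_hom_linear_nonzero:
  assumes "Im \<tau> > 0" "(x, y) \<noteq> (0, 0)"
  shows "of_real x - of_real y * \<tau> \<noteq> 0"
proof
  assume "of_real x - of_real y * \<tau> = 0"
  then have "Im (of_real x - of_real y * \<tau>) = 0" "Re (of_real x - of_real y * \<tau>) = 0" by simp_all
  then show False using assms by auto
qed

text \<open>Let \<open>v = x - y * \<tau>\<close> and
  \<open>A = v * eta1 + 2 * pi * \<i> * y\<close>, so that a zero means
  \<open>12 * A\<^sup>2 = g * v\<^sup>2\<close>. There Ramanujan's equation reduces \<open>v\<close>
  times the derivative to \<open>v\<^sup>2 * (4 * y * g - v * g')\<close>. If this vanishes too,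
  then \<open>v * G = - 2 * \<i> / pi * g * A\<close>; squaring and eliminating \<open>A\<close>
  makes \<open>g ^ 3 + 3 * pi ^ 2 * G\<^sup>2\<close>, the discriminant, equal to 0.\<close>

lemma f_hom_zero_simple:
  assumes "Im \<tau> > 0" "(x, y) \<noteq> (0, 0)" "f_hom x y \<tau> = 0"
  shows "f_hom_deriv x y \<tau> \<noteq> 0"
proof
  assume d: "f_hom_deriv x y \<tau> = 0"
  define v A Y e g G where "v = of_real x - of_real y * \<tau>" "A = v * \<eta>q (nome \<tau>) + 2 * of_real pi * \<i> * of_real y"
    "Y = complex_of_real y" "e = \<eta>q (nome \<tau>)" "g = gq (nome \<tau>)" "G = Gq (nome \<tau>)"
  note defs = this
  have v: "v \<noteq> 0" using f_hom_linear_nonzero[OF assms(1,2)] by (simp add: defs)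
  have A: "v * e = A - 2 * of_real pi * \<i> * Y" by (simp add: defs)
  have f0: "12 * A\<^sup>2 = g * v\<^sup>2" using assms(3) by (simp add: f_hom_eq[OF assms(1)] defs)
  have "v * (v * Dq \<eta>q (nome \<tau>)) = \<i> / (24 * of_real pi) * (12 * (v * e)\<^sup>2 - g * v\<^sup>2)"
    unfolding Dq_\<eta>q[OF assms(1)] defs(4,5)[symmetric] by (simp add: power2_eq_square field_simps)
  also have "\<dots> = 2 * Y * A - 2 * of_real pi * \<i> * Y\<^sup>2"
    unfolding A f0[symmetric] by (simp add: field_simps power2_eq_square)
  finally have vD: "v * (v * Dq \<eta>q (nome \<tau>)) = 2 * Y * A - 2 * of_real pi * \<i> * Y\<^sup>2" .
  have "v * (v * Dq \<eta>q (nome \<tau>) - Y * e) = v * (v * Dq \<eta>q (nome \<tau>)) - Y * (v * e)" by (simp add: algebra_simps)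
  also have "\<dots> = Y * A" unfolding vD A by (simp add: algebra_simps power2_eq_square)
  finally have vA: "v * (v * Dq \<eta>q (nome \<tau>) - Y * e) = Y * A" .
  have Dg: "Dq gq (nome \<tau>) = G + 2 * \<i> / of_real pi * e * g" by (simp add: defs Gq_def)
  have fd: "f_hom_deriv x y \<tau> = 24 * A * (v * Dq \<eta>q (nome \<tau>) - Y * e) - Dq gq (nome \<tau>) * v\<^sup>2 + 2 * Y * g * v"
    by (simp add: f_hom_deriv_def Let_def defs)
  have "0 = v * f_hom_deriv x y \<tau>" using d by simp
  also have "\<dots> = 24 * A * (v * (v * Dq \<eta>q (nome \<tau>) - Y * e)) - Dq gq (nome \<tau>) * v ^ 3 + 2 * Y * (g * v\<^sup>2)"
    unfolding fd by (simp add: algebra_simps eval_nat_numeral)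
  also have "\<dots> = 4 * Y * (12 * A\<^sup>2) - Dq gq (nome \<tau>) * v ^ 3"
    unfolding vA f0[symmetric] by (simp add: algebra_simps power2_eq_square)
  also have "\<dots> = v\<^sup>2 * (4 * Y * g - v * Dq gq (nome \<tau>))"
    unfolding f0 by (simp add: algebra_simps eval_nat_numeral)
  finally have "v\<^sup>2 * (4 * Y * g - v * Dq gq (nome \<tau>)) = 0" by (rule sym)
  then have "4 * Y * g - v * Dq gq (nome \<tau>) = 0" using v by (simp only: mult_eq_0_iff power_eq_0_iff) simp
  then have "v * Dq gq (nome \<tau>) = 4 * Y * g" by (simp only: right_minus_eq)
  then have "v * G + 2 * \<i> / of_real pi * g * (v * e) = 4 * Y * g" unfolding Dg by (simp only: distrib_left mult_ac)
  then have "v * G + 2 * \<i> / of_real pi * g * A = 0" unfolding A by (simp add: field_simps)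
  then have vG: "v * G = - (2 * \<i> / of_real pi * g * A)" by (simp only: eq_neg_iff_add_eq_0)
  have "v\<^sup>2 * (g ^ 3 + 3 * of_real pi ^ 2 * G\<^sup>2) = g\<^sup>2 * (g * v\<^sup>2) + 3 * of_real pi ^ 2 * (v * G)\<^sup>2"
    by (simp add: algebra_simps eval_nat_numeral)
  also have "\<dots> = 0" unfolding vG f0[symmetric] by (simp add: field_simps power2_eq_square)
  finally have "Disc (nome \<tau>) = 0" using v by (simp add: Disc_def defs)
  then show False using Disc_nonzero[OF assms(1)] by simp
qed

section \<open>Nonvanishing at the cusps\<close>

text \<open>For \<open>norm q \<le> 1/8\<close> the first term of the differentiated series
  dominates. In the others the argument has modulus at most 1/64, where 11/10 bounds the derivative
  of \<open>\<phi>2\<close>, and the weights add up to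
  \<open>1 / (1 - r)\<^sup>2 - 1 \<le> 15/49\<close>. The resulting 7/20 is below the lower bound
  6/10 for the first term.\<close>

lemma lambert_\<phi>2_deriv_tail:
  assumes "norm q \<le> 1/8"
  shows "norm (deriv (lambert \<phi>2) q - (1 + q) / (1 - q) ^ 3) \<le> 7/20"
proof -
  define r where "r = norm q"
  have r: "0 \<le> r" "r \<le> 1/8" using assms by (auto simp: r_def)
  have q: "q \<in> ball 0 1" using assms by simp
  have "(\<lambda>n. of_nat (Suc n) * q ^ n * deriv \<phi>2 (q ^ Suc n)) sums deriv (lambert \<phi>2) q"
    by (rule lambert_series(2)[OF \<phi>_basic(1,3) q])
  moreover have "deriv \<phi>2 (q ^ Suc 0) = (1 + q) / (1 - q) ^ 3"
  proof -
    have "q \<noteq> 1" using q by auto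
    then show ?thesis using deriv_\<phi>2 by simp
  qed
  ultimately have S: "(\<lambda>n. of_nat (Suc (Suc n)) * q ^ Suc n * deriv \<phi>2 (q ^ Suc (Suc n))) sums (deriv (lambert \<phi>2) q - (1 + q) / (1 - q) ^ 3)"
    by (subst sums_Suc_iff) simp
  have "(\<lambda>n. of_nat (Suc n) * r ^ n) sums (1 / (1 - r) ^ 2)" by (rule geometric_deriv_sums) (use r in simp)
  then have "(\<lambda>n. of_nat (Suc (Suc n)) * r ^ Suc n) sums (1 / (1 - r) ^ 2 - 1)" by (subst sums_Suc_iff) simp
  then have T: "(\<lambda>n. of_nat (Suc (Suc n)) * r ^ Suc n * (11/10)) sums ((1 / (1 - r) ^ 2 - 1) * (11/10))"
    by (rule sums_mult2)
  have b: "norm (deriv \<phi>2 w) \<le> 11/10" if "norm w \<le> 1/64" for w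
  proof -
    have w1: "w \<noteq> 1" using that by auto
    have "norm (1 + w) \<le> 65/64" using norm_triangle_ineq[of 1 w] that by simp
    moreover have n: "norm (1 - w) \<ge> 63/64" using norm_triangle_ineq2[of 1 w] that by simp
    then have "norm (1 - w) ^ 3 \<ge> (63/64) ^ 3" by (intro power_mono) auto
    ultimately have "norm (1 + w) / norm (1 - w) ^ 3 \<le> (65/64) / (63/64) ^ 3" by (intro frac_le) auto
    then show ?thesis unfolding deriv_\<phi>2[OF w1] norm_divide norm_power by (simp add: power3_eq_cube)
  qed
  have tm: "norm (of_nat (Suc (Suc n)) * q ^ Suc n * deriv \<phi>2 (q ^ Suc (Suc n))) \<le> of_nat (Suc (Suc n)) * r ^ Suc n * (11/10)" for n
  proof -
    have "norm (q ^ Suc (Suc n)) = r ^ Suc (Suc n)" by (simp only: norm_power r_def)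
    also have "\<dots> \<le> r ^ 2" using r by (intro power_decreasing) auto
    also have "\<dots> \<le> (1/8) ^ 2" using r by (intro power_mono) auto
    finally have "norm (deriv \<phi>2 (q ^ Suc (Suc n))) \<le> 11/10" by (intro b) (simp add: power2_eq_square)
    moreover have "norm (of_nat (Suc (Suc n)) * q ^ Suc n) = of_nat (Suc (Suc n)) * r ^ Suc n"
      by (simp only: norm_mult norm_power r_def norm_of_nat)
    ultimately show ?thesis unfolding norm_mult[of _ "deriv _ _"] using r by (intro mult_mono) auto
  qed
  have "norm (deriv (lambert \<phi>2) q - (1 + q) / (1 - q) ^ 3) \<le> (1 / (1 - r) ^ 2 - 1) * (11/10)"
  proof -
    have "norm (\<Sum>n. of_nat (Suc (Suc n)) * q ^ Suc n * deriv \<phi>2 (q ^ Suc (Suc n))) \<le> (\<Sum>n. of_nat (Suc (Suc n)) * r ^ Suc n * (11/10))"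
      by (rule norm_suminf_le[OF tm sums_summable[OF T]])
    then show ?thesis using sums_unique[OF S] sums_unique[OF T] by simp
  qed
  also have "\<dots> \<le> 7/20"
  proof -
    have "(1 - r) ^ 2 \<ge> (7/8) ^ 2" using r by (intro power_mono) auto
    then have "1 / (1 - r) ^ 2 \<le> 1 / (7/8) ^ 2" by (intro divide_left_mono mult_pos_pos) auto
    then show ?thesis by (simp add: power2_eq_square)
  qed
  finally show ?thesis .
qed

lemma lambert_\<phi>2_deriv_bounds:
  assumes "norm q \<le> 1/8"
  shows "deriv (lambert \<phi>2) q \<noteq> 0" "norm (deriv (lambert \<phi>2) q) \<le> 21/10"
proof -
  let ?D = "(1 + q) / (1 - q) ^ 3"
  have n: "norm (1 + q) \<ge> 7/8" "norm (1 + q) \<le> 9/8" "norm (1 - q) \<ge> 7/8" "norm (1 - q) \<le> 9/8"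
    using assms norm_triangle_ineq[of 1 q] norm_triangle_ineq2[of 1 q] norm_triangle_ineq4[of 1 q] norm_diff_ineq[of 1 q] by auto
  then have p: "norm (1 - q) ^ 3 \<ge> (7/8) ^ 3" "norm (1 - q) ^ 3 \<le> (9/8) ^ 3" by (auto intro!: power_mono)
  have p0: "norm (1 - q) ^ 3 > 0" using p(1) by (rule less_le_trans[rotated]) simp
  have "norm ?D \<ge> (7/8) / (9/8) ^ 3" unfolding norm_divide norm_power using n p p0 by (intro frac_le) auto
  then have l: "norm ?D \<ge> 6/10" by (simp add: power3_eq_cube)
  have "norm ?D \<le> (9/8) / (7/8) ^ 3" unfolding norm_divide norm_power using n p by (intro frac_le) auto
  then have u: "norm ?D \<le> 17/10" by (simp add: power3_eq_cube)
  have t: "norm (deriv (lambert \<phi>2) q - ?D) \<le> 7/20" by (rule lambert_\<phi>2_deriv_tail[OF assms])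
  show "deriv (lambert \<phi>2) q \<noteq> 0" using t l by auto
  show "norm (deriv (lambert \<phi>2) q) \<le> 21/10" using t u norm_triangle_sub[of "deriv (lambert \<phi>2) q" ?D] by linarith
qed

lemma lambert_\<phi>2_bound:
  assumes "norm q \<le> 1/8"
  shows "norm (lambert \<phi>2 q) \<le> 3 * norm q"
proof -
  define r where "r = norm q"
  have r: "0 \<le> r" "r \<le> 1/8" using assms by (auto simp: r_def)
  have q: "q \<in> ball 0 1" using assms by simp
  have S: "(\<lambda>n. \<phi>2 (q ^ Suc n)) sums lambert \<phi>2 q" by (rule lambert_series(1)[OF \<phi>_basic(1,3) q])
  have "(\<lambda>n. r ^ n) sums (1 / (1 - r))" using r by (intro geometric_sums) auto
  from sums_mult[OF this, of "2 * r"] have T: "(\<lambda>n. 2 * r ^ Suc n) sums (2 * r * (1 / (1 - r)))" by (simp add: mult_ac)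
  have tm: "norm (\<phi>2 (q ^ Suc n)) \<le> 2 * r ^ Suc n" for n
  proof -
    have nr: "norm (q ^ Suc n) = r ^ Suc n" by (simp only: norm_power r_def)
    have "r ^ Suc n \<le> r ^ 1" using r by (intro power_decreasing) auto
    then have "norm (1 - q ^ Suc n) \<ge> 7/8" using norm_triangle_ineq2[of 1 "q ^ Suc n"] r unfolding nr by simp
    then have "norm (1 - q ^ Suc n) ^ 2 \<ge> (7/8) ^ 2" by (intro power_mono) auto
    then have "norm (1 - q ^ Suc n) ^ 2 \<ge> 1/2" by (rule order_trans[rotated]) (simp add: power2_eq_square)
    then have "r ^ Suc n / norm (1 - q ^ Suc n) ^ 2 \<le> r ^ Suc n / (1/2)" using r by (intro divide_left_mono) auto
    then show ?thesis unfolding \<phi>2_def norm_divide norm_power[of "1 - q ^ Suc n"] nr by simp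
  qed
  have "norm (\<Sum>n. \<phi>2 (q ^ Suc n)) \<le> (\<Sum>n. 2 * r ^ Suc n)" by (rule norm_suminf_le[OF tm sums_summable[OF T]])
  then have "norm (lambert \<phi>2 q) \<le> 2 * r * (1 / (1 - r))" using sums_unique[OF S] sums_unique[OF T] by simp
  also have "\<dots> \<le> 3 * r"
  proof -
    have "1 / (1 - r) \<le> 1 / (7/8)" using r by (intro divide_left_mono) auto
    then have "2 * r * (1 / (1 - r)) \<le> 2 * r * (3/2)" using r by (intro mult_left_mono) auto
    then show ?thesis by simp
  qed
  finally show ?thesis by (simp add: r_def)
qed

lemma Dq_\<eta>q_lambert:
  assumes "q \<in> ball 0 1"
  shows "Dq \<eta>q q = - 16 * of_real pi ^ 3 * \<i> * q * deriv (lambert \<phi>2) q"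
proof -
  have "(\<eta>q has_field_derivative (0 - 8 * of_real pi ^ 2 * deriv (lambert \<phi>2) q)) (at q)"
    unfolding \<eta>q_def[abs_def] by (intro DERIV_diff DERIV_const DERIV_cmult lambert_series(3) \<phi>_basic assms)
  then show ?thesis unfolding Dq_def by (simp add: DERIV_imp_deriv power2_eq_square power3_eq_cube)
qed

text \<open>The constant terms cancel on the left; Ramanujan's equation exhibits the remaining
  factor \<open>nome \<tau>\<close> and reduces nonvanishing to that of the derivative of a Lambert
  series.\<close>

lemma eta1_squared_minus_g2:
  assumes "Im \<tau> > 0"
  shows "12 * \<eta>q (nome \<tau>) ^ 2 - gq (nome \<tau>) = - 384 * of_real pi ^ 4 * nome \<tau> * deriv (lambert \<phi>2) (nome \<tau>)"
proof -
  have "\<i> / (24 * of_real pi) * (12 * \<eta>q (nome \<tau>) ^ 2 - gq (nome \<tau>)) = - 16 * of_real pi ^ 3 * \<i> * nome \<tau> * deriv (lambert \<phi>2) (nome \<tau>)"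
    unfolding Dq_\<eta>q[OF assms, symmetric] by (rule Dq_\<eta>q_lambert[OF nome_in_ball[OF assms]])
  from arg_cong[OF this, of "\<lambda>x. (24 * of_real pi / \<i>) * x"] show ?thesis
    by (simp add: eval_nat_numeral)
qed

lemma f_hom_1_0_high:
  assumes "Im \<tau> \<ge> 2/5"
  shows "f_hom 1 0 \<tau> \<noteq> 0"
proof -
  have t: "Im \<tau> > 0" using assms by simp
  \<comment> \<open>Since \<open>12/5 = 2 * 3 * (2/5)\<close> and \<open>pi > 3\<close>, this puts
    the nome of every point of height at least 2/5 in the disc of radius 1/8.\<close>
  have "8 \<le> exp (12/5 :: real)"
  proof -
    have "2 \<le> exp (4/5 :: real)" using exp_lower_Taylor_quadratic[of "4/5"] by (simp add: power2_eq_square)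
    then have "2 ^ 3 \<le> exp (4/5 :: real) ^ 3" by (intro power_mono) auto
    then show ?thesis by (simp add: exp_of_nat_mult[symmetric])
  qed
  also have "exp (12/5) \<le> exp (2 * pi * Im \<tau>)"
    using mult_mono[of 3 pi "2/5" "Im \<tau>"] pi_gt3 assms by simp
  finally have "exp (2 * pi * Im \<tau>) \<ge> 8" .
  then have "norm (nome \<tau>) \<le> 1/8" unfolding norm_nome by (simp add: exp_minus field_simps)
  then show ?thesis using lambert_\<phi>2_deriv_bounds(1) eta1_squared_minus_g2[OF t] by (simp add: f_hom_eq[OF t])
qed

lemma exp_decay_high:
  fixes y :: real
  assumes "y \<ge> 2"
  shows "exp (- 2 * pi * y) * (y + 1) \<le> 1/1500"
proof -
  have "(17/2) ^ 4 \<le> exp (3 :: real) ^ 4" using exp_lower_Taylor_quadratic[of 3] by (intro power_mono) (auto simp: power2_eq_square)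
  also have "exp (3 :: real) ^ 4 = exp 12" by (simp add: exp_of_nat_mult[symmetric])
  finally have e12: "5000 \<le> exp (12 :: real)" by (rule order_trans[rotated]) (simp add: eval_nat_numeral)
  have "1500 * (y + 1) \<le> 5000 * (1 + 6 * (y - 2))" using assms by (simp add: algebra_simps)
  also have "\<dots> \<le> exp 12 * exp (6 * (y - 2))" using e12 assms exp_ge_add_one_self[of "6 * (y - 2)"] by (intro mult_mono) auto
  also have "\<dots> = exp (6 * y)" by (simp add: exp_add[symmetric] algebra_simps)
  also have "\<dots> \<le> exp (2 * pi * y)" using pi_gt3 assms by simp
  finally have "1500 * (y + 1) \<le> exp (2 * pi * y)" .
  then show ?thesis by (simp add: exp_minus field_simps)
qed

text \<open>Up to the factor \<open>- 48 * pi * \<sigma>\<close> the form is \<open>8 * pi ^ 3 * q *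
  \<sigma> * L + \<i> * (eta1 - \<i> * pi / \<sigma>)\<close>. At height 2 the first part has
  modulus below 1. The second does not: \<open>eta1\<close> is close to \<open>pi ^ 2 / 3\<close>,
  about 3.29, while \<open>pi / \<sigma>\<close> has modulus at most \<open>pi / 2\<close>.\<close>

lemma f_hom_0_1_high:
  assumes "Im \<sigma> \<ge> 2" "\<bar>Re \<sigma>\<bar> \<le> 1"
  shows "f_hom 0 1 \<sigma> \<noteq> 0"
proof
  assume "f_hom 0 1 \<sigma> = 0"
  have t: "Im \<sigma> > 0" using assms by simp
  define q L P where "q = nome \<sigma>" "L = deriv (lambert \<phi>2) q" "P = complex_of_real pi"
  note defs = this
  have s: "cmod \<sigma> \<ge> 2" using assms abs_Im_le_cmod[of \<sigma>] by linarith
  have s0: "\<sigma> \<noteq> 0" using s by auto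
  have s1: "cmod \<sigma> \<le> Im \<sigma> + 1" using cmod_le[of \<sigma>] assms by linarith
  have qs: "norm q * cmod \<sigma> \<le> 1/1500"
  proof -
    have "norm q * cmod \<sigma> \<le> exp (- 2 * pi * Im \<sigma>) * (Im \<sigma> + 1)"
      unfolding q_L_P_def norm_nome using s1 by (intro mult_left_mono) auto
    then show ?thesis using exp_decay_high[OF assms(1)] by linarith
  qed
  have "norm q * 2 \<le> norm q * cmod \<sigma>" using s by (intro mult_left_mono) auto
  then have q: "norm q \<le> 1/3000" using qs by linarith
  have "0 = f_hom 0 1 \<sigma>" using \<open>f_hom 0 1 \<sigma> = 0\<close> by simp
  also have "\<dots> = (12 * \<eta>q q ^ 2 - gq q) * \<sigma> ^ 2 - 48 * P * \<i> * \<sigma> * (\<eta>q q - \<i> * P / \<sigma>)"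
    unfolding f_hom_eq[OF t] defs using s0 by (simp add: power2_eq_square algebra_simps)
  also have "\<dots> = - 48 * P * \<sigma> * (8 * P ^ 3 * (q * \<sigma>) * L + \<i> * (\<eta>q q - \<i> * P / \<sigma>))"
    unfolding defs eta1_squared_minus_g2[OF t] by (simp add: eval_nat_numeral algebra_simps)
  finally have z: "8 * P ^ 3 * (q * \<sigma>) * L = - (\<i> * (\<eta>q q - \<i> * P / \<sigma>))"
    using s0 by (simp add: defs eq_neg_iff_add_eq_0)
  have pi: "pi \<le> 315/100" "pi \<ge> 314/100" using pi_approx by simp_all
  have p3: "pi ^ 3 \<le> (315/100) ^ 3" "pi ^ 2 \<ge> (314/100) ^ 2" "pi ^ 2 \<le> (315/100) ^ 2" using pi by (auto intro!: power_mono)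
  have "norm (8 * P ^ 3 * (q * \<sigma>) * L) = 8 * pi ^ 3 * (norm q * cmod \<sigma>) * norm L"
    by (simp add: norm_mult norm_power defs)
  also have "\<dots> \<le> 8 * (315/100) ^ 3 * (1/1500) * (21/10)"
    using p3(1) qs lambert_\<phi>2_deriv_bounds(2)[of q] q unfolding defs(2) by (intro mult_mono) auto
  also have "\<dots> < 1" by (simp add: power3_eq_cube)
  finally have u: "norm (\<i> * (\<eta>q q - \<i> * P / \<sigma>)) < 1" unfolding z norm_minus_cancel .
  have "of_real pi ^ 2 / 3 = \<eta>q q + 8 * of_real pi ^ 2 * lambert \<phi>2 q" by (simp add: \<eta>q_def)
  also have "\<dots> = (\<eta>q q - \<i> * P / \<sigma>) + \<i> * P / \<sigma> + 8 * of_real pi ^ 2 * lambert \<phi>2 q" by simp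
  also have "norm \<dots> \<le> norm (\<eta>q q - \<i> * P / \<sigma>) + norm (\<i> * P / \<sigma>) + norm (8 * of_real pi ^ 2 * lambert \<phi>2 q)"
    by (meson norm_triangle_ineq norm_triangle_mono order_refl)
  also have "norm (\<i> * P / \<sigma>) = pi / cmod \<sigma>" by (simp add: norm_divide norm_mult defs)
  also have "pi / cmod \<sigma> \<le> pi / 2" using s by (intro divide_left_mono) auto
  also have "norm (8 * of_real pi ^ 2 * lambert \<phi>2 q) = 8 * pi ^ 2 * norm (lambert \<phi>2 q)" by (simp add: norm_mult norm_power)
  also have "\<dots> \<le> 8 * (315/100) ^ 2 * (3 * (1/3000))"
    using lambert_\<phi>2_bound[of q] q p3(3) by (intro mult_mono) auto
  also have "norm (\<eta>q q - \<i> * P / \<sigma>) \<le> 1" using u by (simp add: norm_mult)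
  finally have "norm (of_real pi ^ 2 / 3 :: complex) \<le> 1 + pi / 2 + 8 * (315/100) ^ 2 * (3 * (1/3000))" by simp
  moreover have "norm (of_real pi ^ 2 / 3 :: complex) = pi ^ 2 / 3" by (simp add: norm_divide norm_power)
  ultimately show False using p3(2) pi by (simp add: power2_eq_square)
qed

section \<open>The domain \<open>F0\<close> and its reflection\<close>

lemma F0_D:
  assumes "\<tau> \<in> F0"
  shows "Im \<tau> > 0" "0 \<le> Re \<tau>" "Re \<tau> \<le> 1" "Re \<tau> \<le> (cmod \<tau>)\<^sup>2" "1 - Re \<tau> \<le> (cmod (1 - \<tau>))\<^sup>2"
proof -
  have "(1/2)\<^sup>2 \<le> (cmod (\<tau> - 1/2))\<^sup>2" using assms by (intro power_mono) (auto simp: F0_def)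
  then have "1/4 \<le> (Re \<tau> - 1/2)\<^sup>2 + (Im \<tau>)\<^sup>2" unfolding cmod_power2 by (simp add: power2_eq_square)
  then show "Re \<tau> \<le> (cmod \<tau>)\<^sup>2" "1 - Re \<tau> \<le> (cmod (1 - \<tau>))\<^sup>2"
    unfolding cmod_power2 by (auto simp: power2_eq_square algebra_simps)
qed (use assms in \<open>auto simp: F0_def upper_half_plane_def\<close>)

lemma F0_iff:
  "\<tau> \<in> F0 \<longleftrightarrow> Im \<tau> > 0 \<and> 0 \<le> Re \<tau> \<and> Re \<tau> \<le> 1 \<and> Re \<tau> \<le> (cmod \<tau>)\<^sup>2"
proof
  assume a: "Im \<tau> > 0 \<and> 0 \<le> Re \<tau> \<and> Re \<tau> \<le> 1 \<and> Re \<tau> \<le> (cmod \<tau>)\<^sup>2"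
  then have "(1/2)\<^sup>2 \<le> (cmod (\<tau> - 1/2))\<^sup>2" unfolding cmod_power2 by (simp add: power2_eq_square algebra_simps)
  then have "1/2 \<le> cmod (\<tau> - 1/2)" by (rule power2_le_imp_le) simp
  then show "\<tau> \<in> F0" using a by (auto simp: F0_def upper_half_plane_def)
qed (use F0_D in blast)

lemma f_hom_1_0_inversion:
  assumes "Im \<tau> > 0"
  shows "f_hom 1 0 \<tau> = 0 \<longleftrightarrow> f_hom 0 1 (- 1 / \<tau>) = 0"
proof -
  have "f_hom 0 1 (- 1 / \<tau>) = \<tau> ^ 2 * f_hom 1 0 \<tau>"
    using f_hom_moebius[OF assms, of 0 0 "-1" 1 0 1] by simp
  then show ?thesis using assms by auto
qed

lemma lambert_cnj:
  assumes "\<And>z. \<phi> (cnj z) = cnj (\<phi> z)" "\<phi> holomorphic_on ball 0 1" "\<phi> 0 = 0" "q \<in> ball 0 1"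
  shows "lambert \<phi> (cnj q) = cnj (lambert \<phi> q)"
proof -
  have "(\<lambda>n. cnj (\<phi> (q ^ Suc n))) sums cnj (lambert \<phi> q)"
    unfolding sums_cnj by (rule lambert_series(1)[OF assms(2,3,4)])
  then show ?thesis by (simp add: lambert_def assms(1)[symmetric] sums_iff)
qed

lemma \<eta>q_gq_cnj:
  assumes "q \<in> ball 0 1"
  shows "\<eta>q (cnj q) = cnj (\<eta>q q)" "gq (cnj q) = cnj (gq q)"
proof -
  have "\<phi>2 (cnj z) = cnj (\<phi>2 z)" "\<phi>4 (cnj z) = cnj (\<phi>4 z)" for z
    by (simp_all add: \<phi>2_def \<phi>4_def)
  from lambert_cnj[OF this(1) \<phi>_basic(1,3) assms] lambert_cnj[OF this(2) \<phi>_basic(2,4) assms]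
  show "\<eta>q (cnj q) = cnj (\<eta>q q)" "gq (cnj q) = cnj (gq q)"
    by (simp_all add: \<eta>q_def gq_def)
qed

lemma nome_reflect: "nome (1 - cnj \<tau>) = cnj (nome \<tau>)"
proof -
  have "2 * of_real pi * \<i> * (1 - cnj \<tau>) = cnj (2 * of_real pi * \<i> * \<tau>) + 2 * of_real pi * \<i>" by (simp add: algebra_simps)
  then have "nome (1 - cnj \<tau>) = exp (cnj (2 * of_real pi * \<i> * \<tau>)) * exp (2 * of_real pi * \<i>)"
    by (simp only: nome_def exp_add)
  then show ?thesis by (simp only: exp_two_pi_i exp_cnj nome_def mult_1_right)
qed

lemma f_hom_1_0_reflect:
  assumes "Im \<tau> > 0"
  shows "f_hom 1 0 (1 - cnj \<tau>) = cnj (f_hom 1 0 \<tau>)"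
proof -
  have "Im (1 - cnj \<tau>) > 0" using assms by simp
  then show ?thesis using \<eta>q_gq_cnj[OF nome_in_ball[OF assms]] by (simp add: f_hom_eq assms nome_reflect)
qed

text \<open>By the symmetry \<open>\<tau> \<mapsto> 1 - cnj \<tau>\<close> only the cusps \<open>\<infinity>\<close> and \<open>0\<close> of \<open>F0\<close> have to be examined.\<close>
lemma f_hom_1_0_nonzero_F0:
  assumes "\<tau> \<in> F0"
  shows "f_hom 1 0 \<tau> \<noteq> 0"
proof -
  have half: "f_hom 1 0 \<tau> \<noteq> 0" if F: "\<tau> \<in> F0" and x: "Re \<tau> \<le> 1/2" for \<tau>
  proof (cases "Im \<tau> \<ge> 2/5")
    case True then show ?thesis by (rule f_hom_1_0_high)
  next
    case False
    note F = F0_D[OF F]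
    have c: "(cmod \<tau>)\<^sup>2 = (Re \<tau>)\<^sup>2 + (Im \<tau>)\<^sup>2" by (rule cmod_power2)
    have c0: "(cmod \<tau>)\<^sup>2 > 0" using F(1) by auto
    have y: "(Im \<tau>)\<^sup>2 < 16/100" using False F(1) power_strict_mono[of "Im \<tau>" "2/5" 2] by (simp add: power2_eq_square)
    have xy: "Re \<tau> * (1 - Re \<tau>) \<le> (Im \<tau>)\<^sup>2" using F(4) unfolding c by (simp add: power2_eq_square algebra_simps)
    \<comment> \<open>The boundary circle has height 2/5 at real part 1/5, as
      \<open>1/5 * (4/5) = (2/5)\<^sup>2\<close>. So points of the left half below that height are
      close to the cusp 0, and \<open>- 1 / \<tau>\<close> has height at least 2.\<close>
    have x2: "Re \<tau> < 1/5"
    proof (rule ccontr)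
      assume "\<not> Re \<tau> < 1/5"
      then have "0 \<le> (Re \<tau> - 1/5) * (4/5 - Re \<tau>)" using x by (intro mult_nonneg_nonneg) auto
      moreover have "(Re \<tau> - 1/5) * (4/5 - Re \<tau>) = Re \<tau> * (1 - Re \<tau>) - 4/25" by (simp add: field_simps)
      ultimately show False using xy y by linarith
    qed
    have "Re \<tau> * (4/5) \<le> Re \<tau> * (1 - Re \<tau>)" using x2 F(2) by (intro mult_left_mono) auto
    then have x3: "Re \<tau> \<le> 5/4 * (Im \<tau>)\<^sup>2" using xy by simp
    have "(Re \<tau>)\<^sup>2 \<le> Re \<tau> * (1/5)" unfolding power2_eq_square using x2 F(2) by (intro mult_left_mono) auto
    then have "(cmod \<tau>)\<^sup>2 \<le> 5/4 * (Im \<tau>)\<^sup>2" using x3 unfolding c by simp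
    also have "\<dots> \<le> Im \<tau> * (1/2)" unfolding power2_eq_square using False F(1) by simp
    finally have "2 \<le> Im \<tau> / (cmod \<tau>)\<^sup>2" using c0 by (simp add: field_simps)
    moreover have "Im (- 1 / \<tau>) = Im \<tau> / (cmod \<tau>)\<^sup>2" "Re (- 1 / \<tau>) = - Re \<tau> / (cmod \<tau>)\<^sup>2"
      by (simp_all add: Im_divide Re_divide cmod_power2)
    moreover have "\<bar>- Re \<tau> / (cmod \<tau>)\<^sup>2\<bar> \<le> 1" using F(2,4) c0 by (simp add: field_simps)
    ultimately have "f_hom 0 1 (- 1 / \<tau>) \<noteq> 0" by (intro f_hom_0_1_high) simp_all
    then show ?thesis using f_hom_1_0_inversion[OF F(1)] by simp
  qed
  show ?thesis
  proof (cases "Re \<tau> \<le> 1/2")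
    case True then show ?thesis using half assms by blast
  next
    case False
    have "cmod (1 - cnj \<tau>) = cmod (cnj (1 - \<tau>))" by simp
    also have "\<dots> = cmod (1 - \<tau>)" by (rule complex_mod_cnj)
    finally have "1 - cnj \<tau> \<in> F0" using F0_D[OF assms] by (simp add: F0_iff)
    then have "f_hom 1 0 (1 - cnj \<tau>) \<noteq> 0" using half False by simp
    then show ?thesis unfolding f_hom_1_0_reflect[OF F0_D(1)[OF assms]] by simp
  qed
qed

section \<open>The rotation of order 3 that permutes the cusps\<close>

definition rot :: "complex \<Rightarrow> complex" where "rot \<tau> = 1 / (1 - \<tau>)"

lemma rot_Re_Im:
  "Re (rot \<tau>) = (1 - Re \<tau>) / (cmod (1 - \<tau>))\<^sup>2" "Im (rot \<tau>) = Im \<tau> / (cmod (1 - \<tau>))\<^sup>2"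
  unfolding rot_def cmod_power2 by (simp_all add: Re_divide Im_divide)

lemma rot_F0:
  assumes "\<tau> \<in> F0" shows "rot \<tau> \<in> F0"
proof -
  note F = F0_D[OF assms]
  have "1 - \<tau> \<noteq> 0" using F(1) by (auto simp: complex_eq_iff)
  then have c: "(cmod (1 - \<tau>))\<^sup>2 > 0" by simp
  have "(cmod (rot \<tau>))\<^sup>2 = 1 / (cmod (1 - \<tau>))\<^sup>2" by (simp add: rot_def norm_divide power_divide)
  then show ?thesis unfolding F0_iff rot_Re_Im using F c by (auto simp: field_simps)
qed

lemma rot_rot_rot: assumes "Im \<tau> > 0" shows "rot (rot (rot \<tau>)) = \<tau>" "rot (rot \<tau>) = (\<tau> - 1) / \<tau>"
proof -
  have nz: "\<tau> \<noteq> 0" "1 - \<tau> \<noteq> 0" using assms by (auto simp: complex_eq_iff)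
  have "1 - 1 / (1 - \<tau>) = - \<tau> / (1 - \<tau>)" using nz by (simp add: field_simps)
  then show r2: "rot (rot \<tau>) = (\<tau> - 1) / \<tau>" unfolding rot_def using nz by (simp add: field_simps)
  have "1 - (\<tau> - 1) / \<tau> = 1 / \<tau>" using nz by (simp add: field_simps)
  then show "rot (rot (rot \<tau>)) = \<tau>" unfolding r2 using nz by (simp add: rot_def)
qed

text \<open>The parameter \<open>C\<close> at \<open>rot \<tau>\<close> corresponds to
  \<open>(C - 1) / C\<close> at \<open>\<tau>\<close>; in particular \<open>\<infinity>\<close>
  corresponds to 1 and 1 to 0.\<close>

lemma f_hom_rot:
  assumes "Im \<tau> > 0"
  shows "f_hom x y (rot \<tau>) = 0 \<longleftrightarrow> f_hom (x - y) x \<tau> = 0"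
proof -
  have "f_hom x y (rot \<tau>) = (1 - \<tau>) ^ 2 * f_hom (x - y) x \<tau>"
    using f_hom_moebius[OF assms, of 0 1 1 "-1" x y] by (simp add: rot_def)
  moreover have "1 - \<tau> \<noteq> 0" using assms by (auto simp: complex_eq_iff)
  ultimately show ?thesis by simp
qed

lemma f_hom_cusp_nonzero_F0:
  assumes "\<tau> \<in> F0"
  shows "f_hom 1 1 \<tau> \<noteq> 0" "f_hom 0 1 \<tau> \<noteq> 0"
proof -
  have 1: "f_hom 1 1 \<tau> \<noteq> 0" if "\<tau> \<in> F0" for \<tau>
    using f_hom_rot[OF F0_D(1)[OF that], of 1 0] f_hom_1_0_nonzero_F0[OF rot_F0[OF that]] by simp
  show "f_hom 1 1 \<tau> \<noteq> 0" by (rule 1[OF assms])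
  show "f_hom 0 1 \<tau> \<noteq> 0"
    using f_hom_rot[OF F0_D(1)[OF assms], of 1 1] 1[OF rot_F0[OF assms]] by simp
qed

section \<open>Compactness and persistence of zeros\<close>

lemma f_hom_zero_iff:
  assumes "y \<noteq> 0" shows "f_hom x y \<tau> = 0 \<longleftrightarrow> f_hom (x / y) 1 \<tau> = 0"
  using f_hom_zero_scale[OF assms, of "x / y" 1 \<tau>] assms by simp

lemma gq_real_pos:
  assumes "0 < r" "r < 1"
  shows "Re (gq (of_real r)) > 0"
proof -
  have q: "(of_real r :: complex) \<in> ball 0 1" using assms by simp
  have re: "(\<lambda>n. Re (\<phi>4 (of_real r ^ Suc n))) sums Re (lambert \<phi>4 (of_real r))"
    by (intro sums_Re lambert_series(1) \<phi>_basic q)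
  have pos: "0 \<le> Re (\<phi>4 (of_real r ^ Suc n))" for n
  proof -
    define u where "u = r ^ Suc n"
    have u: "0 \<le> u" using assms by (simp add: u_def)
    have "\<phi>4 (of_real u) = of_real (u * (1 + 4 * u + u ^ 2) / (1 - u) ^ 4)" by (simp add: \<phi>4_def)
    moreover have "of_real r ^ Suc n = (of_real u :: complex)" by (simp add: u_def)
    ultimately have "Re (\<phi>4 (of_real r ^ Suc n)) = u * (1 + 4 * u + u ^ 2) / (1 - u) ^ 4"
      by (simp only: Re_complex_of_real)
    then show ?thesis using u by simp
  qed
  have "0 \<le> Re (lambert \<phi>4 (of_real r))" by (rule sums_le[OF pos sums_zero re])
  moreover have "Re (gq (of_real r)) = 4 * pi ^ 4 / 3 + 320 * pi ^ 4 * Re (lambert \<phi>4 (of_real r))"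
  proof -
    have "gq (of_real r) = of_real (4 * pi ^ 4 / 3) + of_real (320 * pi ^ 4) * lambert \<phi>4 (of_real r)" by (simp add: gq_def)
    then show ?thesis by (simp only: plus_complex.sel Re_complex_of_real times_complex.sel Im_complex_of_real mult_zero_left diff_zero)
  qed
  ultimately show ?thesis by (simp add: add_pos_nonneg)
qed

text \<open>On the axis \<open>eta1\<close> is real and \<open>g2 = 12 * k\<^sup>2\<close> with real
  \<open>k\<close>, so a zero gives \<open>v * eta1 + 2 * pi * \<i> * y = s * v\<close> with
  \<open>s\<close> real. For \<open>x \<noteq> 0\<close> the real part yields
  \<open>eta1 = s\<close>, and then the imaginary part yields \<open>y = 0\<close>. The cases
  \<open>x = 0\<close> and \<open>y = 0\<close> are the cusps 0 and
  \<open>\<infinity>\<close>.\<close>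

lemma f_hom_nonzero_imaginary_axis:
  assumes F: "\<tau> \<in> F0" and re: "Re \<tau> = 0" and xy: "(x, y) \<noteq> (0, 0)"
  shows "f_hom x y \<tau> \<noteq> 0"
proof (cases "x = 0 \<or> y = 0")
  case True
  then show ?thesis
    using xy f_hom_zero_scale[of x 1 0 \<tau>] f_hom_zero_scale[of y 0 1 \<tau>]
      f_hom_1_0_nonzero_F0[OF F] f_hom_cusp_nonzero_F0(2)[OF F] by auto
next
  case False
  define t where "t = Im \<tau>"
  have t: "t > 0" using F0_D(1)[OF F] by (simp add: t_def)
  have \<tau>: "\<tau> = \<i> * of_real t" using re by (simp add: complex_eq_iff t_def)
  have nome: "nome \<tau> = of_real (exp (- 2 * pi * t))"
  proof -
    have "2 * of_real pi * \<i> * \<tau> = complex_of_real (- 2 * pi * t)" by (simp add: \<tau>)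
    then show ?thesis unfolding nome_def by (simp only: exp_of_real)
  qed
  have b: "nome \<tau> \<in> ball 0 1" using F0_D(1)[OF F] by (rule nome_in_ball)
  have "cnj (\<eta>q (nome \<tau>)) = \<eta>q (nome \<tau>)" "cnj (gq (nome \<tau>)) = gq (nome \<tau>)"
    using \<eta>q_gq_cnj[OF b] by (simp_all add: nome)
  then have "\<eta>q (nome \<tau>) \<in> \<real>" "gq (nome \<tau>) \<in> \<real>" by (simp_all add: Reals_cnj_iff)
  then obtain e g where e: "\<eta>q (nome \<tau>) = of_real e" and g: "gq (nome \<tau>) = of_real g"
    by (elim Reals_cases)
  have "g > 0" using gq_real_pos[of "exp (- 2 * pi * t)"] t g by (simp add: nome)
  define k where "k = sqrt (g / 12)"
  have gk: "g = 12 * k\<^sup>2" unfolding k_def using \<open>g > 0\<close> by simp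
  have k: "complex_of_real g = 12 * of_real k ^ 2" by (subst gk) simp
  show ?thesis
  proof
    define v where "v = of_real x - of_real y * \<tau>"
    assume "f_hom x y \<tau> = 0"
    then have "(v * of_real e + 2 * of_real pi * \<i> * of_real y)\<^sup>2 = (of_real k * v)\<^sup>2"
      unfolding f_hom_eq[OF F0_D(1)[OF F]] e g k v_def by (simp add: power_mult_distrib mult_ac)
    then have "v * of_real e + 2 * of_real pi * \<i> * of_real y = of_real k * v \<or> v * of_real e + 2 * of_real pi * \<i> * of_real y = - (of_real k * v)"
      by (simp only: power2_eq_iff)
    then obtain s where s: "v * of_real e + 2 * of_real pi * \<i> * of_real y = of_real s * v"
    proof (elim disjE)
      assume "v * of_real e + 2 * of_real pi * \<i> * of_real y = - (of_real k * v)"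
      then show ?thesis using that[of "- k"] by simp
    qed (use that in blast)
    have "Re v = x" "Im v = - y * t" by (simp_all add: v_def \<tau>)
    with arg_cong[OF s, of Re] arg_cong[OF s, of Im] False
    have "e = s" "- y * t * e + 2 * pi * y = s * (- y * t)" by simp_all
    then have "2 * pi * y = 0" by (simp add: algebra_simps)
    then show False using False by simp
  qed
qed

definition F0_int :: "complex set" where
  "F0_int = {\<tau>. Im \<tau> > 0 \<and> 0 < Re \<tau> \<and> Re \<tau> < 1 \<and> Re \<tau> < (cmod \<tau>)\<^sup>2}"

lemma F0_int_subset: "F0_int \<subseteq> F0" by (auto simp: F0_int_def F0_iff)

lemma open_F0_int: "open F0_int"
  unfolding F0_int_def by (intro open_Collect_conj open_Collect_less continuous_intros)

text \<open>The rotation takes the line \<open>Re \<tau> = 1\<close> to the imaginary axis and the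
  boundary arc to the line \<open>Re \<tau> = 1\<close>, so all three sides reduce to the imaginary
  axis.\<close>

lemma f_hom_zero_interior:
  assumes F: "\<tau> \<in> F0" and xy: "(x, y) \<noteq> (0, 0)" and z: "f_hom x y \<tau> = 0"
  shows "\<tau> \<in> F0_int"
proof -
  have r0: "Re \<tau> \<noteq> 0" using f_hom_nonzero_imaginary_axis[OF F _ xy] z by blast
  have r1: "Re \<tau> \<noteq> 1" if F: "\<tau> \<in> F0" and xy: "(x, y) \<noteq> (0, 0)" and z: "f_hom x y \<tau> = 0" for \<tau> x y
  proof
    assume "Re \<tau> = 1"
    then have "Re (rot \<tau>) = 0" by (simp add: rot_Re_Im)
    moreover have "f_hom y (y - x) (rot \<tau>) = 0" using f_hom_rot[OF F0_D(1)[OF F], of y "y - x"] z by simp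
    ultimately show False using f_hom_nonzero_imaginary_axis[OF rot_F0[OF F], of y "y - x"] xy by auto
  qed
  have "Re \<tau> \<noteq> (cmod \<tau>)\<^sup>2"
  proof
    assume a: "Re \<tau> = (cmod \<tau>)\<^sup>2"
    have "(cmod (1 - \<tau>))\<^sup>2 = 1 - 2 * Re \<tau> + (cmod \<tau>)\<^sup>2"
      unfolding cmod_power2 by (simp add: power2_eq_square algebra_simps)
    then have "Re (rot \<tau>) = 1" using r1[OF F xy z] a by (simp add: rot_Re_Im)
    moreover have "f_hom y (y - x) (rot \<tau>) = 0" using f_hom_rot[OF F0_D(1)[OF F], of y "y - x"] z by simp
    ultimately show False using r1[OF rot_F0[OF F], of y "y - x"] xy by auto
  qed
  then show ?thesis using F0_D[OF F] r0 r1[OF F xy z] by (auto simp: F0_int_def)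
qed

lemma isCont_nome_comp:
  assumes "F holomorphic_on ball 0 1" "Im z > 0"
  shows "isCont (\<lambda>\<tau>. F (nome \<tau>)) z"
  using has_field_derivative_nome[OF assms] DERIV_isCont by blast

lemma tendsto_nome_comp:
  assumes "F holomorphic_on ball 0 1" "(t \<longlongrightarrow> z) A" "Im z > 0"
  shows "((\<lambda>x. F (nome (t x))) \<longlongrightarrow> F (nome z)) A"
  using isCont_tendsto_compose[OF isCont_nome_comp[OF assms(1,3)] assms(2)] .

lemma f_hom_tendsto:
  assumes "(a \<longlongrightarrow> x) A" "(b \<longlongrightarrow> y) A" "(t \<longlongrightarrow> z) A" "Im z > 0"
  shows "((\<lambda>n. f_hom (a n) (b n) (t n)) \<longlongrightarrow> f_hom x y z) A"
proof -
  have ev: "\<forall>\<^sub>F n in A. Im (t n) > 0"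
    using tendsto_Im[OF assms(3)] assms(4) by (rule order_tendstoD)
  have "((\<lambda>n. 12 * ((of_real (a n) - of_real (b n) * t n) * \<eta>q (nome (t n)) + 2 * of_real pi * \<i> * of_real (b n))\<^sup>2
    - gq (nome (t n)) * (of_real (a n) - of_real (b n) * t n)\<^sup>2) \<longlongrightarrow> f_hom x y z) A"
    unfolding f_hom_eq[OF assms(4)]
    by (intro tendsto_intros tendsto_nome_comp \<eta>q_holomorphic gq_holomorphic assms)
  then show ?thesis
    by (rule Lim_transform_eventually) (use ev in \<open>eventually_elim, simp add: f_hom_eq\<close>)
qed

lemma f_hom_deriv_tendsto:
  assumes "(a \<longlongrightarrow> x) A" "(b \<longlongrightarrow> y) A" "(t \<longlongrightarrow> z) A" "Im z > 0"
  shows "((\<lambda>n. f_hom_deriv (a n) (b n) (t n)) \<longlongrightarrow> f_hom_deriv x y z) A"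
  unfolding f_hom_deriv_def Let_def
  by (intro tendsto_intros tendsto_nome_comp Dq_holomorphic \<eta>q_holomorphic gq_holomorphic assms)

text \<open>Banach's fixed point theorem applied to the Newton map \<open>w \<mapsto> w - f_hom C' 1 w / L\<close>.\<close>
lemma f_hom_zero_persists:
  assumes z: "Im z > 0" "f_hom C 1 z = 0" and "\<epsilon> > 0"
  obtains \<rho> where "0 < \<rho>" "\<rho> \<le> \<epsilon>" "\<forall>\<^sub>F C' in nhds C. \<exists>!w. w \<in> cball z \<rho> \<and> f_hom C' 1 w = 0"
proof -
  define L where "L = f_hom_deriv C 1 z"
  have L: "L \<noteq> 0" unfolding L_def by (rule f_hom_zero_simple) (use z in auto)
  have c: "((\<lambda>p. f_hom_deriv (fst p) 1 (snd p)) \<longlongrightarrow> L) (nhds (C, z))"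
    unfolding L_def by (intro f_hom_deriv_tendsto tendsto_const z) (auto intro!: tendsto_eq_intros filterlim_ident)
  have "\<forall>\<^sub>F p in nhds (C, z). dist (f_hom_deriv (fst p) 1 (snd p)) L < norm L / 2"
    using c L by (intro tendstoD) auto
  moreover have "\<forall>\<^sub>F p in nhds (C, z). Im (snd p) > 0"
    using z(1) by (intro order_tendstoD(1)[of _ "Im z"]) (auto intro!: tendsto_eq_intros filterlim_ident)
  ultimately have "\<forall>\<^sub>F p in nhds (C, z). dist (f_hom_deriv (fst p) 1 (snd p)) L < norm L / 2 \<and> Im (snd p) > 0"
    by (rule eventually_conj)
  then obtain d where d: "d > 0" and dd: "\<And>p. dist p (C, z) < d \<Longrightarrow> dist (f_hom_deriv (fst p) 1 (snd p)) L < norm L / 2 \<and> Im (snd p) > 0"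
    unfolding eventually_nhds_metric by blast
  define \<rho> where "\<rho> = min \<epsilon> (d / 2)"
  have \<rho>: "0 < \<rho>" "\<rho> \<le> \<epsilon>" "\<rho> \<le> d / 2" using d \<open>\<epsilon> > 0\<close> by (auto simp: \<rho>_def)
  have near: "dist (C', w) (C, z) < d" if "dist C' C < d / 2" "w \<in> cball z \<rho>" for C' w
  proof -
    have "dist (C', w) (C, z) \<le> dist C' C + dist w z"
      unfolding dist_prod_def fst_conv snd_conv by (rule sqrt_sum_squares_le_sum) auto
    then show ?thesis using that \<rho>(3) by (simp add: dist_commute)
  qed
  have "((\<lambda>C'. f_hom C' 1 z) \<longlongrightarrow> f_hom C 1 z) (nhds C)"
    by (intro f_hom_tendsto tendsto_const filterlim_ident z)
  \<comment> \<open>The Newton map displaces the centre by at most \<open>\<rho> / 2\<close>; with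
    contraction factor 1/2 it therefore maps the closed ball into itself.\<close>
  then have "\<forall>\<^sub>F C' in nhds C. dist (f_hom C' 1 z) 0 < norm L * (\<rho> / 2)"
    unfolding z(2) using L \<rho>(1) by (intro tendstoD) auto
  moreover have "\<forall>\<^sub>F C' in nhds C. dist C' C < d / 2" using d by (auto simp: eventually_nhds_metric intro!: exI[of _ "d / 2"])
  ultimately have "\<forall>\<^sub>F C' in nhds C. \<exists>!w. w \<in> cball z \<rho> \<and> f_hom C' 1 w = 0"
  proof eventually_elim
    case (elim C')
    define T where "T w = w - f_hom C' 1 w / L" for w
    have lip: "norm (T w - T w') \<le> (1/2) * norm (w - w')" if "w \<in> cball z \<rho>" "w' \<in> cball z \<rho>" for w w'
    proof (rule field_differentiable_bound[of "cball z \<rho>" T "\<lambda>w. 1 - f_hom_deriv C' 1 w / L"])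
      fix w assume w: "w \<in> cball z \<rho>"
      note dw = dd[OF near[OF elim(2) w]]
      have "(f_hom C' 1 has_field_derivative f_hom_deriv C' 1 w) (at w)"
        by (rule has_field_derivative_f_hom) (use dw in simp)
      then have "(T has_field_derivative 1 - f_hom_deriv C' 1 w / L) (at w)"
        unfolding T_def[abs_def] by (intro DERIV_diff DERIV_ident DERIV_cdivide)
      then show "(T has_field_derivative 1 - f_hom_deriv C' 1 w / L) (at w within cball z \<rho>)"
        by (rule has_field_derivative_at_within)
      have "1 - f_hom_deriv C' 1 w / L = (L - f_hom_deriv C' 1 w) / L" using L by (simp add: diff_divide_distrib)
      then show "norm (1 - f_hom_deriv C' 1 w / L) \<le> 1/2"
        using dw L by (simp add: norm_divide dist_norm norm_minus_commute field_simps)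
    qed (use that in auto)
    have "\<exists>!w\<in>cball z \<rho>. T w = w"
    proof (rule Banach_fix)
      show "complete (cball z \<rho>)" by (simp add: complete_eq_closed)
      show "cball z \<rho> \<noteq> {}" using \<rho>(1) by simp
      show "T ` cball z \<rho> \<subseteq> cball z \<rho>"
      proof clarify
        fix w assume w: "w \<in> cball z \<rho>"
        have "norm (T w - z) \<le> norm (T w - T z) + norm (T z - z)" using norm_triangle_ineq[of "T w - T z" "T z - z"] by simp
        also have "norm (T w - T z) \<le> (1/2) * norm (w - z)" by (rule lip[OF w]) (use \<rho>(1) in simp)
        also have "\<dots> \<le> \<rho> / 2" using w by (simp add: dist_norm norm_minus_commute)
        also have "norm (T z - z) \<le> \<rho> / 2" using elim(1) L by (simp add: T_def norm_divide field_simps)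
        finally show "T w \<in> cball z \<rho>" by (simp add: dist_norm norm_minus_commute)
      qed
      show "dist (T w) (T w') \<le> (1/2) * dist w w'" if "w \<in> cball z \<rho>" "w' \<in> cball z \<rho>" for w w'
        unfolding dist_norm by (rule lip[OF that])
    qed auto
    moreover have "T w = w \<longleftrightarrow> f_hom C' 1 w = 0" for w using L by (simp add: T_def)
    ultimately show ?case by auto
  qed
  then show thesis using that \<rho>(1,2) by blast
qed

lemma Im_rot_rot: assumes "Im \<tau> > 0" shows "Im (rot (rot \<tau>)) = Im \<tau> / (cmod \<tau>)\<^sup>2"
proof -
  have "\<tau> \<noteq> 0" using assms by auto
  then have "(\<tau> - 1) / \<tau> = 1 - 1 / \<tau>" by (simp add: field_simps)
  then show ?thesis unfolding rot_rot_rot(2)[OF assms] by (simp add: Im_divide cmod_power2)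
qed

text \<open>In the left half of \<open>F0\<close> the circle condition gives
  \<open>(Re \<tau>)\<^sup>2 \<le> (Im \<tau>)\<^sup>2\<close>, hence
  \<open>Im (rot (rot \<tau>)) \<ge> 1 / (2 * Im \<tau>)\<close>; in the right half
  \<open>rot\<close> plays this part. A point close to the real axis is thus high at one of the two
  finite cusps.\<close>

lemma F0_Im_lower_bound:
  assumes F: "\<tau> \<in> F0" and Y: "Im (rot \<tau>) \<le> Y" "Im (rot (rot \<tau>)) \<le> Y"
  shows "1 \<le> 2 * Y * Im \<tau>"
proof -
  note D = F0_D[OF F]
  define x y where "x = Re \<tau>" "y = Im \<tau>"
  note xy = this
  have c: "(cmod \<tau>)\<^sup>2 = x\<^sup>2 + y\<^sup>2" "(cmod (1 - \<tau>))\<^sup>2 = (1 - x)\<^sup>2 + y\<^sup>2" by (simp_all add: cmod_power2 xy)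
  have y: "y > 0" "0 \<le> x" "x \<le> 1" using D xy by auto
  have q: "x * (1 - x) \<le> y\<^sup>2" using D(4) unfolding c by (simp add: xy power2_eq_square algebra_simps)
  have fin: "1 \<le> 2 * Y * y" if "s \<le> y\<^sup>2" "y / (s + y\<^sup>2) \<le> Y" "s \<ge> 0" for s
  proof -
    have "y / (2 * y\<^sup>2) \<le> y / (s + y\<^sup>2)" using that y by (intro divide_left_mono mult_pos_pos) (auto intro: add_nonneg_pos)
    then have "y / (2 * y\<^sup>2) \<le> Y" using that by simp
    then show ?thesis using y(1) by (simp add: field_simps power2_eq_square)
  qed
  show ?thesis
  proof (cases "x \<le> 1/2")
    case True
    have "x * x \<le> x * (1 - x)" using True y by (intro mult_left_mono) auto
    then have "x\<^sup>2 \<le> y\<^sup>2" using q by (simp add: power2_eq_square)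
    moreover have "y / (x\<^sup>2 + y\<^sup>2) \<le> Y" using Y(2) unfolding Im_rot_rot[OF D(1)] c by (simp add: xy)
    ultimately show ?thesis using fin[of "x\<^sup>2"] by (simp add: xy)
  next
    case False
    have "(1 - x) * (1 - x) \<le> x * (1 - x)" using False y by (intro mult_right_mono) auto
    then have "(1 - x)\<^sup>2 \<le> y\<^sup>2" using q by (simp add: power2_eq_square)
    moreover have "y / ((1 - x)\<^sup>2 + y\<^sup>2) \<le> Y" using Y(1) unfolding rot_Re_Im c by (simp add: xy)
    ultimately show ?thesis using fin[of "(1 - x)\<^sup>2"] by (simp add: xy)
  qed
qed

lemma F0_limit:
  assumes "\<And>n. t n \<in> F0" "t \<longlonglongrightarrow> z" "Im z > 0"
  shows "z \<in> F0"
proof -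
  note D = F0_D[OF assms(1)]
  have "0 \<le> Re z" by (rule LIMSEQ_le_const[OF tendsto_Re[OF assms(2)]]) (use D in blast)
  moreover have "Re z \<le> 1" by (rule LIMSEQ_le_const2[OF tendsto_Re[OF assms(2)]]) (use D in blast)
  moreover have "Re z \<le> (cmod z)\<^sup>2"
    by (rule LIMSEQ_le[OF tendsto_Re[OF assms(2)] tendsto_power[OF tendsto_norm[OF assms(2)]]]) (use D in blast)
  ultimately show ?thesis using assms(3) by (auto simp: F0_iff)
qed

text \<open>Height at most \<open>Y\<close> at all three cusps confines the zeros to a compact part
  of \<open>F0\<close>. Homogeneous parameters allow a limit with
  \<open>C = \<infinity>\<close>.\<close>

lemma F0_zeros_compact:
  assumes F: "\<And>n. t n \<in> F0" and z: "\<And>n. f_hom (a n) (b n) (t n) = 0" and ab: "a \<longlonglongrightarrow> x" "b \<longlonglongrightarrow> y"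
    and Y: "\<And>n. Im (t n) \<le> Y" "\<And>n. Im (rot (t n)) \<le> Y" "\<And>n. Im (rot (rot (t n))) \<le> Y"
  obtains s z where "strict_mono s" "(t \<circ> s) \<longlonglongrightarrow> z" "z \<in> F0" "f_hom x y z = 0"
proof -
  have Y0: "Y > 0" using Y(1)[of 0] F0_D(1)[OF F[of 0]] by linarith
  have low: "Im (t n) \<ge> 1 / (2 * Y)" for n
    using F0_Im_lower_bound[OF F Y(2,3), of n] Y0 by (simp add: field_simps)
  have "norm (t n) \<le> 1 + Y" for n
    using cmod_le[of "t n"] F0_D[OF F[of n]] Y(1)[of n] by linarith
  then have "bounded (range t)" by (auto intro!: boundedI)
  then obtain z s where s: "strict_mono s" "(t \<circ> s) \<longlonglongrightarrow> z"
    using bounded_imp_convergent_subsequence by blast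
  have "1 / (2 * Y) \<le> Im z"
    by (rule LIMSEQ_le_const[OF tendsto_Im[OF s(2)]]) (use low in auto)
  moreover have "1 / (2 * Y) > 0" using Y0 by simp
  ultimately have Iz: "Im z > 0" by linarith
  have "z \<in> F0" by (rule F0_limit[OF _ s(2) Iz]) (use F in simp)
  moreover have "(\<lambda>n. f_hom ((a \<circ> s) n) ((b \<circ> s) n) ((t \<circ> s) n)) \<longlonglongrightarrow> f_hom x y z"
    by (intro f_hom_tendsto Iz LIMSEQ_subseq_LIMSEQ[OF ab(1) s(1)] LIMSEQ_subseq_LIMSEQ[OF ab(2) s(1)] s(2))
  then have "f_hom x y z = 0" using z by (simp add: LIMSEQ_const_iff)
  ultimately show thesis using that s by blast
qed

section \<open>The expansion at infinity\<close>

text \<open>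
  With \<open>v = C - \<tau>\<close> and \<open>s = sqrt (g2 / 12)\<close> the function \<open>f_fam C\<close> is
  \<open>12 * (v * eta1 + 2 * pi * \<i> - s * v) * (v * eta1 + 2 * pi * \<i> + s * v)\<close>. Near \<open>\<i> * \<infinity>\<close> the second
  factor does not vanish, and the first one determines \<open>C\<close> as a function of \<open>\<tau>\<close>.
\<close>
lemma cusp_parametrization:
  obtains \<rho> m where "0 < \<rho>" "m holomorphic_on ball 0 \<rho>"
    "\<And>\<tau> C. norm (nome \<tau>) < \<rho> \<Longrightarrow> Im \<tau> > 0 \<Longrightarrow>
       f_hom C 1 \<tau> = 0 \<longleftrightarrow> of_real C = \<tau> + \<i> / (24 * of_real pi * nome \<tau>) + m (nome \<tau>)"
proof -
  define s where "s q = csqrt (gq q / 12)" for q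
  have "isCont gq 0" using \<eta>q_gq_deriv_0(2) DERIV_isCont by blast
  then have "isCont (\<lambda>q. Re (gq q)) 0" by (intro isCont_Re)
  moreover have g0: "gq 0 / 12 = of_real (pi ^ 4 / 9)" by (simp add: \<eta>q_gq_0)
  moreover have "Re (gq 0) > 0"
  proof -
    have "gq 0 = of_real (4 * pi ^ 4 / 3)" by (simp add: \<eta>q_gq_0)
    then show ?thesis by (simp only: Re_complex_of_real) simp
  qed
  ultimately have "\<forall>\<^sub>F q in nhds 0. Re (gq q) > 0"
    using order_tendstoD(1)[of "\<lambda>q. Re (gq q)" "Re (gq 0)" "nhds 0" 0] by (simp add: isCont_def tendsto_nhds_iff)
  then obtain d where "d > 0" "\<And>q. dist q 0 < d \<Longrightarrow> Re (gq q) > 0"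
    unfolding eventually_nhds_metric by blast
  then obtain \<rho>1 where \<rho>1: "\<rho>1 > 0" "\<rho>1 \<le> 1" "\<And>q. q \<in> ball 0 \<rho>1 \<Longrightarrow> Re (gq q) > 0"
    by (intro that[of "min d 1"]) auto
  have nr: "gq q / 12 \<notin> \<real>\<^sub>\<le>\<^sub>0" if "q \<in> ball 0 \<rho>1" for q
    using \<rho>1(3)[OF that] by (auto simp: complex_nonpos_Reals_iff)
  have hol: "gq holomorphic_on ball 0 \<rho>1" "\<eta>q holomorphic_on ball 0 \<rho>1"
    using gq_holomorphic \<eta>q_holomorphic \<rho>1 by (auto elim!: holomorphic_on_subset)
  have s: "s holomorphic_on ball 0 \<rho>1"
  proof (subst holomorphic_on_open[OF open_ball], intro ballI exI)
    fix q :: complex assume q: "q \<in> ball 0 \<rho>1"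
    show "(s has_field_derivative deriv gq q / 12 / (2 * csqrt (gq q / 12))) (at q)"
      unfolding s_def[abs_def]
      by (intro has_field_derivative_csqrt' DERIV_cdivide holomorphic_derivI[OF hol(1) open_ball q] nr q)
  qed
  have s0: "s 0 = of_real (pi ^ 2 / 3)"
  proof -
    have "csqrt (of_real (pi ^ 4 / 9)) = of_real (sqrt (pi ^ 4 / 9))" by simp
    also have "sqrt (pi ^ 4 / 9) = pi ^ 2 / 3"
      by (rule real_sqrt_unique) (auto simp: power_divide power_mult[symmetric])
    finally show ?thesis unfolding s_def g0 .
  qed
  have s2: "s q ^ 2 = gq q / 12" for q by (simp add: s_def)
  \<comment> \<open>The first factor vanishes exactly if \<open>v * \<kappa> q = 1\<close>. As
    \<open>\<kappa>\<close> has a simple zero at 0 with derivative \<open>- 24 * pi * \<i>\<close>,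
    its reciprocal has principal part \<open>\<i> / (24 * pi * q)\<close>, the main term of the
    expansion.\<close>
  define \<kappa> where "\<kappa> q = (s q - \<eta>q q) / (2 * of_real pi * \<i>)" for q
  have \<kappa>: "\<kappa> holomorphic_on ball 0 \<rho>1" unfolding \<kappa>_def[abs_def] by (intro holomorphic_intros s hol) auto
  have \<kappa>0: "\<kappa> 0 = 0" by (simp add: \<kappa>_def s0 \<eta>q_gq_0)
  have ds: "(s has_field_derivative (320 * of_real pi ^ 4 / 12) / (2 * s 0)) (at 0)"
    unfolding s_def[abs_def] using nr[of 0] \<rho>1(1)
    by (intro has_field_derivative_csqrt' DERIV_cdivide \<eta>q_gq_deriv_0) auto
  have "(\<kappa> has_field_derivative ((320 * of_real pi ^ 4 / 12) / (2 * s 0) - (- 8 * of_real pi ^ 2)) / (2 * of_real pi * \<i>)) (at 0)"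
    unfolding \<kappa>_def[abs_def] by (intro DERIV_cdivide DERIV_diff ds \<eta>q_gq_deriv_0)
  also have "((320 * of_real pi ^ 4 / 12) / (2 * s 0) - (- 8 * of_real pi ^ 2)) / (2 * of_real pi * \<i>) = - 24 * of_real pi * \<i>"
    unfolding s0 by (simp add: field_simps eval_nat_numeral)
  finally have d\<kappa>: "deriv \<kappa> 0 = - 24 * of_real pi * \<i>" by (rule DERIV_imp_deriv)
  define k where "k z = (if z = 0 then deriv \<kappa> 0 else (\<kappa> z - \<kappa> 0) / (z - 0))" for z
  have k: "k holomorphic_on ball 0 \<rho>1" "\<And>z. \<kappa> z = z * k z" "k 0 = - 24 * of_real pi * \<i>"
    using pole_lemma_open[OF \<kappa> open_ball, of 0] \<kappa>0 d\<kappa> by (simp_all add: k_def[abs_def])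
  have cont: "isCont k 0" "isCont s 0" "isCont \<eta>q 0"
    using holomorphic_on_imp_continuous_on[OF k(1)] holomorphic_on_imp_continuous_on[OF s]
      holomorphic_on_imp_continuous_on[OF hol(2)] \<rho>1(1)
    by (auto simp: continuous_on_eq_continuous_at)
  have "isCont (\<lambda>q. norm (k q)) 0" "isCont (\<lambda>q. norm (s q + \<eta>q q)) 0"
    using cont by (auto intro!: continuous_intros)
  moreover have "norm (k 0) > 0" by (simp add: k(3))
  moreover have "norm (s 0 + \<eta>q 0) > 2"
  proof -
    have "s 0 + \<eta>q 0 = of_real (2 / 3 * pi ^ 2)" by (simp add: s0 \<eta>q_gq_0)
    moreover have "9 \<le> pi ^ 2" using power_mono[of 3 pi 2] pi_gt3 by simp
    ultimately show ?thesis by (simp only: norm_of_real)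
  qed
  ultimately have "\<forall>\<^sub>F q in nhds 0. norm (k q) > 0" "\<forall>\<^sub>F q in nhds 0. norm (s q + \<eta>q q) > 2"
    using order_tendstoD(1)[of "\<lambda>q. norm (k q)" "norm (k 0)" "nhds 0" 0]
      order_tendstoD(1)[of "\<lambda>q. norm (s q + \<eta>q q)" "norm (s 0 + \<eta>q 0)" "nhds 0" 2]
    by (simp_all add: isCont_def tendsto_nhds_iff)
  then have "\<forall>\<^sub>F q in nhds 0. norm (k q) > 0 \<and> norm (s q + \<eta>q q) > 2" by (rule eventually_conj)
  then obtain \<rho>2 where \<rho>2: "\<rho>2 > 0" "\<And>q. norm q < \<rho>2 \<Longrightarrow> k q \<noteq> 0 \<and> norm (s q + \<eta>q q) > 2"
    unfolding eventually_nhds_metric by auto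
  \<comment> \<open>The bound \<open>exp (- 8 * pi)\<close> forces \<open>Im \<tau> > 4\<close>.
    Then \<open>norm v > 4\<close> and \<open>norm (s q + \<eta>q q) > 2\<close>, whose product
    exceeds \<open>2 * pi\<close> and keeps the second factor from vanishing.\<close>
  define \<rho> where "\<rho> = min (min \<rho>1 \<rho>2) (exp (- 8 * pi))"
  have \<rho>: "\<rho> > 0" "\<rho> \<le> \<rho>1" "\<rho> \<le> \<rho>2" "\<rho> \<le> exp (- 8 * pi)" using \<rho>1 \<rho>2 by (auto simp: \<rho>_def)
  define W where "W q = 1 / k q" for q
  have W: "W holomorphic_on ball 0 \<rho>" unfolding W_def[abs_def]
    using k(1) \<rho> \<rho>2(2) by (intro holomorphic_intros) (auto elim!: holomorphic_on_subset)
  have W0: "W 0 = \<i> / (24 * of_real pi)" by (simp add: W_def k(3) field_simps)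
  define m where "m z = (if z = 0 then deriv W 0 else (W z - W 0) / (z - 0))" for z
  have m: "m holomorphic_on ball 0 \<rho>" using pole_lemma_open[OF W open_ball, of 0] by (simp add: m_def[abs_def])
  show thesis
  proof (rule that[OF \<rho>(1) m])
    fix \<tau> C assume q: "norm (nome \<tau>) < \<rho>" and I: "Im \<tau> > 0"
    define q where "q = nome \<tau>"
    have q0: "q \<noteq> 0" by (simp add: q_def)
    have kq: "k q \<noteq> 0" "norm (s q + \<eta>q q) > 2" using \<rho>2(2)[of q] q \<rho>(3) by (simp_all add: q_def)
    define v where "v = of_real C - \<tau>"
    have "exp (- 2 * pi * Im \<tau>) < exp (- 8 * pi)" using q \<rho>(4) unfolding norm_nome by linarith
    then have "Im \<tau> > 4" by simp
    moreover have "norm v \<ge> \<bar>Im v\<bar>" by (rule abs_Im_le_cmod)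
    ultimately have nv: "norm v > 4" by (simp add: v_def)
    have "f_hom C 1 \<tau> = 12 * ((v * \<eta>q q + 2 * of_real pi * \<i>)\<^sup>2 - s q ^ 2 * v\<^sup>2)"
      unfolding f_hom_eq[OF I] s2 by (simp add: v_def q_def)
    also have "\<dots> = 12 * ((v * \<eta>q q + 2 * of_real pi * \<i> - s q * v) * (v * (s q + \<eta>q q) + 2 * of_real pi * \<i>))"
      by (simp add: power2_eq_square algebra_simps)
    finally have f: "f_hom C 1 \<tau> = 12 * ((v * \<eta>q q + 2 * of_real pi * \<i> - s q * v) * (v * (s q + \<eta>q q) + 2 * of_real pi * \<i>))" .
    have "v * (s q + \<eta>q q) + 2 * of_real pi * \<i> \<noteq> 0"
    proof
      assume "v * (s q + \<eta>q q) + 2 * of_real pi * \<i> = 0"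
      then have "v * (s q + \<eta>q q) = - (2 * of_real pi * \<i>)" by (simp add: eq_neg_iff_add_eq_0)
      then have "norm v * norm (s q + \<eta>q q) = 2 * pi" by (simp add: norm_mult[symmetric]) (simp add: norm_mult)
      moreover have "4 * 2 < norm v * norm (s q + \<eta>q q)" using nv kq(2) by (intro mult_strict_mono) auto
      ultimately show False using pi_less_4 by simp
    qed
    then have "f_hom C 1 \<tau> = 0 \<longleftrightarrow> v * \<eta>q q + 2 * of_real pi * \<i> - s q * v = 0" unfolding f by simp
    also have "v * \<eta>q q + 2 * of_real pi * \<i> - s q * v = 2 * of_real pi * \<i> - v * (s q - \<eta>q q)" by (simp add: algebra_simps)
    also have "\<dots> = 0 \<longleftrightarrow> v * (s q - \<eta>q q) = 2 * of_real pi * \<i>" by (simp only: right_minus_eq) (rule eq_commute)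
    also have "\<dots> \<longleftrightarrow> v * \<kappa> q = 1" unfolding \<kappa>_def times_divide_eq_right divide_eq_1_iff by simp
    also have "\<dots> \<longleftrightarrow> v = W q / q" unfolding k(2)[of q] W_def using kq(1) q0 by (simp add: divide_simps mult_ac)
    also have "W q / q = \<i> / (24 * of_real pi * q) + m q" using q0 W0 by (simp add: m_def field_simps)
    also have "v = \<i> / (24 * of_real pi * q) + m q \<longleftrightarrow> of_real C = \<tau> + \<i> / (24 * of_real pi * q) + m q"
      by (auto simp: v_def algebra_simps)
    finally show "f_hom C 1 \<tau> = 0 \<longleftrightarrow> of_real C = \<tau> + \<i> / (24 * of_real pi * nome \<tau>) + m (nome \<tau>)"
      unfolding q_def .
  qed
qed

text \<open>Bundles a height \<open>Y\<close> above which the expansion of \<open>C\<close> holds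
  with its remainder \<open>m\<close>. The estimates below know of \<open>m\<close> only that it and
  its derivative with respect to \<open>\<tau>\<close> are bounded by \<open>B\<close>.\<close>

locale cusp_expansion =
  fixes Y B r :: real and m :: "complex \<Rightarrow> complex"
  assumes Y: "Y \<ge> 1" and m: "m holomorphic_on ball 0 r"
    and nome_r: "\<And>\<tau>. Im \<tau> \<ge> Y \<Longrightarrow> nome \<tau> \<in> ball 0 r"
    and B: "\<And>\<tau>. Im \<tau> \<ge> Y \<Longrightarrow> norm (m (nome \<tau>)) \<le> B" "\<And>\<tau>. Im \<tau> \<ge> Y \<Longrightarrow> norm (Dq m (nome \<tau>)) \<le> B"
    and zero_iff: "\<And>\<tau> C. Im \<tau> \<ge> Y \<Longrightarrow>
       f_hom C 1 \<tau> = 0 \<longleftrightarrow> of_real C = \<tau> + \<i> / (24 * of_real pi * nome \<tau>) + m (nome \<tau>)"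

lemma cusp_expansion_exists: "\<exists>Y B r m. cusp_expansion Y B r m"
proof -
  obtain \<rho> m where \<rho>: "0 < \<rho>" and m: "m holomorphic_on ball 0 \<rho>" and
    z: "\<And>\<tau> C. norm (nome \<tau>) < \<rho> \<Longrightarrow> Im \<tau> > 0 \<Longrightarrow>
       f_hom C 1 \<tau> = 0 \<longleftrightarrow> of_real C = \<tau> + \<i> / (24 * of_real pi * nome \<tau>) + m (nome \<tau>)"
    using cusp_parametrization by blast
  have "Dq m holomorphic_on ball 0 \<rho>" unfolding Dq_def[abs_def] by (intro holomorphic_intros m) auto
  then have "continuous_on (cball 0 (\<rho>/2)) m" "continuous_on (cball 0 (\<rho>/2)) (Dq m)"
    using m \<rho> by (auto intro!: holomorphic_on_imp_continuous_on elim: holomorphic_on_subset)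
  then have "bounded (m ` cball 0 (\<rho>/2))" "bounded (Dq m ` cball 0 (\<rho>/2))"
    by (auto intro!: compact_imp_bounded compact_continuous_image)
  then obtain B1 B2 where B: "\<forall>z\<in>cball 0 (\<rho>/2). norm (m z) \<le> B1" "\<forall>z\<in>cball 0 (\<rho>/2). norm (Dq m z) \<le> B2"
    unfolding bounded_iff by blast
  define Y where "Y = max 1 (ln (2 / \<rho>))"
  have nome: "nome \<tau> \<in> cball 0 (\<rho>/2)" if "Im \<tau> \<ge> Y" for \<tau>
  proof -
    have 1: "1 \<le> Im \<tau>" "ln (2 / \<rho>) \<le> Im \<tau>" using that by (auto simp: Y_def)
    have "1 * Im \<tau> \<le> 2 * pi * Im \<tau>" using 1 pi_gt3 by (intro mult_right_mono) auto
    then have "ln (2 / \<rho>) \<le> 2 * pi * Im \<tau>" using 1(2) by linarith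
    then have "exp (- 2 * pi * Im \<tau>) \<le> exp (- ln (2 / \<rho>))" by simp
    also have "\<dots> = \<rho> / 2" using \<rho> by (simp add: exp_minus)
    finally show ?thesis by (simp add: norm_nome)
  qed
  have "cusp_expansion Y (max B1 B2) \<rho> m"
  proof
    fix \<tau> assume t: "Im \<tau> \<ge> Y"
    then have "Im \<tau> > 0" by (auto simp: Y_def)
    have n: "norm (nome \<tau>) < \<rho>" using nome[OF t] \<rho> by simp
    show "nome \<tau> \<in> ball 0 \<rho>" using n by simp
    show "norm (m (nome \<tau>)) \<le> max B1 B2" "norm (Dq m (nome \<tau>)) \<le> max B1 B2"
      using B nome[OF t] by (auto intro: max.coboundedI1 max.coboundedI2)
    show "f_hom C 1 \<tau> = 0 \<longleftrightarrow> of_real C = \<tau> + \<i> / (24 * of_real pi * nome \<tau>) + m (nome \<tau>)" for C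
      by (rule z[OF n \<open>Im \<tau> > 0\<close>])
  qed (use m in \<open>auto simp: Y_def\<close>)
  then show ?thesis by blast
qed

text \<open>The threshold gives \<open>2 * y + K \<le> y * (2 + K) \<le> y\<^sup>2 / 5\<close>, and
  the quadratic term of the exponential exceeds \<open>24 * pi * y\<^sup>2 / 5\<close>.\<close>

lemma exp_dominates:
  fixes y K :: real
  assumes "K \<ge> 0" "y \<ge> 10 + 5 * K"
  shows "exp (2 * pi * y) / (24 * pi) > 2 * y + K"
proof -
  have y: "y \<ge> 10" using assms by simp
  have pos: "0 \<le> 2 * pi * y" using y by simp
  have "2 * y + K \<le> y * (2 + K)" using y assms(1) mult_right_mono[of 1 y K] by (simp add: algebra_simps)
  also have "\<dots> \<le> y * (y / 5)" using assms y by (intro mult_left_mono) auto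
  finally have 1: "2 * y + K \<le> y\<^sup>2 / 5" by (simp add: power2_eq_square)
  have p: "pi > 3" "pi < 4" using pi_gt3 pi_less_4 by auto
  have "24 * pi * (y\<^sup>2 / 5) \<le> (2 * pi * y)\<^sup>2 / 2"
  proof -
    have "pi * (24 / 5) \<le> pi * (2 * pi)" using p by (intro mult_left_mono) auto
    then have "(pi * (24 / 5)) * y\<^sup>2 \<le> (pi * (2 * pi)) * y\<^sup>2" by (intro mult_right_mono) auto
    then show ?thesis by (simp add: power2_eq_square algebra_simps)
  qed
  also have "\<dots> < exp (2 * pi * y)" using exp_lower_Taylor_quadratic[OF pos] pos by linarith
  finally have "y\<^sup>2 / 5 < exp (2 * pi * y) / (24 * pi)" using p by (simp add: field_simps)
  then show ?thesis using 1 by linarith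
qed

lemma inverse_nome:
  "\<i> / (24 * of_real pi * nome \<tau>) = of_real (exp (2 * pi * Im \<tau>) / (24 * pi)) * (of_real (sin (2 * pi * Re \<tau>)) + \<i> * of_real (cos (2 * pi * Re \<tau>)))"
proof -
  have "1 / nome \<tau> = exp (- (2 * of_real pi * \<i> * \<tau>))" by (simp add: nome_def exp_minus inverse_eq_divide)
  also have "\<dots> = of_real (exp (2 * pi * Im \<tau>)) * (of_real (cos (2 * pi * Re \<tau>)) - \<i> * of_real (sin (2 * pi * Re \<tau>)))"
    by (simp add: exp_eq_polar complex_eq_iff cis.code Re_exp Im_exp)
  finally have "1 / nome \<tau> = of_real (exp (2 * pi * Im \<tau>)) * (of_real (cos (2 * pi * Re \<tau>)) - \<i> * of_real (sin (2 * pi * Re \<tau>)))" .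
  moreover have "\<i> / (24 * of_real pi * nome \<tau>) = \<i> / (24 * of_real pi) * (1 / nome \<tau>)" by simp
  ultimately have "\<i> / (24 * of_real pi * nome \<tau>) = \<i> / (24 * of_real pi) * (of_real (exp (2 * pi * Im \<tau>)) * (of_real (cos (2 * pi * Re \<tau>)) - \<i> * of_real (sin (2 * pi * Re \<tau>))))"
    by (simp only:)
  then show ?thesis by (simp add: field_simps)
qed

text \<open>A form of the Noshiro-Warschawski theorem: along the segment from \<open>a\<close> to
  \<open>b\<close> the imaginary part of \<open>f / (b - a)\<close> has derivative
  \<open>Im f'\<close>, so it strictly decreases.\<close>

lemma convex_injective:
  fixes f :: "complex \<Rightarrow> complex"
  assumes "convex S" "\<And>z. z \<in> S \<Longrightarrow> (f has_field_derivative f' z) (at z)" "\<And>z. z \<in> S \<Longrightarrow> Im (f' z) < 0"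
    and "a \<in> S" "b \<in> S" "f a = f b"
  shows "a = b"
proof (rule ccontr)
  assume "a \<noteq> b"
  define p where "p t = a + of_real t * (b - a)" for t
  have p: "p t \<in> S" if "0 \<le> t" "t \<le> 1" for t
  proof -
    have "(1 - t) *\<^sub>R a + t *\<^sub>R b \<in> S" using that assms by (intro convexD) auto
    then show ?thesis by (simp add: p_def scaleR_conv_of_real algebra_simps)
  qed
  define g where "g t = Im (f (p t) / (b - a))" for t
  have "(g has_real_derivative Im (f' (p t))) (at t)" if "0 \<le> t" "t \<le> 1" for t
  proof -
    have "(p has_vector_derivative (b - a)) (at t)"
      unfolding p_def[abs_def] by (auto intro!: derivative_eq_intros)
    then have "((f \<circ> p) has_vector_derivative (b - a) * f' (p t)) (at t)"
      using assms(2)[OF p[OF that]] by (rule field_vector_diff_chain_at)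
    then have "((\<lambda>t. f (p t) / (b - a)) has_vector_derivative (b - a) * f' (p t) / (b - a)) (at t)"
      unfolding o_def by (rule has_vector_derivative_divide)
    then have "((\<lambda>t. Im (f (p t) / (b - a))) has_vector_derivative Im ((b - a) * f' (p t) / (b - a))) (at t)"
      by (rule bounded_linear.has_vector_derivative[OF bounded_linear_Im])
    then show ?thesis using \<open>a \<noteq> b\<close> by (simp add: g_def[abs_def] has_real_derivative_iff_has_vector_derivative)
  qed
  then have "g 1 < g 0"
    using assms(3) p by (intro DERIV_neg_imp_decreasing[of 0 1 g]) auto
  then show False using assms(6) by (simp add: g_def p_def)
qed

context cusp_expansion
begin

text \<open>The parameter as a function of the zero: above height \<open>Y\<close>, the zeros for
  real parameters are the points where \<open>H\<close> is real.\<close>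

definition H :: "complex \<Rightarrow> complex" where
  "H \<tau> = \<tau> + \<i> / (24 * of_real pi * nome \<tau>) + m (nome \<tau>)"

lemma B_nonneg: "B \<ge> 0"
  by (rule order_trans[OF norm_ge_zero B(1)[of "\<i> * of_real Y"]]) simp

lemma H_Re_Im:
  "Re (H \<tau>) = Re \<tau> + exp (2 * pi * Im \<tau>) / (24 * pi) * sin (2 * pi * Re \<tau>) + Re (m (nome \<tau>))"
  "Im (H \<tau>) = Im \<tau> + exp (2 * pi * Im \<tau>) / (24 * pi) * cos (2 * pi * Re \<tau>) + Im (m (nome \<tau>))"
  unfolding H_def inverse_nome by simp_all

lemma zero_iff_H: "Im \<tau> \<ge> Y \<Longrightarrow> f_hom C 1 \<tau> = 0 \<longleftrightarrow> of_real C = H \<tau>"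
  by (simp add: zero_iff H_def)

lemma no_zeros_near_cusp:
  assumes "M \<ge> 0" "\<tau> \<in> F0" "\<bar>C\<bar> \<le> M" "Im \<tau> \<ge> Y + 10 + 5 * (M + B + 1)"
  shows "f_hom C 1 \<tau> \<noteq> 0"
proof
  assume "f_hom C 1 \<tau> = 0"
  have Ip: "Im \<tau> \<ge> Y" "Im \<tau> \<ge> 10 + 5 * (M + B + 1)" using assms B_nonneg Y by auto
  have "of_real C = H \<tau>" using zero_iff_H[OF Ip(1)] \<open>f_hom C 1 \<tau> = 0\<close> by simp
  then have e: "\<i> / (24 * of_real pi * nome \<tau>) = of_real C - \<tau> - m (nome \<tau>)" by (simp add: H_def)
  have "norm (\<i> / (24 * of_real pi * nome \<tau>)) \<le> norm (of_real C :: complex) + norm \<tau> + norm (m (nome \<tau>))"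
    unfolding e using norm_triangle_ineq4[of "of_real C - \<tau>" "m (nome \<tau>)"] norm_triangle_ineq4[of "of_real C :: complex" \<tau>] by linarith
  moreover have "norm (\<i> / (24 * of_real pi * nome \<tau>)) = exp (2 * pi * Im \<tau>) / (24 * pi)"
  proof -
    have "norm (\<i> / (24 * of_real pi * nome \<tau>)) = 1 / (24 * pi * exp (- (2 * pi * Im \<tau>)))"
      by (simp add: norm_divide norm_mult norm_nome)
    then show ?thesis unfolding exp_minus by (simp add: divide_simps)
  qed
  moreover have "norm \<tau> \<le> 1 + Im \<tau>" using cmod_le[of \<tau>] F0_D[OF assms(2)] by linarith
  moreover have "norm (m (nome \<tau>)) \<le> B" by (rule B(1)[OF Ip(1)])
  moreover have "norm (of_real C :: complex) = \<bar>C\<bar>" by (rule norm_of_real)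
  ultimately have "exp (2 * pi * Im \<tau>) / (24 * pi) \<le> Im \<tau> + (M + B + 1)" using assms(3) by linarith
  moreover have "exp (2 * pi * Im \<tau>) / (24 * pi) > 2 * Im \<tau> + (M + B + 1)"
    using exp_dominates[OF _ Ip(2)] assms(1) B_nonneg by simp
  ultimately show False using Ip(1) Y by linarith
qed

lemma H_derivative:
  assumes "Im \<tau> \<ge> Y"
  shows "(H has_field_derivative 1 + 1 / (12 * nome \<tau>) + Dq m (nome \<tau>)) (at \<tau>)"
proof -
  have "(nome has_field_derivative 2 * of_real pi * \<i> * nome \<tau>) (at \<tau>)"
    unfolding nome_def[abs_def] by (auto intro!: derivative_eq_intros)
  then have "((\<lambda>\<tau>. \<i> / (24 * of_real pi * nome \<tau>)) has_field_derivative
     - \<i> * (24 * of_real pi * (2 * of_real pi * \<i> * nome \<tau>)) / (24 * of_real pi * nome \<tau>)\<^sup>2) (at \<tau>)"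
    by (auto intro!: derivative_eq_intros simp: power2_eq_square)
  also have "- \<i> * (24 * of_real pi * (2 * of_real pi * \<i> * nome \<tau>)) / (24 * of_real pi * nome \<tau>)\<^sup>2 = 1 / (12 * nome \<tau>)"
    by (simp add: power2_eq_square field_simps)
  finally show ?thesis unfolding H_def[abs_def]
    by (intro DERIV_add DERIV_ident has_field_derivative_nome_comp[OF m open_ball] nome_r assms)
qed

text \<open>From this height on, even half of the exponential term exceeds \<open>y + B + 1\<close>;
  the half is the value of sine and cosine allowed for in the following bounds.\<close>

definition strip_start :: real where "strip_start = Y + 10 + 5 * (2 * B + 2)"

lemma strip_start:
  assumes "y \<ge> strip_start"
  shows "y \<ge> Y" "exp (2 * pi * y) / (24 * pi) > 2 * y + 2 * B + 2" "y \<ge> 1"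
  using assms exp_dominates[of "2 * B + 2" y] Y B_nonneg by (auto simp: strip_start_def)

lemma cos_120: "cos (2 * (pi / 3)) = - 1/2"
  using cos_double_cos[of "pi / 3"] by (simp add: cos_60 power2_eq_square)

text \<open>With \<open>a = 2 * pi * Re \<tau>\<close>, the real part of \<open>H \<tau> = C\<close>
  forces \<open>sin a > 0\<close> because \<open>C > 1 + B\<close>, and the vanishing imaginary part
  forces \<open>\<bar>cos a\<bar> < 1/2\<close>. So \<open>a\<close> lies between
  \<open>pi / 3\<close> and \<open>2 * pi / 3\<close>.\<close>

lemma zero_location:
  assumes "\<tau> \<in> F0" "Im \<tau> \<ge> strip_start" "C > 1 + B" "f_hom C 1 \<tau> = 0"
  shows "Re \<tau> \<in> {1/6<..<1/3}"
proof -
  note F = F0_D[OF assms(1)]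
  note S = strip_start[OF assms(2)]
  define E a where "E = exp (2 * pi * Im \<tau>) / (24 * pi)" and "a = 2 * pi * Re \<tau>"
  have E: "E > 2 * Im \<tau> + 2 * B + 2" using S(2) by (simp add: E_def)
  have E0: "E > 0" using E S B_nonneg by linarith
  have H: "H \<tau> = of_real C" using zero_iff_H[OF S(1)] assms(4) by simp
  have m: "\<bar>Re (m (nome \<tau>))\<bar> \<le> B" "\<bar>Im (m (nome \<tau>))\<bar> \<le> B"
    using B(1)[OF S(1)] abs_Re_le_cmod[of "m (nome \<tau>)"] abs_Im_le_cmod[of "m (nome \<tau>)"] by linarith+
  have re: "C = Re \<tau> + E * sin a + Re (m (nome \<tau>))" and im: "0 = Im \<tau> + E * cos a + Im (m (nome \<tau>))"
    using H_Re_Im[of \<tau>] unfolding H E_def a_def by simp_all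
  have "E * sin a > 0" using re assms(3) F m by linarith
  then have sin: "sin a > 0" using E0 by (simp add: zero_less_mult_iff)
  have "\<bar>E * cos a\<bar> < E * (1/2)" using im m E S by linarith
  then have "E * \<bar>cos a\<bar> < E * (1/2)" using E0 by (simp add: abs_mult)
  then have cos: "\<bar>cos a\<bar> < 1/2" using E0 by (simp only: mult_less_cancel_left_pos)
  have a: "0 \<le> a" "a \<le> 2 * pi" using F mult_left_mono[of "Re \<tau>" 1 "2 * pi"] by (auto simp: a_def)
  have api: "a \<le> pi"
  proof (rule ccontr)
    assume "\<not> a \<le> pi"
    then show False using sin sin_le_zero[of a] a by (cases "a = 2 * pi") auto
  qed
  have "a > pi / 3"
  proof (rule ccontr)
    assume "\<not> a > pi / 3"
    then have "cos (pi / 3) \<le> cos a" using a pi_gt_zero by (intro cos_monotone_0_pi_le) linarith+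
    then show False using cos by (simp add: cos_60)
  qed
  moreover have "a < 2 * (pi / 3)"
  proof (rule ccontr)
    assume "\<not> a < 2 * (pi / 3)"
    then have "cos a \<le> cos (2 * (pi / 3))" using a api pi_gt_zero by (intro cos_monotone_0_pi_le) linarith+
    then show False using cos unfolding cos_120 by linarith
  qed
  ultimately show ?thesis by (simp add: a_def)
qed

lemma trig_strip:
  assumes "x \<in> {1/6..1/3}"
  shows "sin (2 * pi * x) \<ge> 1/2"
proof -
  define a where "a = 2 * pi * x"
  have "pi * x \<ge> pi * (1/6)" "pi * x \<le> pi * (1/3)" using assms by (intro mult_left_mono; simp)+
  then have a: "pi / 3 \<le> a" "a \<le> 2 * (pi / 3)" by (simp_all add: a_def)
  have "cos a \<le> cos (pi / 3)" using a pi_gt_zero by (intro cos_monotone_0_pi_le) linarith+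
  moreover have "cos (2 * (pi / 3)) \<le> cos a" using a pi_gt_zero by (intro cos_monotone_0_pi_le) linarith+
  ultimately have "\<bar>cos a\<bar> \<le> 1/2" unfolding cos_120 cos_60 by linarith
  then have "(cos a)\<^sup>2 \<le> (1/2)\<^sup>2" by (metis abs_ge_zero power2_abs power_mono)
  then have "(1/2)\<^sup>2 \<le> (sin a)\<^sup>2" using sin_cos_squared_add[of a] by (simp add: power2_eq_square)
  moreover have "sin a \<ge> 0" using a pi_gt_zero by (intro sin_ge_zero) linarith+
  ultimately show ?thesis unfolding a_def[symmetric] by (rule power2_le_imp_le)
qed

text \<open>All such zeros lie in the convex strip \<open>1/6 < Re \<tau> < 1/3\<close>. There the
  term \<open>1 / (12 * nome \<tau>)\<close> of the derivative of \<open>H\<close> has a negative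
  imaginary part that outweighs the rest, so \<open>H\<close> is injective.\<close>

lemma zero_unique_near_cusp:
  assumes "\<tau>1 \<in> F0" "\<tau>2 \<in> F0" "Im \<tau>1 \<ge> strip_start" "Im \<tau>2 \<ge> strip_start" "C > 1 + B"
    and "f_hom C 1 \<tau>1 = 0" "f_hom C 1 \<tau>2 = 0"
  shows "\<tau>1 = \<tau>2"
proof (rule convex_injective[of "{\<tau>. Re \<tau> \<in> {1/6<..<1/3} \<and> Im \<tau> \<ge> strip_start}" H "\<lambda>\<tau>. 1 + 1 / (12 * nome \<tau>) + Dq m (nome \<tau>)"])
  have "{\<tau>. Re \<tau> \<in> {1/6<..<1/3} \<and> Im \<tau> \<ge> strip_start} = {\<tau>. Re \<tau> > 1/6} \<inter> {\<tau>. Re \<tau> < 1/3} \<inter> {\<tau>. Im \<tau> \<ge> strip_start}" by auto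
  then show "convex {\<tau>. Re \<tau> \<in> {1/6<..<1/3} \<and> Im \<tau> \<ge> strip_start}"
    by (simp only:) (intro convex_Int convex_halfspace_Re_gt convex_halfspace_Re_lt convex_halfspace_Im_ge)
  show "\<tau>1 \<in> {\<tau>. Re \<tau> \<in> {1/6<..<1/3} \<and> Im \<tau> \<ge> strip_start}" "\<tau>2 \<in> {\<tau>. Re \<tau> \<in> {1/6<..<1/3} \<and> Im \<tau> \<ge> strip_start}"
    using zero_location assms by simp_all
  show "H \<tau>1 = H \<tau>2" using zero_iff_H[OF strip_start(1)] assms by metis
  fix \<tau> assume t: "\<tau> \<in> {\<tau>. Re \<tau> \<in> {1/6<..<1/3} \<and> Im \<tau> \<ge> strip_start}"
  then have S: "Im \<tau> \<ge> Y" "exp (2 * pi * Im \<tau>) / (24 * pi) > 2 * Im \<tau> + 2 * B + 2" "Im \<tau> \<ge> 1"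
    using strip_start[of "Im \<tau>"] by auto
  show "(H has_field_derivative 1 + 1 / (12 * nome \<tau>) + Dq m (nome \<tau>)) (at \<tau>)" by (rule H_derivative[OF S(1)])
  define E where "E = exp (2 * pi * Im \<tau>) / (24 * pi)"
  have "1 / (12 * nome \<tau>) = - 2 * of_real pi * \<i> * (\<i> / (24 * of_real pi * nome \<tau>))" by (simp add: field_simps)
  then have "Im (1 / (12 * nome \<tau>)) = - 2 * pi * (E * sin (2 * pi * Re \<tau>))"
    unfolding inverse_nome E_def[symmetric] by simp
  moreover have "2 * pi * (E * sin (2 * pi * Re \<tau>)) \<ge> 2 * 3 * (E * (1/2))"
    using trig_strip[of "Re \<tau>"] t pi_gt3 S B_nonneg by (intro mult_mono) (auto simp: E_def)
  moreover have "Im (Dq m (nome \<tau>)) \<le> B" using B(2)[OF S(1)] abs_Im_le_cmod[of "Dq m (nome \<tau>)"] by linarith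
  moreover have "Im (1 + 1 / (12 * nome \<tau>) + Dq m (nome \<tau>)) = Im (1 / (12 * nome \<tau>)) + Im (Dq m (nome \<tau>))" by simp
  moreover have "E > 2 * Im \<tau> + 2 * B + 2" using S(2) by (simp add: E_def)
  ultimately show "Im (1 + 1 / (12 * nome \<tau>) + Dq m (nome \<tau>)) < 0"
    using S(3) B_nonneg by linarith
qed

text \<open>On a horizontal segment at height at least \<open>K\<close>, the imaginary part of
  \<open>H\<close> changes sign between real parts 1/6 and 1/3. At the intermediate zero,
  \<open>Re (H \<tau>)\<close> is the desired parameter, and the sine term makes it exceed
  \<open>K\<close>.\<close>

lemma zero_exists_near_cusp:
  shows "\<exists>C \<tau>. C > K \<and> \<tau> \<in> F0 \<and> f_hom C 1 \<tau> = 0"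
proof -
  define y where "y = max strip_start K"
  note S = strip_start[of y]
  have y: "y \<ge> strip_start" "y \<ge> K" by (auto simp: y_def)
  define p where "p x = Complex x y" for x
  define E where "E = exp (2 * pi * y) / (24 * pi)"
  have E: "E > 2 * y + 2 * B + 2" using S y by (simp add: E_def)
  have mb: "\<bar>Re (m (nome (p x)))\<bar> \<le> B" "\<bar>Im (m (nome (p x)))\<bar> \<le> B" for x
    using B(1)[of "p x"] S(1)[OF y(1)] abs_Re_le_cmod[of "m (nome (p x))"] abs_Im_le_cmod[of "m (nome (p x))"]
    by (auto simp: p_def)
  have H: "Re (H (p x)) = x + E * sin (2 * pi * x) + Re (m (nome (p x)))"
    "Im (H (p x)) = y + E * cos (2 * pi * x) + Im (m (nome (p x)))" for x
    using H_Re_Im[of "p x"] by (simp_all add: p_def E_def)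
  have "isCont (\<lambda>x. Im (H (p x))) x" for x
  proof -
    have "isCont H (p x)" using H_derivative[of "p x"] S(1)[OF y(1)] DERIV_isCont by (auto simp: p_def)
    moreover have "isCont p x" unfolding p_def[abs_def] Complex_eq by (intro continuous_intros)
    ultimately show ?thesis using isCont_o2[of x p "\<lambda>w. Im (H w)"] by (auto intro: continuous_intros)
  qed
  moreover have "Im (H (p (1/6))) \<ge> 0"
    using mb(2)[of "1/6"] E S y B_nonneg unfolding H by (simp add: cos_60 abs_le_iff)
  moreover have "Im (H (p (1/3))) \<le> 0"
  proof -
    have "cos (2 * pi * (1/3)) = - 1/2" using cos_120 by (simp add: mult.commute)
    then show ?thesis using mb(2)[of "1/3"] E S y B_nonneg unfolding H by (simp add: abs_le_iff)
  qed
  ultimately obtain x where x: "1/6 \<le> x" "x \<le> 1/3" "Im (H (p x)) = 0"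
    using IVT2[of "\<lambda>x. Im (H (p x))" "1/3" 0 "1/6"] by auto
  define C where "C = Re (H (p x))"
  have "E * sin (2 * pi * x) \<ge> E * (1/2)" using trig_strip[of x] x E y S B_nonneg by (intro mult_left_mono) auto
  then have "C > K" unfolding C_def H using mb(1)[of x] x E y by (simp add: abs_le_iff)
  moreover have "f_hom C 1 (p x) = 0"
    using zero_iff_H[of "p x"] S(1)[OF y(1)] x(3) by (simp add: C_def complex_eq_iff p_def)
  moreover have "p x \<in> F0"
  proof -
    have "1 \<le> y" using S(3) y by simp
    then have "1\<^sup>2 \<le> y\<^sup>2" by (intro power_mono) auto
    then have "x \<le> x\<^sup>2 + y\<^sup>2" using x zero_le_power2[of x] by (simp only: one_power2)
    then show ?thesis using x \<open>1 \<le> y\<close> by (auto simp: F0_iff p_def cmod_power2)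
  qed
  ultimately show ?thesis by blast
qed

end

section \<open>Counting zeros\<close>

lemma no_zeros_near_infinity:
  assumes "M \<ge> 0"
  obtains Y where "\<And>\<tau> C. \<tau> \<in> F0 \<Longrightarrow> \<bar>C\<bar> \<le> M \<Longrightarrow> f_hom C 1 \<tau> = 0 \<Longrightarrow> Im \<tau> \<le> Y"
proof -
  obtain Y B r m where "cusp_expansion Y B r m" using cusp_expansion_exists by blast
  then interpret cusp_expansion Y B r m .
  show thesis by (rule that[of "Y + 10 + 5 * (M + B + 1)"]) (use no_zeros_near_cusp[OF assms] in force)
qed

lemma f_hom_zero_rot:
  assumes "Im \<tau> > 0" "C \<noteq> 1" "f_hom C 1 \<tau> = 0"
  shows "f_hom (1 / (1 - C)) 1 (rot \<tau>) = 0"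
proof -
  have "f_hom 1 (1 - C) (rot \<tau>) = 0" using f_hom_rot[OF assms(1), of 1 "1 - C"] assms(3) by simp
  then show ?thesis using f_hom_zero_iff[of "1 - C" 1] assms(2) by simp
qed

text \<open>For \<open>C \<ge> a > 1\<close> the parameters \<open>1 / (1 - C)\<close> and
  \<open>(C - 1) / C\<close> at the two rotated points are bounded uniformly in \<open>C\<close>, so
  only the height at \<open>\<infinity>\<close> depends on an upper bound for
  \<open>C\<close>.\<close>

lemma zeros_bounded:
  assumes "a > 1"
  obtains Y where "\<And>\<tau> C. \<tau> \<in> F0 \<Longrightarrow> a \<le> C \<Longrightarrow> f_hom C 1 \<tau> = 0 \<Longrightarrow> Im (rot \<tau>) \<le> Y \<and> Im (rot (rot \<tau>)) \<le> Y"
    "\<And>\<tau> C. \<tau> \<in> F0 \<Longrightarrow> a \<le> C \<Longrightarrow> C \<le> b \<Longrightarrow> f_hom C 1 \<tau> = 0 \<Longrightarrow> Im \<tau> \<le> Y"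
proof -
  define M where "M = \<bar>b\<bar> + 1 + 1 / (a - 1)"
  have M: "M \<ge> 0" "M \<ge> 1" "M \<ge> 1 / (a - 1)" "M \<ge> \<bar>b\<bar>" using assms by (auto simp: M_def)
  obtain Y where Y: "\<And>\<tau> C. \<tau> \<in> F0 \<Longrightarrow> \<bar>C\<bar> \<le> M \<Longrightarrow> f_hom C 1 \<tau> = 0 \<Longrightarrow> Im \<tau> \<le> Y"
    using no_zeros_near_infinity[OF M(1)] by blast
  show thesis
  proof (rule that[of Y])
    fix \<tau> C assume F: "\<tau> \<in> F0" and C: "a \<le> C" and z: "f_hom C 1 \<tau> = 0"
    have C1: "C > 1" using C assms by simp
    have z1: "f_hom (1 / (1 - C)) 1 (rot \<tau>) = 0" by (rule f_hom_zero_rot[OF F0_D(1)[OF F] _ z]) (use C1 in simp)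
    have "\<bar>1 / (1 - C)\<bar> = 1 / (C - 1)" using C1 by (simp add: abs_divide)
    also have "\<dots> \<le> 1 / (a - 1)" using C assms by (intro divide_left_mono mult_pos_pos) auto
    finally have 1: "Im (rot \<tau>) \<le> Y" using Y[OF rot_F0[OF F] _ z1] M(3) by simp
    have "1 / (1 - C) \<noteq> 1" using C1 by (simp add: divide_simps)
    from f_hom_zero_rot[OF F0_D(1)[OF rot_F0[OF F]] this z1]
    have z2: "f_hom (1 / (1 - 1 / (1 - C))) 1 (rot (rot \<tau>)) = 0" .
    have "1 / (1 - 1 / (1 - C)) = (C - 1) / C" using C1 by (simp add: field_simps)
    moreover have "\<bar>(C - 1) / C\<bar> \<le> 1" using C1 by (simp add: field_simps)
    ultimately have "Im (rot (rot \<tau>)) \<le> Y" using Y[OF rot_F0[OF rot_F0[OF F]] _ z2] M(2) by simp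
    then show "Im (rot \<tau>) \<le> Y \<and> Im (rot (rot \<tau>)) \<le> Y" using 1 by simp
  next
    fix \<tau> C assume F: "\<tau> \<in> F0" and C: "a \<le> C" "C \<le> b" and z: "f_hom C 1 \<tau> = 0"
    show "Im \<tau> \<le> Y" by (rule Y[OF F _ z]) (use C assms M(4) in auto)
  qed
qed

text \<open>Otherwise zeros outside \<open>U\<close> for parameters tending to \<open>C0\<close>
  would accumulate in \<open>F0\<close> at a zero for \<open>C0\<close> outside
  \<open>U\<close>.\<close>

lemma zeros_stay_near:
  assumes C0: "C0 > 1" and U: "open U" "\<And>\<tau>. \<tau> \<in> F0 \<Longrightarrow> f_hom C0 1 \<tau> = 0 \<Longrightarrow> \<tau> \<in> U"
  shows "\<forall>\<^sub>F C in nhds C0. \<forall>\<tau>\<in>F0. f_hom C 1 \<tau> = 0 \<longrightarrow> \<tau> \<in> U"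
proof (rule ccontr)
  assume "\<not> ?thesis"
  then have ex: "\<exists>C. dist C C0 < d \<and> (\<exists>\<tau>\<in>F0. f_hom C 1 \<tau> = 0 \<and> \<tau> \<notin> U)" if "d > 0" for d
    using that unfolding eventually_nhds_metric by blast
  \<comment> \<open>Keeps the parameters in a compact interval within
    \<open>(1, \<infinity>)\<close>, where all three heights are bounded.\<close>
  define \<delta> where "\<delta> = (C0 - 1) / 2"
  have \<delta>: "\<delta> > 0" using C0 by (simp add: \<delta>_def)
  have "\<exists>C \<tau>. dist C C0 < \<delta> / Suc n \<and> \<tau> \<in> F0 \<and> f_hom C 1 \<tau> = 0 \<and> \<tau> \<notin> U" for n
    using ex[of "\<delta> / Suc n"] \<delta> by auto
  then obtain c t where ct: "\<And>n. dist (c n) C0 < \<delta> / Suc n" "\<And>n. t n \<in> F0" "\<And>n. f_hom (c n) 1 (t n) = 0" "\<And>n. t n \<notin> U"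
    by metis
  have "(\<lambda>n. \<delta> * inverse (real (Suc n))) \<longlonglongrightarrow> \<delta> * 0"
    by (intro tendsto_mult_left LIMSEQ_inverse_real_of_nat)
  then have "(\<lambda>n. dist (c n) C0) \<longlonglongrightarrow> 0"
    by (intro real_tendsto_sandwich[of "\<lambda>_. 0" "\<lambda>n. dist (c n) C0" _ "\<lambda>n. \<delta> * inverse (real (Suc n))"])
      (use ct(1) in \<open>auto intro!: always_eventually less_imp_le simp: divide_inverse\<close>)
  then have c: "c \<longlonglongrightarrow> C0" by (rule tendsto_dist_iff[THEN iffD2])
  have cb: "C0 - \<delta> \<le> c n" "c n \<le> C0 + \<delta>" for n
  proof -
    have "\<delta> / Suc n \<le> \<delta> / 1" using \<delta> by (intro divide_left_mono) auto
    then have "\<bar>c n - C0\<bar> < \<delta>" using ct(1)[of n] by (simp add: dist_real_def)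
    then show "C0 - \<delta> \<le> c n" "c n \<le> C0 + \<delta>" by auto
  qed
  have a: "C0 - \<delta> > 1" using C0 by (simp add: \<delta>_def field_simps)
  obtain Y where Y: "\<And>\<tau> C. \<tau> \<in> F0 \<Longrightarrow> C0 - \<delta> \<le> C \<Longrightarrow> f_hom C 1 \<tau> = 0 \<Longrightarrow> Im (rot \<tau>) \<le> Y \<and> Im (rot (rot \<tau>)) \<le> Y"
    "\<And>\<tau> C. \<tau> \<in> F0 \<Longrightarrow> C0 - \<delta> \<le> C \<Longrightarrow> C \<le> C0 + \<delta> \<Longrightarrow> f_hom C 1 \<tau> = 0 \<Longrightarrow> Im \<tau> \<le> Y"
    using zeros_bounded[OF a] by blast
  have tb: "Im (t n) \<le> Y" "Im (rot (t n)) \<le> Y" "Im (rot (rot (t n))) \<le> Y" for n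
    using Y(1)[OF ct(2) cb(1) ct(3)] Y(2)[OF ct(2) cb ct(3)] by auto
  obtain s z where s: "strict_mono s" "(t \<circ> s) \<longlonglongrightarrow> z" "z \<in> F0" "f_hom C0 1 z = 0"
    by (rule F0_zeros_compact[OF ct(2,3) c tendsto_const tb])
  have "closed (- U)" unfolding closed_def using U(1) by simp
  then have "z \<in> - U" by (rule closed_sequentially[OF _ _ s(2)]) (use ct(4) in auto)
  then show False using U(2)[OF s(3,4)] by simp
qed

definition unique_zero :: "real \<Rightarrow> real \<Rightarrow> bool" where
  "unique_zero x y \<longleftrightarrow> (\<exists>!\<tau>. \<tau> \<in> F0 \<and> f_hom x y \<tau> = 0)"

lemma unique_zeroI:
  assumes "w \<in> F0" "f_hom x y w = 0" "\<And>\<tau>. \<tau> \<in> F0 \<Longrightarrow> f_hom x y \<tau> = 0 \<Longrightarrow> \<tau> = w"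
  shows "unique_zero x y"
  unfolding unique_zero_def using assms by (intro ex1I[of _ w] conjI) blast+

lemma unique_zeroD:
  assumes "unique_zero x y" "w \<in> F0" "f_hom x y w = 0" "w' \<in> F0" "f_hom x y w' = 0"
  shows "w = w'"
  using assms unfolding unique_zero_def by blast

lemma zero_persists_F0:
  assumes "z \<in> F0" "f_hom C 1 z = 0" "\<epsilon> > 0"
  obtains \<rho> where "0 < \<rho>" "\<rho> \<le> \<epsilon>" "cball z \<rho> \<subseteq> F0"
    "\<forall>\<^sub>F C' in nhds C. \<exists>!w. w \<in> cball z \<rho> \<and> f_hom C' 1 w = 0"
proof -
  have "z \<in> F0_int" by (rule f_hom_zero_interior[OF assms(1) _ assms(2)]) simp
  then obtain e where e: "e > 0" "cball z e \<subseteq> F0_int" using open_F0_int open_contains_cball by blast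
  obtain \<rho> where "0 < \<rho>" "\<rho> \<le> min e \<epsilon>" "\<forall>\<^sub>F C' in nhds C. \<exists>!w. w \<in> cball z \<rho> \<and> f_hom C' 1 w = 0"
    by (rule f_hom_zero_persists[OF F0_D(1)[OF assms(1)] assms(2), of "min e \<epsilon>"]) (use e assms(3) in auto)
  moreover have "cball z \<rho> \<subseteq> cball z e" using \<open>\<rho> \<le> min e \<epsilon>\<close> by (intro subset_cball) simp
  then have "cball z \<rho> \<subseteq> F0" using e(2) F0_int_subset by blast
  ultimately show thesis using that by auto
qed

text \<open>The negation must be stable as well: absence of zeros by compactness, and two distinct
  zeros because they persist in disjoint balls.\<close>

lemma unique_zero_locally_constant:
  assumes C0: "C0 > 1"
  shows "\<forall>\<^sub>F C in nhds C0. unique_zero C 1 \<longleftrightarrow> unique_zero C0 1"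
proof (cases "\<exists>z\<in>F0. f_hom C0 1 z = 0")
  case False
  have "\<forall>\<^sub>F C in nhds C0. \<forall>\<tau>\<in>F0. f_hom C 1 \<tau> = 0 \<longrightarrow> \<tau> \<in> {}"
    by (rule zeros_stay_near[OF C0 open_empty]) (use False in blast)
  then show ?thesis
  proof eventually_elim
    case (elim C)
    then have "\<not> unique_zero C 1" unfolding unique_zero_def by blast
    moreover have "\<not> unique_zero C0 1" using False unfolding unique_zero_def by blast
    ultimately show ?case by simp
  qed
next
  case True
  then obtain z where z: "z \<in> F0" "f_hom C0 1 z = 0" by blast
  show ?thesis
  proof (cases "unique_zero C0 1")
    case True
    have u: "\<tau> = z" if "\<tau> \<in> F0" "f_hom C0 1 \<tau> = 0" for \<tau> by (rule unique_zeroD[OF True that z])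
    obtain \<rho> where \<rho>: "0 < \<rho>" "cball z \<rho> \<subseteq> F0" "\<forall>\<^sub>F C' in nhds C0. \<exists>!w. w \<in> cball z \<rho> \<and> f_hom C' 1 w = 0"
      using zero_persists_F0[OF z, of 1] by auto
    have "\<forall>\<^sub>F C in nhds C0. \<forall>\<tau>\<in>F0. f_hom C 1 \<tau> = 0 \<longrightarrow> \<tau> \<in> ball z \<rho>"
    proof (rule zeros_stay_near[OF C0 open_ball])
      fix \<tau> assume "\<tau> \<in> F0" "f_hom C0 1 \<tau> = 0"
      from u[OF this] show "\<tau> \<in> ball z \<rho>" using \<rho>(1) by simp
    qed
    with \<rho>(3) show ?thesis
    proof eventually_elim
      case (elim C)
      obtain w where w: "w \<in> cball z \<rho>" "f_hom C 1 w = 0" using elim(1) by blast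
      have "unique_zero C 1"
      proof (rule unique_zeroI)
        show "w \<in> F0" using w(1) \<rho>(2) by blast
        fix \<tau> assume t: "\<tau> \<in> F0" "f_hom C 1 \<tau> = 0"
        then have "\<tau> \<in> ball z \<rho>" using elim(2) by blast
        then have "\<tau> \<in> cball z \<rho>" by simp
        then show "\<tau> = w" using elim(1) w t(2) by blast
      qed (rule w(2))
      then show ?case using True by simp
    qed
  next
    case False
    then obtain z' where z': "z' \<in> F0" "f_hom C0 1 z' = 0" "z' \<noteq> z" using unique_zeroI[OF z] False by metis
    define \<epsilon> where "\<epsilon> = dist z z' / 3"
    have \<epsilon>: "\<epsilon> > 0" using z'(3) by (simp add: \<epsilon>_def)
    obtain \<rho> where \<rho>: "\<rho> \<le> \<epsilon>" "cball z \<rho> \<subseteq> F0" "\<forall>\<^sub>F C' in nhds C0. \<exists>!w. w \<in> cball z \<rho> \<and> f_hom C' 1 w = 0"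
      using zero_persists_F0[OF z \<epsilon>] by auto
    obtain \<rho>' where \<rho>': "\<rho>' \<le> \<epsilon>" "cball z' \<rho>' \<subseteq> F0" "\<forall>\<^sub>F C' in nhds C0. \<exists>!w. w \<in> cball z' \<rho>' \<and> f_hom C' 1 w = 0"
      using zero_persists_F0[OF z'(1,2) \<epsilon>] by auto
    from \<rho>(3) \<rho>'(3) show ?thesis
    proof eventually_elim
      case (elim C)
      obtain w w' where w: "w \<in> cball z \<rho>" "f_hom C 1 w = 0" "w' \<in> cball z' \<rho>'" "f_hom C 1 w' = 0" using elim by blast
      have "w \<noteq> w'"
      proof
        assume "w = w'"
        then have "dist z w \<le> \<epsilon>" "dist w z' \<le> \<epsilon>" using w(1,3) \<rho>(1) \<rho>'(1) by (auto simp: dist_commute)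
        then show False using dist_triangle[of z z' w] \<epsilon> unfolding \<epsilon>_def by linarith
      qed
      moreover have "w \<in> F0" "w' \<in> F0" using w(1,3) \<rho>(2) \<rho>'(2) by blast+
      ultimately have "\<not> unique_zero C 1" using unique_zeroD[of C 1 w w'] w(2,4) by metis
      then show ?case using False by simp
    qed
  qed
qed

text \<open>Zeros of bounded height for \<open>C\<close> tending to \<open>\<infinity>\<close> would
  converge to a zero in \<open>F0\<close> for the parameter \<open>\<infinity>\<close>, which does
  not exist. So for large \<open>C\<close> every zero is near the cusp, where existence and
  uniqueness are known.\<close>

lemma unique_zero_large: "\<exists>C>1. unique_zero C 1"
proof -
  obtain Y B r m where "cusp_expansion Y B r m" using cusp_expansion_exists by blast
  then interpret cusp_expansion Y B r m .
  have "\<exists>C1. \<forall>C\<ge>C1. \<forall>\<tau>\<in>F0. f_hom C 1 \<tau> = 0 \<longrightarrow> Im \<tau> \<ge> strip_start"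
  proof (rule ccontr)
    assume nt: "\<not> ?thesis"
    have "\<exists>C \<tau>. C \<ge> real n + 2 \<and> \<tau> \<in> F0 \<and> f_hom C 1 \<tau> = 0 \<and> Im \<tau> < strip_start" for n
    proof (rule ccontr)
      assume "\<nexists>C \<tau>. C \<ge> real n + 2 \<and> \<tau> \<in> F0 \<and> f_hom C 1 \<tau> = 0 \<and> Im \<tau> < strip_start"
      then have "\<forall>C\<ge>real n + 2. \<forall>\<tau>\<in>F0. f_hom C 1 \<tau> = 0 \<longrightarrow> strip_start \<le> Im \<tau>" unfolding not_less[symmetric] by blast
      then show False using nt by blast
    qed
    then obtain c t where ct: "\<And>n. c n \<ge> real n + 2" "\<And>n. t n \<in> F0" "\<And>n. f_hom (c n) 1 (t n) = 0" "\<And>n. Im (t n) < strip_start"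
      by metis
    obtain Y' where Y': "\<And>\<tau> C. \<tau> \<in> F0 \<Longrightarrow> 2 \<le> C \<Longrightarrow> f_hom C 1 \<tau> = 0 \<Longrightarrow> Im (rot \<tau>) \<le> Y' \<and> Im (rot (rot \<tau>)) \<le> Y'"
      by (rule zeros_bounded[of 2 0]) auto
    have c2: "c n \<ge> 2" for n using ct(1)[of n] by linarith
    have rb: "Im (rot (t n)) \<le> max Y' strip_start" "Im (rot (rot (t n))) \<le> max Y' strip_start" for n
      using Y'[OF ct(2) c2 ct(3)] by (auto intro: max.coboundedI1)
    have tb: "Im (t n) \<le> max Y' strip_start" for n using ct(4)[of n] by simp
    \<comment> \<open>Rescaling the parameters to \<open>(1, 1 / C)\<close> makes the limit at
      \<open>\<infinity>\<close> finite.\<close>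
    have z: "f_hom 1 (1 / c n) (t n) = 0" for n
      using f_hom_zero_scale[of "c n" 1 "1 / c n" "t n"] ct(3)[of n] c2[of n] by simp
    have l: "(\<lambda>n. 1 / c n) \<longlonglongrightarrow> 0"
    proof (rule real_tendsto_sandwich[of "\<lambda>_. 0" _ _ "\<lambda>n. inverse (real (Suc n))"])
      have "0 \<le> 1 / c n" for n using c2[of n] by simp
      then show "\<forall>\<^sub>F n in sequentially. 0 \<le> 1 / c n" by (auto intro: always_eventually)
      have "1 / c n \<le> inverse (real (Suc n))" for n
        unfolding inverse_eq_divide using ct(1)[of n] by (intro divide_left_mono mult_pos_pos) auto
      then show "\<forall>\<^sub>F n in sequentially. 1 / c n \<le> inverse (real (Suc n))" by (auto intro: always_eventually)
    qed (rule tendsto_const LIMSEQ_inverse_real_of_nat)+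
    obtain s w where "w \<in> F0" "f_hom 1 0 w = 0"
      by (rule F0_zeros_compact[OF ct(2) z tendsto_const l tb rb])
    then show False using f_hom_1_0_nonzero_F0 by blast
  qed
  then obtain C1 where C1: "\<And>C \<tau>. C \<ge> C1 \<Longrightarrow> \<tau> \<in> F0 \<Longrightarrow> f_hom C 1 \<tau> = 0 \<Longrightarrow> Im \<tau> \<ge> strip_start" by blast
  obtain C \<tau> where C: "C > max C1 (1 + B)" "\<tau> \<in> F0" "f_hom C 1 \<tau> = 0"
    using zero_exists_near_cusp by blast
  have "unique_zero C 1"
  proof (rule unique_zeroI[OF C(2,3)])
    fix \<tau>' assume t: "\<tau>' \<in> F0" "f_hom C 1 \<tau>' = 0"
    have CC: "C \<ge> C1" "C > 1 + B" using C(1) by simp_all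
    show "\<tau>' = \<tau>"
      by (rule zero_unique_near_cusp[OF t(1) C(2) C1[OF CC(1) t] C1[OF CC(1) C(2,3)] CC(2) t(2) C(3)])
  qed
  moreover have "C > 1" using C(1) B_nonneg by simp
  ultimately show ?thesis by blast
qed

lemma unique_zero_gt_1:
  assumes "C > 1" shows "unique_zero C 1"
proof -
  obtain C1 where C1: "C1 > 1" "unique_zero C1 1" using unique_zero_large by blast
  show ?thesis
  proof (rule connected_induction_simple[of "{1<..}" C1 C "\<lambda>C. unique_zero C 1"])
    fix a :: real assume a: "a \<in> {1<..}"
    then have "\<forall>\<^sub>F C in nhds a. unique_zero C 1 \<longleftrightarrow> unique_zero a 1" by (intro unique_zero_locally_constant) simp
    then obtain S where S: "open S" "a \<in> S" "\<forall>C\<in>S. unique_zero C 1 \<longleftrightarrow> unique_zero a 1"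
      unfolding eventually_nhds by blast
    have "openin (top_of_set {1<..}) ({1<..} \<inter> S)" using S(1) by (rule openin_open_Int)
    moreover have "\<forall>x\<in>{1<..} \<inter> S. \<forall>y\<in>{1<..} \<inter> S. unique_zero x 1 \<longrightarrow> unique_zero y 1" using S(3) by blast
    moreover have "a \<in> {1<..} \<inter> S" using a S(2) by simp
    ultimately show "\<exists>T. openin (top_of_set {1<..}) T \<and> a \<in> T \<and> (\<forall>x\<in>T. \<forall>y\<in>T. unique_zero x 1 \<longrightarrow> unique_zero y 1)"
      by blast
  next
    show "connected {1::real<..}" by simp
    show "C1 \<in> {1<..}" "C \<in> {1<..}" using C1(1) assms by simp_all
    show "unique_zero C1 1" by (rule C1(2))
  qed
qed

lemma unique_zero_rot:
  assumes "unique_zero (x - y) x"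
  shows "unique_zero x y"
proof -
  obtain \<sigma> where \<sigma>: "\<sigma> \<in> F0" "f_hom (x - y) x \<sigma> = 0" "\<And>\<tau>. \<tau> \<in> F0 \<Longrightarrow> f_hom (x - y) x \<tau> = 0 \<Longrightarrow> \<tau> = \<sigma>"
    using assms unfolding unique_zero_def by blast
  show ?thesis
  proof (rule unique_zeroI[OF rot_F0[OF \<sigma>(1)]])
    show "f_hom x y (rot \<sigma>) = 0" using f_hom_rot[OF F0_D(1)[OF \<sigma>(1)], of x y] \<sigma>(2) by simp
    fix \<tau> assume t: "\<tau> \<in> F0" "f_hom x y \<tau> = 0"
    have F: "rot (rot \<tau>) \<in> F0" by (intro rot_F0 t)
    have r: "rot (rot (rot \<tau>)) = \<tau>" by (rule rot_rot_rot(1)[OF F0_D(1)[OF t(1)]])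
    then have "f_hom (x - y) x (rot (rot \<tau>)) = 0" using f_hom_rot[OF F0_D(1)[OF F], of x y] t(2) by simp
    from \<sigma>(3)[OF F this] r show "\<tau> = rot \<sigma>" by metis
  qed
qed

text \<open>The map \<open>C \<mapsto> (C - 1) / C\<close> sends negative \<open>C\<close> into
  \<open>(1, \<infinity>)\<close> and \<open>(0, 1)\<close> to the negative numbers, so the case
  \<open>C > 1\<close> yields the others in turn.\<close>

lemma unique_zero_step:
  assumes "C \<noteq> 0" "unique_zero ((C - 1) / C) 1" shows "unique_zero C 1"
proof (rule unique_zero_rot)
  have "f_hom (C - 1) C \<tau> = 0 \<longleftrightarrow> f_hom ((C - 1) / C) 1 \<tau> = 0" for \<tau> by (rule f_hom_zero_iff[OF assms(1)])
  then show "unique_zero (C - 1) C" using assms(2) by (simp only: unique_zero_def)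
qed

lemma unique_zero_real:
  assumes "C \<noteq> 0" "C \<noteq> 1" shows "unique_zero C 1"
proof -
  have neg: "unique_zero C 1" if "C < 0" for C
  proof (rule unique_zero_step)
    have "(C - 1) / C = 1 - 1 / C" using that by (simp add: diff_divide_distrib)
    moreover have "1 / C < 0" using that by (intro divide_pos_neg) auto
    ultimately have "1 < (C - 1) / C" by linarith
    then show "unique_zero ((C - 1) / C) 1" by (rule unique_zero_gt_1)
  qed (use that in simp)
  consider "C < 0" | "0 < C" "C < 1" | "C > 1" using assms by linarith
  then show ?thesis
  proof cases
    case 1
    then show ?thesis by (rule neg)
  next
    case 2
    then have "(C - 1) / C < 0" by (intro divide_neg_pos) auto
    from unique_zero_step[OF assms(1) neg[OF this]] show ?thesis .
  next
    case 3
    then show ?thesis by (rule unique_zero_gt_1)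
  qed
qed

lemma tau_zero:
  assumes "C \<noteq> 0" "C \<noteq> 1"
  shows "tau_zero C \<in> F0" "f_hom C 1 (tau_zero C) = 0" "\<And>\<tau>. \<tau> \<in> F0 \<Longrightarrow> f_hom C 1 \<tau> = 0 \<Longrightarrow> \<tau> = tau_zero C"
proof -
  have u: "\<exists>!\<tau>. \<tau> \<in> F0 \<and> f_hom C 1 \<tau> = 0"
    using unique_zero_real[OF assms] unfolding unique_zero_def .
  have t: "tau_zero C = (THE \<tau>. \<tau> \<in> F0 \<and> f_hom C 1 \<tau> = 0)"
    by (simp only: tau_zero_def f_fam_eq_f_hom)
  show 1: "tau_zero C \<in> F0" "f_hom C 1 (tau_zero C) = 0"
    using theI'[OF u] unfolding t by blast+
  show "\<tau> = tau_zero C" if "\<tau> \<in> F0" "f_hom C 1 \<tau> = 0" for \<tau>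
    using u that 1 by blast
qed

section \<open>Critical points, \<open>Gamma0_2\<close> and the density of its ratios\<close>

lemma Gamma0_2_entries:
  fixes A :: "int^2^2"
  assumes "A \<in> Gamma0_2"
  shows "A $ 1 $ 1 * A $ 2 $ 2 - A $ 1 $ 2 * A $ 2 $ 1 = 1" "even (A $ 2 $ 1)" "odd (A $ 2 $ 2)"
proof -
  show 1: "A $ 1 $ 1 * A $ 2 $ 2 - A $ 1 $ 2 * A $ 2 $ 1 = 1" and 2: "even (A $ 2 $ 1)"
    using assms by (auto simp: Gamma0_2_def det_2)
  show "odd (A $ 2 $ 2)"
  proof
    assume "even (A $ 2 $ 2)"
    then have "even (A $ 1 $ 1 * A $ 2 $ 2 - A $ 1 $ 2 * A $ 2 $ 1)" using 2 by simp
    then show False using 1 by simp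
  qed
qed

text \<open>By parity: the lower left entry is even and the lower right one odd, so the ratio avoids
  the two cusp parameters.\<close>

lemma Gamma0_2_ratio:
  fixes A :: "int^2^2"
  assumes "A \<in> Gamma0_2" "A $ 2 $ 1 \<noteq> 0"
  shows "- real_of_int (A $ 2 $ 2) / real_of_int (A $ 2 $ 1) \<noteq> 0" "- real_of_int (A $ 2 $ 2) / real_of_int (A $ 2 $ 1) \<noteq> 1"
proof -
  note e = Gamma0_2_entries[OF assms(1)]
  show "- real_of_int (A $ 2 $ 2) / real_of_int (A $ 2 $ 1) \<noteq> 0" using e(3) assms(2) by auto
  show "- real_of_int (A $ 2 $ 2) / real_of_int (A $ 2 $ 1) \<noteq> 1"
  proof
    assume "- real_of_int (A $ 2 $ 2) / real_of_int (A $ 2 $ 1) = 1"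
    then have "real_of_int (- (A $ 2 $ 2)) = real_of_int (A $ 2 $ 1)"
      using assms(2) by (subst (asm) divide_eq_1_iff) simp
    then have "- (A $ 2 $ 2) = A $ 2 $ 1" by (simp only: of_int_eq_iff)
    then have "even (- (A $ 2 $ 2))" using e(2) by simp
    then show False using e(3) by simp
  qed
qed

lemma critical_point_moebius_iff:
  fixes A :: "int^2^2"
  assumes "A \<in> Gamma0_2" "\<tau> \<in> F0"
  shows "critical_point_E2 (moebius A \<tau>) \<longleftrightarrow>
    A $ 2 $ 1 \<noteq> 0 \<and> \<tau> = tau_zero (- real_of_int (A $ 2 $ 2) / real_of_int (A $ 2 $ 1))"
proof -
  note e = Gamma0_2_entries[OF assms(1)]
  note I = F0_D(1)[OF assms(2)]
  have nz: "of_int (A $ 2 $ 1) * \<tau> + of_int (A $ 2 $ 2) \<noteq> 0" by (rule moebius_denominator_nonzero[OF I e(1)])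
  have "Im (moebius A \<tau>) > 0" unfolding moebius_def Im_moebius[OF e(1)] using I nz by simp
  then have "critical_point_E2 (moebius A \<tau>) \<longleftrightarrow> f_hom 1 0 (moebius A \<tau>) = 0" by (rule critical_point_E2_iff)
  also have "\<dots> \<longleftrightarrow> f_hom (real_of_int (A $ 2 $ 2)) (- real_of_int (A $ 2 $ 1)) \<tau> = 0"
    unfolding moebius_def f_hom_moebius[OF I e(1)] using nz by simp
  also have "\<dots> \<longleftrightarrow> A $ 2 $ 1 \<noteq> 0 \<and> \<tau> = tau_zero (- real_of_int (A $ 2 $ 2) / real_of_int (A $ 2 $ 1))"
  proof (cases "A $ 2 $ 1 = 0")
    case True
    have "A $ 2 $ 2 \<noteq> 0" using e(3) by auto
    then show ?thesis
      using True f_hom_zero_scale[of "real_of_int (A $ 2 $ 2)" 1 0 \<tau>] f_hom_1_0_nonzero_F0[OF assms(2)] by simp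
  next
    case False
    have "f_hom (real_of_int (A $ 2 $ 2)) (- real_of_int (A $ 2 $ 1)) \<tau> = 0 \<longleftrightarrow>
       f_hom (- real_of_int (A $ 2 $ 2) / real_of_int (A $ 2 $ 1)) 1 \<tau> = 0"
      using f_hom_zero_iff[of "- real_of_int (A $ 2 $ 1)"] False by simp
    also have "\<dots> \<longleftrightarrow> \<tau> = tau_zero (- real_of_int (A $ 2 $ 2) / real_of_int (A $ 2 $ 1))"
      using tau_zero[OF Gamma0_2_ratio[OF assms(1) False]] assms(2) by metis
    finally show ?thesis using False by simp
  qed
  finally show ?thesis .
qed

lemma crit_set_eq:
  "crit_set = {tau_zero (- of_int (A $ 2 $ 2) / of_int (A $ 2 $ 1)) | A. A \<in> Gamma0_2 \<and> A $ 2 $ 1 \<noteq> 0}"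
proof (intro set_eqI iffI)
  fix \<tau> assume "\<tau> \<in> crit_set"
  then show "\<tau> \<in> {tau_zero (- of_int (A $ 2 $ 2) / of_int (A $ 2 $ 1)) | A. A \<in> Gamma0_2 \<and> A $ 2 $ 1 \<noteq> 0}"
    unfolding crit_set_def using critical_point_moebius_iff by blast
next
  fix \<tau> assume "\<tau> \<in> {tau_zero (- of_int (A $ 2 $ 2) / of_int (A $ 2 $ 1)) | A. A \<in> Gamma0_2 \<and> A $ 2 $ 1 \<noteq> 0}"
  then obtain A :: "int^2^2" where A: "A \<in> Gamma0_2" "A $ 2 $ 1 \<noteq> 0" "\<tau> = tau_zero (- of_int (A $ 2 $ 2) / of_int (A $ 2 $ 1))" by blast
  then show "\<tau> \<in> crit_set"
    unfolding crit_set_def using critical_point_moebius_iff[OF A(1)] tau_zero(1)[OF Gamma0_2_ratio[OF A(1,2)]] by blast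
qed

text \<open>Fractions with odd numerator and denominator \<open>2 ^ Suc k\<close> suffice: numerator
  and denominator are coprime, and Bezout coefficients supply the first row of the matrix. The odd
  numerator \<open>n\<close> differs from \<open>2 * (C * 2 ^ k)\<close> by at most 1.\<close>

lemma Gamma0_2_ratios_dense:
  fixes C \<delta> :: real
  assumes "\<delta> > 0"
  obtains A :: "int^2^2" where "A \<in> Gamma0_2" "A $ 2 $ 1 \<noteq> 0" "dist (- of_int (A $ 2 $ 2) / of_int (A $ 2 $ 1)) C < \<delta>"
proof -
  obtain k where k: "(1/2 :: real) ^ k < \<delta>" using real_arch_pow_inv[OF assms, of "1/2"] by auto
  define D :: int where "D = 2 ^ Suc k"
  define n where "n = 2 * \<lfloor>C * 2 ^ k\<rfloor> + 1"
  have "odd n" by (simp add: n_def)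
  then have "coprime (- n) D" by (simp add: D_def)
  then obtain u v where uv: "u * (- n) + v * D = 1" using bezout_int[of "- n" D] by (auto simp: coprime_iff_gcd_eq_1)
  define A :: "int^2^2" where "A = vector [vector [u, - v], vector [D, - n]]"
  have A: "A $ 1 $ 1 = u" "A $ 1 $ 2 = - v" "A $ 2 $ 1 = D" "A $ 2 $ 2 = - n" by (simp_all add: A_def)
  have "A \<in> Gamma0_2" using uv by (simp add: Gamma0_2_def det_2 A) (simp add: D_def)
  moreover have "A $ 2 $ 1 \<noteq> 0" by (simp add: A D_def)
  moreover have "dist (- of_int (A $ 2 $ 2) / of_int (A $ 2 $ 1)) C < \<delta>"
  proof -
    define x where "x = C * 2 ^ k"
    have D: "real_of_int D = 2 * 2 ^ k" by (simp add: D_def)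
    have "\<bar>of_int n - 2 * x\<bar> \<le> 1" unfolding n_def x_def[symmetric] using floor_correct[of x] by (simp add: abs_le_iff) linarith
    then have "\<bar>of_int n - 2 * x\<bar> / (2 * 2 ^ k) \<le> 1 / (2 * 2 ^ k)" by (intro divide_right_mono) auto
    moreover have "of_int n / (2 * 2 ^ k) - C = (of_int n - 2 * x) / (2 * 2 ^ k)" by (simp add: x_def field_simps)
    then have "\<bar>of_int n / (2 * 2 ^ k) - C\<bar> = \<bar>of_int n - 2 * x\<bar> / (2 * 2 ^ k)" by (simp add: abs_divide)
    moreover have "1 / (2 * 2 ^ k) \<le> (1/2 :: real) ^ k" by (simp add: power_divide field_simps)
    ultimately show ?thesis using k by (simp add: dist_real_def A D)
  qed
  ultimately show thesis using that by blast
qed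

lemma curves_eq: "curve_minus \<union> curve_0 \<union> curve_plus = tau_zero ` (- {0, 1})"
proof -
  have "- {0, 1} = {..<0} \<union> {0<..<1} \<union> {1<..} \<union> ({} :: real set)" by auto
  then show ?thesis by (simp add: curve_minus_def curve_0_def curve_plus_def image_Un)
qed

text \<open>Limits are taken in the projective line of parameters \<open>C = x / y\<close>.\<close>
lemma closure_subset_curves:
  assumes S: "S \<subseteq> tau_zero ` (- {0, 1})" and "\<tau> \<in> closure S" "\<tau> \<in> F0"
  shows "\<tau> \<in> tau_zero ` (- {0, 1})"
proof -
  obtain t where t: "\<And>n. t n \<in> S" "t \<longlonglongrightarrow> \<tau>" using assms(2) unfolding closure_sequential by blast
  then have "\<exists>C. C \<noteq> 0 \<and> C \<noteq> 1 \<and> t n = tau_zero C" for n using S by blast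
  then obtain c where c: "\<And>n. c n \<noteq> 0" "\<And>n. c n \<noteq> 1" "\<And>n. t n = tau_zero (c n)" by metis
  \<comment> \<open>Scaling \<open>(C, 1)\<close> to norm 1 gives a convergent subsequence even if
    the parameters are unbounded. The limits on the lines of \<open>\<infinity>\<close>, 0 and 1 are
    then excluded because these parameters have no zeros in \<open>F0\<close>.\<close>
  define k where "k n = 1 / cmod (Complex (c n) 1)" for n
  define p where "p n = of_real (k n) * Complex (c n) 1" for n
  have c0: "cmod (Complex (c n) 1) > 0" for n by (simp add: complex_eq_iff)
  have k0: "k n > 0" for n unfolding k_def using c0[of n] by simp
  have np: "norm (p n) = 1" for n
  proof -
    have "norm (p n) = k n * cmod (Complex (c n) 1)" using k0[of n] by (simp only: p_def norm_mult norm_of_real abs_of_pos)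
    then show ?thesis using c0[of n] by (simp add: k_def)
  qed
  then have "bounded (range p)" by (auto intro!: boundedI[of _ 1])
  then obtain P s where s: "strict_mono s" "(p \<circ> s) \<longlonglongrightarrow> P" using bounded_imp_convergent_subsequence by blast
  have "(\<lambda>n. norm ((p \<circ> s) n)) \<longlonglongrightarrow> norm P" by (rule tendsto_norm[OF s(2)])
  then have P: "norm P = 1" using np by (simp add: LIMSEQ_const_iff)
  have z: "f_hom (Re (p n)) (Im (p n)) (t n) = 0" for n
    using f_hom_scale[of "k n" "c n" 1 "t n"] tau_zero(2)[OF c(1,2)] c(3) by (simp add: p_def)
  have "(\<lambda>n. f_hom (Re ((p \<circ> s) n)) (Im ((p \<circ> s) n)) ((t \<circ> s) n)) \<longlonglongrightarrow> f_hom (Re P) (Im P) \<tau>"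
    by (intro f_hom_tendsto tendsto_Re tendsto_Im s(2) LIMSEQ_subseq_LIMSEQ[OF t(2) s(1)] F0_D(1)[OF assms(3)])
  then have f: "f_hom (Re P) (Im P) \<tau> = 0" using z by (simp add: LIMSEQ_const_iff)
  have y: "Im P \<noteq> 0"
  proof
    assume "Im P = 0"
    then have "Re P \<noteq> 0" using P by (auto simp: cmod_def)
    then show False using f f_hom_zero_scale[of "Re P" 1 0 \<tau>] f_hom_1_0_nonzero_F0[OF assms(3)] \<open>Im P = 0\<close> by simp
  qed
  define C where "C = Re P / Im P"
  have C: "f_hom C 1 \<tau> = 0" using f f_hom_zero_iff[OF y] by (simp add: C_def)
  then have "C \<noteq> 0" "C \<noteq> 1" using f_hom_cusp_nonzero_F0[OF assms(3)] by auto
  then show ?thesis using tau_zero(3)[OF _ _ assms(3) C] by blast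
qed

theorem theorem1p3:
  shows "crit_set =
           {tau_zero (- of_int (A $ 2 $ 2) / of_int (A $ 2 $ 1)) | A. A \<in> Gamma0_2 \<and> A $ 2 $ 1 \<noteq> 0} \<and>
         crit_set \<subseteq> curve_minus \<union> curve_0 \<union> curve_plus \<and>
         closure crit_set \<inter> F0 = curve_minus \<union> curve_0 \<union> curve_plus"
proof (intro conjI)
  show "crit_set = {tau_zero (- of_int (A $ 2 $ 2) / of_int (A $ 2 $ 1)) | A. A \<in> Gamma0_2 \<and> A $ 2 $ 1 \<noteq> 0}"
    by (rule crit_set_eq)
  show sub: "crit_set \<subseteq> curve_minus \<union> curve_0 \<union> curve_plus"
    unfolding crit_set_eq curves_eq using Gamma0_2_ratio by blast
  show "closure crit_set \<inter> F0 = curve_minus \<union> curve_0 \<union> curve_plus"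
  proof (intro equalityI subsetI)
    fix \<tau> assume "\<tau> \<in> closure crit_set \<inter> F0"
    then show "\<tau> \<in> curve_minus \<union> curve_0 \<union> curve_plus"
      using closure_subset_curves[of crit_set \<tau>] sub unfolding curves_eq by blast
  next
    fix \<tau> assume "\<tau> \<in> curve_minus \<union> curve_0 \<union> curve_plus"
    then obtain C where C: "C \<noteq> 0" "C \<noteq> 1" "\<tau> = tau_zero C" unfolding curves_eq by auto
    note z = tau_zero(1,2)[OF C(1,2)]
    \<comment> \<open>The zero \<open>\<tau>\<close> persists near itself for every parameter close
      to \<open>C\<close>, in particular for some ratio from \<open>Gamma0_2\<close>. The ball lies
      in \<open>F0\<close>, so uniqueness identifies the nearby zero with \<open>tau_zero\<close> of
      that ratio.\<close>
    have "\<exists>w\<in>crit_set. dist w \<tau> < e" if e: "e > 0" for e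
    proof -
      obtain \<rho> where \<rho>: "0 < \<rho>" "\<rho> \<le> e / 2" "cball \<tau> \<rho> \<subseteq> F0" "\<forall>\<^sub>F C' in nhds C. \<exists>!w. w \<in> cball \<tau> \<rho> \<and> f_hom C' 1 w = 0"
        unfolding C(3) by (rule zero_persists_F0[OF z half_gt_zero[OF e]])
      then obtain d where d: "d > 0" "\<And>C'. dist C' C < d \<Longrightarrow> \<exists>!w. w \<in> cball \<tau> \<rho> \<and> f_hom C' 1 w = 0"
        unfolding eventually_nhds_metric by blast
      obtain A :: "int^2^2" where A: "A \<in> Gamma0_2" "A $ 2 $ 1 \<noteq> 0" "dist (- of_int (A $ 2 $ 2) / of_int (A $ 2 $ 1)) C < d"
        using Gamma0_2_ratios_dense[OF d(1)] by blast
      obtain w where w: "w \<in> cball \<tau> \<rho>" "f_hom (- of_int (A $ 2 $ 2) / of_int (A $ 2 $ 1)) 1 w = 0"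
        using d(2)[OF A(3)] by blast
      have "w = tau_zero (- of_int (A $ 2 $ 2) / of_int (A $ 2 $ 1))"
        by (rule tau_zero(3)[OF Gamma0_2_ratio[OF A(1,2)] _ w(2)]) (use w(1) \<rho>(3) in blast)
      then have "w \<in> crit_set" unfolding crit_set_eq using A(1,2) by blast
      moreover have "dist w \<tau> < e" using w(1) \<rho>(2) e by (simp add: dist_commute)
      ultimately show ?thesis by blast
    qed
    then have "\<tau> \<in> closure crit_set" by (simp add: closure_approachable)
    then show "\<tau> \<in> closure crit_set \<inter> F0" using z(1) C(3) by simp
  qed
qed

end
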